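(* The following evaluations hold: $$r_{3,14}=(\sqrt 3+\sqrt 2)^{1/2}(2\sqrt 2+\sqrt 7)^{1/6},$$ $$r_{3,7/2}=(\sqrt 3+\sqrt 2)^{1/2}(2\sqrt 2-\sqrt 7)^{1/6},$$ $$r_{2,21}=2^{-1/2}(\sqrt 7+\sqrt 3)^{1/2}(2\sqrt 2+\sqrt 7)^{1/6},$$ $$r_{2,7/3}=2^{-1/2}(\sqrt 7+\sqrt 3)^{1/2}(2\sqrt 2-\sqrt 7)^{1/6}.$$
   Context: For $|x|<1$, $f(-x):=\sum_{m=-\infty}^{\infty}(-1)^m x^{m(3m-1)/2}$. For positive real $k,n$, $$r_{k,n}:=\frac{f(-q)}{k^{1/4}q^{(k-1)/24}f(-q^k)}\ \text{ with } q=e^{-2\pi\sqrt{n/k}}.$$ All roots and fractional powers of positive reals are the positive real ones. *)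

theory Defs
  imports "HOL-Analysis.Analysis"
begin

(* The defining formula is for f(-x), so x is written as - y here.
   The integer m * (3 * m - 1) is even and nonnegative for every integer m,
   so both div and nat are exact. For norm y < 1 the family is absolutely summable;
   outside this disc the value is not meaningful. *)
definition ramanujan_f :: "'a::real_normed_field \<Rightarrow> 'a" where
  "ramanujan_f y = (\<Sum>\<^sub>\<infinity>m::int. (- 1) powi m * (- y) ^ nat (m * (3 * m - 1) div 2))"

(* Meant for k > 0 and n > 0 only. *)
definition r :: "real \<Rightarrow> real \<Rightarrow> real" where
  "r k n =
    (let q = exp (- 2 * pi * sqrt (n / k))
     in ramanujan_f (- q) /
          (k powr (1 / 4) * q powr ((k - 1) / 24) * ramanujan_f (- (q powr k))))"

end

theory Submission
  imports Defs "HOL-Probability.Probability"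
begin

text \<open>
  Put \<open>t = \<surd>(7/6)\<close> and \<open>a, b, c, d = \<eta>(it), \<eta>(2it), \<eta>(3it), \<eta>(6it)\<close>. Up to fourth roots of 2 and 3
  the four values are \<open>b/d\<close>, \<open>a/c\<close>, \<open>c/d\<close> and \<open>a/b\<close>. Two relations between eta quotients
  of level 6, obtained by multiplying the 3-dissections of \<open>\<phi>(-q)\<close> and \<open>\<psi>(q)\<close> over the cube roots
  of unity, express everything through one parameter \<open>h\<close> and give the modular equation of degree 3
  between \<open>a/b\<close> and \<open>c/d\<close> as well as an equation for \<open>ab/(cd)\<close>. A second equation between \<open>a/b\<close> and
  \<open>c/d\<close> is the modular equation of degree 7: the point \<open>i \<surd>(3/14)\<close> is sent to \<open>3it\<close> by multiplication
  by 7 and to \<open>it\<close> by \<open>\<tau> \<mapsto> -1/(2\<tau>)\<close>, under which \<open>\<eta>(\<tau>)/\<eta>(2\<tau>)\<close> is inverted up to the factor \<open>\<surd>2\<close>.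
  The two equations, together with crude numerical bounds that select the right roots, determine all
  four quotients.
\<close>

section \<open>The Jacobi triple product\<close>

text \<open>No space of modular forms is available for comparing coefficients, so every relation
  comes from rearranging an absolutely convergent theta series and rewriting the result by the
  triple product.

  Degree 7 resists this at first: the equation in eta(tau)/eta(2 tau) alone is not the shape of a
  series identity. What a series does give is f f' = f_1 f_1' + f_2 f_2' for Weber's three functions
  at a point and at 7 times it, an identity about the odd exponents in a product of two pentagonal
  series. Eliminating f and f_2 then determines only a cubic expression in the wanted quantity, and
  positivity undoes the cubing.

  The inversion needs only theta values: the cube of eta(it)/eta(2it) is a quotient of two theta
  values that Poisson summation at 1/2 exchanges.

  The equations are symmetric under inversions such as V -> 8/V and X -> 9/X, so they cannot tell a
  root from its mirror image. This is why the numerical bounds may be crude: it is enough to lie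
  above the fixed points of these inversions.\<close>

definition qpoch_inf :: "'a \<Rightarrow> 'a \<Rightarrow> 'a::{real_normed_field,banach}" where
  "qpoch_inf c q = (\<Prod>k. 1 - c * q ^ k)"

lemma convergent_qpoch_inf:
  fixes c q :: "'a::{real_normed_field,banach}"
  assumes "norm q < 1"
  shows "convergent_prod (\<lambda>k. 1 - c * q ^ k)"
proof -
  have "summable (\<lambda>k. norm (1 - c * q ^ k - 1))"
    using assms by (simp add: norm_mult norm_power summable_mult summable_geometric)
  then show ?thesis
    by (intro abs_convergent_prod_imp_convergent_prod)
       (simp add: abs_convergent_prod_conv_summable)
qed

lemma qpoch_inf_LIMSEQ:
  fixes c q :: "'a::{real_normed_field,banach}"
  assumes "norm q < 1"
  shows "(\<lambda>n. \<Prod>k<n. 1 - c * q ^ k) \<longlonglongrightarrow> qpoch_inf c q"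
proof -
  have "(\<lambda>n. \<Prod>k\<le>n. 1 - c * q ^ k) \<longlonglongrightarrow> qpoch_inf c q"
    unfolding qpoch_inf_def by (rule convergent_prod_LIMSEQ[OF convergent_qpoch_inf[OF assms]])
  then have "(\<lambda>n. \<Prod>k<Suc n. 1 - c * q ^ k) \<longlonglongrightarrow> qpoch_inf c q"
    by (simp only: lessThan_Suc_atMost)
  then show ?thesis by (rule LIMSEQ_imp_Suc)
qed

lemma qpoch_inf_nonzero:
  fixes c q :: "'a::{real_normed_field,banach}"
  assumes "norm q < 1" "norm c < 1"
  shows "qpoch_inf c q \<noteq> 0"
proof -
  have "1 - c * q ^ k \<noteq> 0" for k
  proof -
    have "norm (c * q ^ k) \<le> norm c * 1"
      unfolding norm_mult norm_power using assms by (intro mult_left_mono power_le_one) auto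
    with assms have "norm (c * q ^ k) < 1" by simp
    then show ?thesis by (metis eq_iff_diff_eq_0 norm_one less_irrefl)
  qed
  then show ?thesis
    unfolding qpoch_inf_def by (intro prodinf_nonzero convergent_qpoch_inf assms) auto
qed

text \<open>Grouping the finite partial products of length \<open>n * m\<close> by residues modulo
  \<open>m\<close> avoids any rearrangement of an infinite product.\<close>

lemma qpoch_inf_split:
  fixes c q :: "'a::{real_normed_field,banach}"
  assumes "norm q < 1" "m > 0"
  shows "qpoch_inf c q = (\<Prod>r<m. qpoch_inf (c * q ^ r) (q ^ m))"
proof -
  have qm: "norm (q ^ m) < 1"
    using assms by (simp add: norm_power power_less_one_iff)
  have "(\<lambda>n. \<Prod>r<m. \<Prod>k<n. 1 - c * q ^ r * (q ^ m) ^ k) \<longlonglongrightarrow> (\<Prod>r<m. qpoch_inf (c * q ^ r) (q ^ m))"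
    by (intro tendsto_prod qpoch_inf_LIMSEQ qm)
  also have "(\<lambda>n. \<Prod>r<m. \<Prod>k<n. 1 - c * q ^ r * (q ^ m) ^ k) = (\<lambda>n. \<Prod>k<n * m. 1 - c * q ^ k)"
  proof
    fix n
    have "(\<Prod>k<n * m. 1 - c * q ^ k) = (\<Prod>k<n. \<Prod>j\<in>{k*m..<k*m+m}. 1 - c * q ^ j)"
      by (rule prod.nat_group[symmetric])
    also have "\<dots> = (\<Prod>k<n. \<Prod>r<m. 1 - c * q ^ r * (q ^ m) ^ k)"
    proof (rule prod.cong[OF refl])
      fix k
      show "(\<Prod>j\<in>{k*m..<k*m+m}. 1 - c * q ^ j) = (\<Prod>r<m. 1 - c * q ^ r * (q ^ m) ^ k)"
        by (rule prod.reindex_bij_witness[of _ "\<lambda>r. r + k * m" "\<lambda>j. j - k * m"])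
           (auto simp: mult.assoc power_add[symmetric] power_mult[symmetric] add.commute mult.commute[of m])
    qed
    also have "\<dots> = (\<Prod>r<m. \<Prod>k<n. 1 - c * q ^ r * (q ^ m) ^ k)"
      by (rule prod.swap)
    finally show "(\<Prod>r<m. \<Prod>k<n. 1 - c * q ^ r * (q ^ m) ^ k) = (\<Prod>k<n * m. 1 - c * q ^ k)" ..
  qed
  finally have 1: "(\<lambda>n. \<Prod>k<n * m. 1 - c * q ^ k) \<longlonglongrightarrow> (\<Prod>r<m. qpoch_inf (c * q ^ r) (q ^ m))" .
  have "strict_mono (\<lambda>n. n * m)" using assms by (simp add: strict_mono_def)
  from LIMSEQ_subseq_LIMSEQ[OF qpoch_inf_LIMSEQ[OF assms(1), of c] this]
  have "(\<lambda>n. \<Prod>k<n * m. 1 - c * q ^ k) \<longlonglongrightarrow> qpoch_inf c q" by (simp add: o_def)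
  from LIMSEQ_unique[OF this 1] show ?thesis .
qed

lemma qpoch_inf_minus_mult:
  fixes c q :: "'a::{real_normed_field,banach}"
  assumes "norm q < 1"
  shows "qpoch_inf c q * qpoch_inf (- c) q = qpoch_inf (c\<^sup>2) (q\<^sup>2)"
proof -
  have q2: "norm (q\<^sup>2) < 1"
    using assms by (simp add: norm_power power_less_one_iff)
  have "(\<lambda>n. (\<Prod>k<n. 1 - c * q ^ k) * (\<Prod>k<n. 1 - (- c) * q ^ k)) \<longlonglongrightarrow> qpoch_inf c q * qpoch_inf (- c) q"
    by (intro tendsto_mult qpoch_inf_LIMSEQ assms)
  also have "(\<lambda>n. (\<Prod>k<n. 1 - c * q ^ k) * (\<Prod>k<n. 1 - (- c) * q ^ k)) =
     (\<lambda>n. \<Prod>k<n. 1 - c\<^sup>2 * (q\<^sup>2) ^ k)"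
    by (auto simp: prod.distrib[symmetric] algebra_simps power2_eq_square power_mult_distrib
             intro!: prod.cong)
  finally show ?thesis using LIMSEQ_unique qpoch_inf_LIMSEQ[OF q2] by blast
qed

lemma qpoch_inf_of_real:
  "norm q < 1 \<Longrightarrow> qpoch_inf (of_real c) (of_real q) = (of_real (qpoch_inf c q) :: 'a::{real_normed_field,banach})"
proof -
  assume q: "norm q < 1"
  have "(\<lambda>n. of_real (\<Prod>k<n. 1 - c * q ^ k) :: 'a) \<longlonglongrightarrow> of_real (qpoch_inf c q)"
    by (intro tendsto_of_real qpoch_inf_LIMSEQ q)
  moreover have "(\<lambda>n. of_real (\<Prod>k<n. 1 - c * q ^ k) :: 'a) \<longlonglongrightarrow> qpoch_inf (of_real c) (of_real q)"
    using qpoch_inf_LIMSEQ[of "of_real q :: 'a" "of_real c"] q by simp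
  ultimately show ?thesis using LIMSEQ_unique by blast
qed

text \<open>One function serves both exponents of a theta series: \<open>tri (- n)\<close> is
  n(n-1)/2, and \<open>tri n + tri (- n)\<close> is the square of n. The value is a natural number,
  so plain powers work in any field.\<close>

definition tri :: "int \<Rightarrow> nat" where "tri n = nat (n * (n + 1) div 2)"

lemma tri_eq: "2 * int (tri n) = n * (n + 1)"
proof -
  have "n * (n + 1) \<ge> 0" by (cases "n \<ge> 0") (auto simp: zero_le_mult_iff)
  moreover have "even (n * (n + 1))" by simp
  ultimately show ?thesis by (simp add: tri_def)
qed

lemma tri_minus_eq: "2 * int (tri (- n)) = n * (n - 1)"
  using tri_eq[of "- n"] by (simp add: algebra_simps)

lemma tri_add_tri_minus: "int (tri m + tri (- m)) = m * m"
proof -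
  have "2 * int (tri m + tri (- m)) = 2 * (m * m)"
    unfolding of_nat_add distrib_left tri_eq tri_minus_eq by (simp add: algebra_simps)
  then show ?thesis by simp
qed

text \<open>Ramanujan's theta function \<open>f(a, b)\<close>; \<open>\<phi>(q) = f(q, q)\<close> and \<open>2 \<psi>(q) = f(1, q)\<close>.\<close>

definition ram_theta :: "'a \<Rightarrow> 'a \<Rightarrow> 'a::{real_normed_field,banach}" where
  "ram_theta a b = (\<Sum>\<^sub>\<infinity>n::int. a ^ tri n * b ^ tri (- n))"

text \<open>Consecutive terms have ratio \<open>x * (x * y) ^ n\<close>, which tends to 0 even if
  \<open>x\<close> is large. Only the product of the arguments has to be small, and this admits the
  argument 1 of the psi series.\<close>

lemma summable_tri_nat:
  fixes x y :: real
  assumes "x > 0" "y > 0" "x * y < 1"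
  shows "summable (\<lambda>n. x ^ tri (int n) * y ^ tri (- int n))"
proof -
  let ?f = "\<lambda>n. x ^ tri (int n) * y ^ tri (- int n)"
  have step: "?f (Suc n) = ?f n * (x * (x * y) ^ n)" for n
  proof -
    have "tri (int (Suc n)) = tri (int n) + Suc n"
      using tri_eq[of "int n"] tri_eq[of "int (Suc n)"] by (simp add: algebra_simps)
    moreover have "tri (- int (Suc n)) = tri (- int n) + n"
      using tri_minus_eq[of "int n"] tri_minus_eq[of "int (Suc n)"] by (simp add: algebra_simps)
    ultimately show ?thesis by (simp only: power_add power_Suc power_mult_distrib mult_ac)
  qed
  have "(\<lambda>n. x * (x * y) ^ n) \<longlonglongrightarrow> x * 0"
    using assms by (intro tendsto_mult tendsto_const LIMSEQ_realpow_zero) auto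
  then have "\<forall>\<^sub>F n in sequentially. x * (x * y) ^ n < 1 / 2"
    by (rule order_tendstoD) simp
  then obtain N where N: "\<And>n. n \<ge> N \<Longrightarrow> x * (x * y) ^ n < 1 / 2"
    by (auto simp: eventually_sequentially)
  show ?thesis
  proof (rule summable_ratio_test[of "1/2" N])
    fix n assume "n \<ge> N"
    have 0: "0 \<le> ?f n" "0 \<le> x * (x * y) ^ n" "0 \<le> ?f (Suc n)" using assms by auto
    have "?f (Suc n) \<le> ?f n * (1 / 2)"
      unfolding step using N[OF \<open>n \<ge> N\<close>] 0(1) by (intro mult_left_mono) auto
    then show "norm (?f (Suc n)) \<le> 1/2 * norm (?f n)"
      unfolding real_norm_def abs_of_nonneg[OF 0(1)] abs_of_nonneg[OF 0(3)] by simp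
  qed simp
qed

lemma summable_on_int:
  fixes f :: "int \<Rightarrow> real"
  assumes "\<And>n. f n \<ge> 0" "summable (\<lambda>n. f (int n))" "summable (\<lambda>n. f (- int n))"
  shows "f summable_on UNIV"
proof -
  have 1: "f summable_on range int"
    using assms by (subst summable_on_reindex) (auto simp: o_def summable_on_UNIV_nonneg_real_iff)
  have 2: "f summable_on range (\<lambda>n. - int n)"
    using assms by (subst summable_on_reindex) (auto simp: o_def summable_on_UNIV_nonneg_real_iff inj_def)
  have "UNIV = range int \<union> range (\<lambda>n. - int n)"
  proof (safe; simp)
    fix x :: int assume "x \<notin> range (\<lambda>n. - int n)"
    moreover have "x = - int (nat (- x))" if "x < 0" using that by simp
    ultimately have "x \<ge> 0" by (metis not_le rangeI)
    then show "x \<in> range int" by (metis nat_eq_iff rangeI)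
  qed
  then show ?thesis using summable_on_union[OF 1 2] by simp
qed

lemma ram_theta_abs_summable:
  fixes a b :: "'a::{real_normed_field,banach}"
  assumes "a \<noteq> 0" "b \<noteq> 0" "norm (a * b) < 1"
  shows "(\<lambda>n. norm (a ^ tri n * b ^ tri (- n))) summable_on UNIV"
proof (rule summable_on_int)
  show "summable (\<lambda>n. norm (a ^ tri (int n) * b ^ tri (- int n)))"
    using summable_tri_nat[of "norm a" "norm b"] assms by (simp add: norm_mult norm_power)
  show "summable (\<lambda>n. norm (a ^ tri (- int n) * b ^ tri (- (- int n))))"
    using summable_tri_nat[of "norm b" "norm a"] assms by (simp add: norm_mult norm_power mult_ac)
qed auto

lemma ram_theta_summable:
  fixes a b :: "'a::{real_normed_field,banach}"
  assumes "a \<noteq> 0" "b \<noteq> 0" "norm (a * b) < 1"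
  shows "(\<lambda>n. a ^ tri n * b ^ tri (- n)) summable_on UNIV"
  by (rule abs_summable_summable[OF ram_theta_abs_summable[OF assms]])

text \<open>Dominated convergence for bilateral series: \<open>int_decode\<close> transports the
  family to the naturals, where Tannery's theorem applies.\<close>

lemma tannery_int:
  fixes f :: "nat \<Rightarrow> int \<Rightarrow> 'a::{real_normed_field,banach}"
  assumes lim: "\<And>k. (\<lambda>n. f n k) \<longlonglongrightarrow> g k"
    and bound: "\<And>n k. norm (f n k) \<le> M k" and M: "M summable_on UNIV"
  shows "(\<lambda>n. \<Sum>\<^sub>\<infinity>k. f n k) \<longlonglongrightarrow> (\<Sum>\<^sub>\<infinity>k. g k)"
proof -
  have Mn: "(\<lambda>k. M (int_decode k)) summable_on UNIV"
    using M summable_on_reindex_bij_betw[OF bij_int_decode, of M] by simp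
  have sumM: "summable (\<lambda>k. M (int_decode k))"
    by (rule summable_on_imp_summable[OF Mn])
  have eq: "(\<Sum>\<^sub>\<infinity>k. h k) = (\<Sum>k. h (int_decode k))" if h: "\<And>k. norm (h k) \<le> M k" for h :: "int \<Rightarrow> 'a"
  proof -
    have "(\<lambda>k. norm (h (int_decode k))) summable_on UNIV"
      by (rule summable_on_comparison_test[OF Mn]) (use h in auto)
    then have "(\<lambda>k. h (int_decode k)) summable_on UNIV" by (rule abs_summable_summable)
    then have "(\<lambda>k. h (int_decode k)) sums (\<Sum>\<^sub>\<infinity>k. h (int_decode k))"
      by (intro has_sum_imp_sums) auto
    then show ?thesis
      using infsum_reindex_bij_betw[OF bij_int_decode, of h] by (simp add: sums_iff)
  qed
  have g: "norm (g k) \<le> M k" for k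
    by (rule LIMSEQ_le_const2[OF tendsto_norm[OF lim]]) (use bound in auto)
  have "(\<lambda>n. \<Sum>k. f n (int_decode k)) \<longlonglongrightarrow> (\<Sum>k. g (int_decode k))"
    by (rule conjunct2[OF conjunct2[OF tannerys_theorem[where M = "\<lambda>k. M (int_decode k)"]]])
       (use lim bound sumM in \<open>auto simp: case_prod_unfold\<close>)
  then show ?thesis using eq[OF bound] eq[OF g] by simp
qed

section \<open>Gaussian binomial coefficients and the finite triple product\<close>

definition qpoch :: "'a \<Rightarrow> nat \<Rightarrow> 'a::{real_normed_field,banach}" where
  "qpoch q n = (\<Prod>k<n. 1 - q * q ^ k)"

definition qbinom :: "'a \<Rightarrow> nat \<Rightarrow> nat \<Rightarrow> 'a::{real_normed_field,banach}" where
  "qbinom q N i = (if i \<le> N then qpoch q N / (qpoch q i * qpoch q (N - i)) else 0)"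

lemma qpoch_0 [simp]: "qpoch q 0 = 1" and qpoch_Suc: "qpoch q (Suc n) = qpoch q n * (1 - q ^ Suc n)"
  by (simp_all add: qpoch_def)

lemma qpoch_nonzero:
  fixes q :: "'a::{real_normed_field,banach}"
  assumes "norm q < 1"
  shows "qpoch q n \<noteq> 0"
proof -
  have "norm (q ^ Suc k) < 1" for k
    using power_less_one_iff[of "norm q" "Suc k"] assms unfolding norm_power by simp
  then have "1 - q * q ^ k \<noteq> 0" for k
    by (metis eq_iff_diff_eq_0 norm_one less_irrefl power_Suc)
  then show ?thesis by (simp add: qpoch_def)
qed

lemma qpoch_LIMSEQ: "norm q < 1 \<Longrightarrow> qpoch q \<longlonglongrightarrow> qpoch_inf q q"
  unfolding qpoch_def by (rule qpoch_inf_LIMSEQ)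

lemma qbinom_0 [simp]:
  fixes q :: "'a::{real_normed_field,banach}"
  shows "norm q < 1 \<Longrightarrow> qbinom q N 0 = 1"
  by (simp add: qbinom_def qpoch_nonzero)

lemma qbinom_Suc_Suc:
  fixes q :: "'a::{real_normed_field,banach}"
  assumes q: "norm q < 1" and i: "i \<le> N"
  shows "qbinom q (Suc N) (Suc i) = qbinom q N (Suc i) + q ^ (N - i) * qbinom q N i"
proof (cases "i = N")
  case True
  then show ?thesis using q by (simp add: qbinom_def qpoch_nonzero)
next
  case False
  with i obtain m where N: "N = Suc (i + m)" by (metis less_imp_Suc_add le_neq_implies_less)
  have nz: "qpoch q k \<noteq> 0" "1 - q ^ Suc k \<noteq> 0" for k
    using qpoch_nonzero[OF q, of k] qpoch_nonzero[OF q, of "Suc k"] by (auto simp: qpoch_Suc)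
  have Ni: "N - i = Suc m" "Suc N - Suc i = Suc m" "N - Suc i = m" using N by auto
  have le: "Suc i \<le> Suc N" "Suc i \<le> N" "i \<le> N" using N by auto
  have key: "1 - q ^ Suc N = (1 - q ^ Suc m) + q ^ Suc m * (1 - q ^ Suc i)"
    by (simp add: N power_add algebra_simps)
  have "qpoch q (Suc N) / (qpoch q (Suc i) * qpoch q (Suc m)) =
        qpoch q N / (qpoch q (Suc i) * qpoch q m) + q ^ Suc m * (qpoch q N / (qpoch q i * qpoch q (Suc m)))"
    unfolding qpoch_Suc key using nz by (simp add: divide_simps del: power_Suc) (simp add: algebra_simps)
  then show ?thesis by (simp only: qbinom_def Ni le if_True)
qed

lemma choose_two_Suc: "Suc n choose 2 = (n choose 2) + n"
  by (simp add: numeral_2_eq_2)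

lemma two_choose_two: "2 * int (n choose 2) = int n * (int n - 1)"
  by (induction n) (simp_all add: choose_two_Suc algebra_simps)

text \<open>Cauchy's q-binomial theorem, kept homogeneous in \<open>x\<close> and \<open>y\<close>
  so that \<open>x\<close> can later be a power of \<open>q\<close>; negative exponents never
  appear.\<close>

lemma q_binomial:
  fixes q x y :: "'a::{real_normed_field,banach}"
  assumes q: "norm q < 1"
  shows "(\<Prod>k<N. x + y * q ^ k) = (\<Sum>i\<le>N. qbinom q N i * (q ^ (i choose 2) * y ^ i * x ^ (N - i)))"
proof (induction N)
  case (Suc N)
  let ?T = "\<lambda>i. q ^ (i choose 2) * y ^ i * x ^ (Suc N - i)"
  let ?t = "\<lambda>i. q ^ (i choose 2) * y ^ i * x ^ (N - i)"
  have "(\<Sum>i\<le>Suc N. qbinom q (Suc N) i * ?T i) =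
      ?T 0 + (\<Sum>i\<le>N. qbinom q (Suc N) (Suc i) * ?T (Suc i))"
    by (subst sum.atMost_Suc_shift) (simp add: q)
  also have "(\<Sum>i\<le>N. qbinom q (Suc N) (Suc i) * ?T (Suc i)) =
      (\<Sum>i\<le>N. qbinom q N (Suc i) * ?T (Suc i)) + (\<Sum>i\<le>N. q ^ (N - i) * qbinom q N i * ?T (Suc i))"
    by (subst sum.distrib[symmetric], rule sum.cong) (auto simp: qbinom_Suc_Suc[OF q] distrib_right)
  also have "?T 0 + \<dots> = (\<Sum>i\<le>Suc N. qbinom q N i * ?T i) + (\<Sum>i\<le>N. q ^ (N - i) * qbinom q N i * ?T (Suc i))"
    by (simp only: sum.atMost_Suc_shift qbinom_0[OF q] mult_1_left add.assoc)
  also have "(\<Sum>i\<le>Suc N. qbinom q N i * ?T i) = (\<Sum>i\<le>N. qbinom q N i * ?T i)"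
    by (simp add: qbinom_def)
  also have "\<dots> = (\<Sum>i\<le>N. qbinom q N i * ?t i * x)"
    by (rule sum.cong) (auto simp: Suc_diff_le)
  also have "(\<Sum>i\<le>N. q ^ (N - i) * qbinom q N i * ?T (Suc i)) = (\<Sum>i\<le>N. qbinom q N i * ?t i * (y * q ^ N))"
  proof (rule sum.cong[OF refl])
    fix i assume "i \<in> {..N}"
    then have "N = (N - i) + i" by simp
    then have "q ^ N = q ^ (N - i) * q ^ i" by (metis power_add)
    then show "q ^ (N - i) * qbinom q N i * ?T (Suc i) = qbinom q N i * ?t i * (y * q ^ N)"
      by (simp add: choose_two_Suc power_add)
  qed
  finally show ?case
    unfolding prod.lessThan_Suc Suc.IH sum_distrib_right[symmetric] distrib_left[symmetric] by simp
qed (simp add: q numeral_2_eq_2)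

text \<open>Exponents made of triangular, pentagonal and binomial numbers become integer polynomials
  after doubling, so they are compared in doubled form.\<close>

lemma nat_eqI_double: "2 * int m = 2 * int n \<Longrightarrow> m = n"
  by simp

text \<open>This is the q-binomial theorem with \<open>2 * n\<close> factors,
  \<open>x = (a * b) ^ n\<close> and \<open>y = a\<close>. The upper half of the factors gives the
  product in \<open>a\<close>; the lower half, read backwards, gives the product in
  \<open>b\<close>. Centring the summation index at \<open>n\<close> makes the sum
  bilateral.\<close>

lemma finite_jacobi_triple:
  fixes a b :: "'a::{real_normed_field,banach}"
  assumes nz: "a \<noteq> 0" "b \<noteq> 0" and q: "norm (a * b) < 1"
  shows "(\<Prod>k<n. 1 + a * (a * b) ^ k) * (\<Prod>k<n. 1 + b * (a * b) ^ k) =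
    (\<Sum>i\<le>2 * n. qbinom (a * b) (2 * n) i * (a ^ tri (int i - int n) * b ^ tri (- (int i - int n))))"
proof -
  let ?q = "a * b"
  \<comment> \<open>The monomial that both evaluations of the product have in common; it is
    cancelled at the end because \<open>a\<close> and \<open>b\<close> are nonzero.\<close>
  let ?C = "a ^ n * ?q ^ (n choose 2) * ?q ^ (n * n)"
  have "(\<Prod>k<2*n. ?q ^ n + a * ?q ^ k) = (\<Prod>k<n. ?q ^ n + a * ?q ^ k) * (\<Prod>k<n. ?q ^ n + a * ?q ^ (k + n))"
    using prod.nat_group[of "\<lambda>k. ?q ^ n + a * ?q ^ k" n 2]
    by (simp add: numeral_2_eq_2 lessThan_Suc lessThan_atLeast0 prod.shift_bounds_nat_ivl[where k = n and m = 0 and n = n, symmetric] mult_ac)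
       (simp add: prod.shift_bounds_nat_ivl[where k = n and m = 0 and n = n, simplified] mult_2 mult_ac)
  also have "(\<Prod>k<n. ?q ^ n + a * ?q ^ (k + n)) = (\<Prod>k<n. ?q ^ n * (1 + a * ?q ^ k))"
    by (simp add: power_add algebra_simps)
  also have "\<dots> = ?q ^ (n * n) * (\<Prod>k<n. 1 + a * ?q ^ k)"
    by (simp add: prod.distrib power_mult)
  also have "(\<Prod>k<n. ?q ^ n + a * ?q ^ k) = (\<Prod>k<n. (a * ?q ^ k) * (1 + b * ?q ^ (n - Suc k)))"
  proof (rule prod.cong[OF refl])
    fix k assume "k \<in> {..<n}"
    then have "n = k + Suc (n - Suc k)" by simp
    then have "?q ^ n = ?q ^ k * (?q * ?q ^ (n - Suc k))" by (metis power_add power_Suc)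
    then show "?q ^ n + a * ?q ^ k = (a * ?q ^ k) * (1 + b * ?q ^ (n - Suc k))"
      by (simp add: algebra_simps)
  qed
  also have "\<dots> = (\<Prod>k<n. a * ?q ^ k) * (\<Prod>k<n. 1 + b * ?q ^ k)"
    using prod.nat_diff_reindex[of "\<lambda>k. 1 + b * ?q ^ k" n] by (simp only: prod.distrib)
  also have "(\<Prod>k<n. a * ?q ^ k) = a ^ n * ?q ^ (n choose 2)"
    by (induction n) (simp_all add: choose_two_Suc power_add binomial_eq_0)
  finally have 1: "(\<Prod>k<2*n. ?q ^ n + a * ?q ^ k) =
     ?C * ((\<Prod>k<n. 1 + a * ?q ^ k) * (\<Prod>k<n. 1 + b * ?q ^ k))" by (simp add: mult_ac)
  have "(\<Prod>k<2*n. ?q ^ n + a * ?q ^ k) =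
     (\<Sum>i\<le>2*n. qbinom ?q (2*n) i * (?q ^ (i choose 2) * a ^ i * (?q ^ n) ^ (2 * n - i)))"
    by (rule q_binomial[OF q])
  also have "\<dots> = (\<Sum>i\<le>2*n. ?C * (qbinom ?q (2*n) i * (a ^ tri (int i - int n) * b ^ tri (- (int i - int n)))))"
  proof (rule sum.cong[OF refl])
    fix i assume "i \<in> {..2*n}"
    then have le: "int (2 * n - i) = 2 * int n - int i" by auto
    have "2 * int ((i choose 2) + n * (2 * n - i)) = 2 * int ((n choose 2) + n * n + tri (- (int i - int n)))"
      unfolding of_nat_add of_nat_mult le distrib_left two_choose_two tri_minus_eq by (simp add: algebra_simps)
    then have eb: "(i choose 2) + n * (2 * n - i) = (n choose 2) + n * n + tri (- (int i - int n))" by (rule nat_eqI_double)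
    have "2 * int ((i choose 2) + n * (2 * n - i) + i) = 2 * int (n + (n choose 2) + n * n + tri (int i - int n))"
      unfolding of_nat_add of_nat_mult le distrib_left two_choose_two tri_eq by (simp add: algebra_simps)
    then have ea: "(i choose 2) + n * (2 * n - i) + i = n + (n choose 2) + n * n + tri (int i - int n)" by (rule nat_eqI_double)
    have "?q ^ (i choose 2) * a ^ i * (?q ^ n) ^ (2 * n - i) =
        a ^ ((i choose 2) + n * (2 * n - i) + i) * b ^ ((i choose 2) + n * (2 * n - i))"
      by (simp add: power_add power_mult[symmetric] power_mult_distrib mult_ac)
    also have "\<dots> = ?C * (a ^ tri (int i - int n) * b ^ tri (- (int i - int n)))"
      unfolding ea unfolding eb by (simp only: power_add power_mult_distrib mult_ac)
    finally show "qbinom ?q (2*n) i * (?q ^ (i choose 2) * a ^ i * (?q ^ n) ^ (2 * n - i)) =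
      ?C * (qbinom ?q (2*n) i * (a ^ tri (int i - int n) * b ^ tri (- (int i - int n))))"
      by (simp only: mult_ac)
  qed
  finally have "?C * ((\<Prod>k<n. 1 + a * ?q ^ k) * (\<Prod>k<n. 1 + b * ?q ^ k)) =
    ?C * (\<Sum>i\<le>2*n. qbinom ?q (2*n) i * (a ^ tri (int i - int n) * b ^ tri (- (int i - int n))))"
    unfolding 1 sum_distrib_left[symmetric] .
  moreover have "?C \<noteq> 0" using nz by simp
  ultimately show ?thesis using mult_left_cancel by blast
qed

text \<open>Let \<open>n\<close> tend to infinity in the finite identity. Each recentred q-binomial
  coefficient tends to \<open>inverse ?L\<close>, and all of them share one bound, so the theta
  series itself dominates up to a constant.\<close>

theorem jacobi_triple:
  fixes a b :: "'a::{real_normed_field,banach}"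
  assumes nz: "a \<noteq> 0" "b \<noteq> 0" and q: "norm (a * b) < 1"
  shows "ram_theta a b = qpoch_inf (- a) (a * b) * qpoch_inf (- b) (a * b) * qpoch_inf (a * b) (a * b)"
proof -
  let ?q = "a * b" let ?L = "qpoch_inf ?q ?q"
  let ?T = "\<lambda>j. a ^ tri j * b ^ tri (- j)"
  \<comment> \<open>The finite sums are padded with zeros, so that every \<open>n\<close> gives a
    family over all integers, as dominated convergence requires.\<close>
  define F where "F n j = (if \<bar>j\<bar> \<le> int n then qbinom ?q (2 * n) (nat (j + int n)) else 0) * ?T j" for n j
  have L: "?L \<noteq> 0" using q by (rule qpoch_inf_nonzero[OF _ q])
  have lim: "qpoch ?q \<longlonglongrightarrow> ?L" by (rule qpoch_LIMSEQ[OF q])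
  have "Bseq (qpoch ?q)" using lim by (intro convergent_imp_Bseq) (auto simp: convergent_def)
  then obtain B where B: "B > 0" "\<And>n. norm (qpoch ?q n) \<le> B" by (auto simp: Bseq_def)
  have "Bseq (\<lambda>n. inverse (qpoch ?q n))"
    using tendsto_inverse[OF lim L] by (intro convergent_imp_Bseq) (auto simp: convergent_def)
  then obtain D where D: "D > 0" "\<And>n. norm (inverse (qpoch ?q n)) \<le> D" by (auto simp: Bseq_def)
  have gb: "norm (qbinom ?q N i) \<le> B * (D * D)" for N i
  proof (cases "i \<le> N")
    case True
    then have "norm (qbinom ?q N i) = norm (qpoch ?q N) * (norm (inverse (qpoch ?q i)) * norm (inverse (qpoch ?q (N - i))))"
      by (simp add: qbinom_def norm_divide norm_mult norm_inverse divide_inverse)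
    also have "\<dots> \<le> B * (D * D)"
      using B D by (intro mult_mono) (auto intro: less_imp_le)
    finally show ?thesis .
  qed (use B D in \<open>simp add: qbinom_def\<close>)
  have conv: "(\<lambda>n. \<Sum>\<^sub>\<infinity>j. F n j) \<longlonglongrightarrow> (\<Sum>\<^sub>\<infinity>j. inverse ?L * ?T j)"
  proof (rule tannery_int)
    show "norm (F n j) \<le> B * (D * D) * norm (?T j)" for n j
      using gb B D unfolding F_def norm_mult[of "if _ then _ else _"] by (intro mult_right_mono) auto
    show "(\<lambda>j. B * (D * D) * norm (?T j)) summable_on UNIV"
      by (intro summable_on_cmult_right ram_theta_abs_summable assms)
    fix j
    have 1: "filterlim (\<lambda>n. nat (j + int n)) sequentially sequentially"
      unfolding filterlim_at_top_ge[where c = 0] eventually_sequentially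
      by (intro allI impI, rule_tac x = "Z + nat (- j)" in exI) auto
    have 2: "filterlim (\<lambda>n. 2 * n - nat (j + int n)) sequentially sequentially"
      unfolding filterlim_at_top_ge[where c = 0] eventually_sequentially
      by (intro allI impI, rule_tac x = "Z + nat (- j) + nat j" in exI) auto
    have 3: "filterlim (\<lambda>n::nat. 2 * n) sequentially sequentially"
      unfolding filterlim_at_top_ge[where c = 0] eventually_sequentially
      by (intro allI impI, rule_tac x = "Z" in exI) auto
    have "(\<lambda>n. qpoch ?q (2 * n) / (qpoch ?q (nat (j + int n)) * qpoch ?q (2 * n - nat (j + int n))) * ?T j)
       \<longlonglongrightarrow> ?L / (?L * ?L) * ?T j"
      using L by (intro tendsto_intros filterlim_compose[OF lim 1] filterlim_compose[OF lim 2]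
        filterlim_compose[OF lim 3]) auto
    moreover have "\<forall>\<^sub>F n in sequentially. qpoch ?q (2 * n) / (qpoch ?q (nat (j + int n)) * qpoch ?q (2 * n - nat (j + int n))) * ?T j = F n j"
      unfolding eventually_sequentially
      by (rule exI[of _ "nat \<bar>j\<bar>"]) (auto simp: F_def qbinom_def)
    ultimately show "(\<lambda>n. F n j) \<longlonglongrightarrow> inverse ?L * ?T j"
      using L by (simp add: field_simps tendsto_cong)
  qed
  have fin: "(\<Sum>\<^sub>\<infinity>j. F n j) = (\<Prod>k<n. 1 - (- a) * ?q ^ k) * (\<Prod>k<n. 1 - (- b) * ?q ^ k)" for n
  proof -
    have "(\<Sum>\<^sub>\<infinity>j. F n j) = (\<Sum>\<^sub>\<infinity>j\<in>{- int n..int n}. F n j)"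
      by (rule infsum_cong_neutral) (auto simp: F_def)
    also have "\<dots> = (\<Sum>j\<in>{- int n..int n}. F n j)" by simp
    also have "\<dots> = (\<Sum>i\<le>2 * n. qbinom ?q (2 * n) i * ?T (int i - int n))"
      by (rule sum.reindex_bij_witness[of _ "\<lambda>i. int i - int n" "\<lambda>j. nat (j + int n)"])
         (auto simp: F_def)
    also have "\<dots> = (\<Prod>k<n. 1 + a * ?q ^ k) * (\<Prod>k<n. 1 + b * ?q ^ k)"
      by (rule finite_jacobi_triple[OF nz q, symmetric])
    finally show ?thesis by simp
  qed
  have "(\<lambda>n. \<Sum>\<^sub>\<infinity>j. F n j) \<longlonglongrightarrow> qpoch_inf (- a) ?q * qpoch_inf (- b) ?q"
    unfolding fin by (intro tendsto_mult qpoch_inf_LIMSEQ q)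
  from LIMSEQ_unique[OF this conv] have "qpoch_inf (- a) ?q * qpoch_inf (- b) ?q = inverse ?L * ram_theta a b"
    unfolding ram_theta_def by (simp add: infsum_cmult_right')
  then show ?thesis using L by (simp add: field_simps)
qed

section \<open>Eta quotients of level 6\<close>

definition euler :: "'a \<Rightarrow> 'a::{real_normed_field,banach}" where "euler q = qpoch_inf q q"

lemma euler_nonzero: "norm q < 1 \<Longrightarrow> euler q \<noteq> 0"
  by (simp add: euler_def qpoch_inf_nonzero)

lemma norm_power_lt_1:
  fixes q :: "'a::real_normed_field"
  shows "norm q < 1 \<Longrightarrow> m > 0 \<Longrightarrow> norm (q ^ m) < 1"
  by (simp add: norm_power power_less_one_iff)

lemma qpoch_inf_shift:
  fixes c q :: "'a::{real_normed_field,banach}"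
  assumes q: "norm q < 1"
  shows "qpoch_inf c q = (1 - c) * qpoch_inf (c * q) q"
proof -
  have "(\<lambda>n. \<Prod>k<Suc n. 1 - c * q ^ k) \<longlonglongrightarrow> qpoch_inf c q"
    using qpoch_inf_LIMSEQ[OF q] by (rule LIMSEQ_Suc)
  also have "(\<lambda>n. \<Prod>k<Suc n. 1 - c * q ^ k) = (\<lambda>n. (1 - c) * (\<Prod>k<n. 1 - (c * q) * q ^ k))"
    by (simp add: prod.lessThan_Suc_shift mult_ac del: prod.lessThan_Suc)
  finally show ?thesis
    using LIMSEQ_unique[OF _ tendsto_mult[OF tendsto_const qpoch_inf_LIMSEQ[OF q]]] by blast
qed

lemma qpoch_inf_cube_mult:
  fixes c q w :: "'a::{real_normed_field,banach}"
  assumes q: "norm q < 1" and w: "1 + w + w\<^sup>2 = 0"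
  shows "qpoch_inf c q * qpoch_inf (w * c) q * qpoch_inf (w\<^sup>2 * c) q = qpoch_inf (c ^ 3) (q ^ 3)"
proof -
  have w3: "w ^ 3 = 1" using w by algebra
  have cube: "(1 - x) * (1 - w * x) * (1 - w\<^sup>2 * x) = 1 - x ^ 3" for x
  proof -
    have "(1 - x) * (1 - w * x) * (1 - w\<^sup>2 * x) = 1 - (1 + w + w\<^sup>2) * x + w * (1 + w + w\<^sup>2) * x\<^sup>2 - w ^ 3 * x ^ 3"
      by (simp add: algebra_simps power2_eq_square power3_eq_cube)
    then show ?thesis by (simp add: w w3)
  qed
  have "(\<lambda>n. (\<Prod>k<n. 1 - c * q ^ k) * (\<Prod>k<n. 1 - (w * c) * q ^ k) * (\<Prod>k<n. 1 - (w\<^sup>2 * c) * q ^ k))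
      \<longlonglongrightarrow> qpoch_inf c q * qpoch_inf (w * c) q * qpoch_inf (w\<^sup>2 * c) q"
    by (intro tendsto_mult qpoch_inf_LIMSEQ q)
  also have "(\<lambda>n. (\<Prod>k<n. 1 - c * q ^ k) * (\<Prod>k<n. 1 - (w * c) * q ^ k) * (\<Prod>k<n. 1 - (w\<^sup>2 * c) * q ^ k)) =
     (\<lambda>n. \<Prod>k<n. 1 - c ^ 3 * (q ^ 3) ^ k)"
  proof
    fix n
    have "(1 - c * q ^ k) * (1 - (w * c) * q ^ k) * (1 - (w\<^sup>2 * c) * q ^ k) = 1 - c ^ 3 * (q ^ 3) ^ k" for k
      using cube[of "c * q ^ k"] by (simp add: power_mult_distrib power_mult[symmetric] mult_ac)
    then show "(\<Prod>k<n. 1 - c * q ^ k) * (\<Prod>k<n. 1 - (w * c) * q ^ k) * (\<Prod>k<n. 1 - (w\<^sup>2 * c) * q ^ k) =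
      (\<Prod>k<n. 1 - c ^ 3 * (q ^ 3) ^ k)"
      unfolding prod.distrib[symmetric] by simp
  qed
  finally show ?thesis
    using LIMSEQ_unique qpoch_inf_LIMSEQ[OF norm_power_lt_1[OF q]] by (metis zero_less_numeral)
qed

lemma euler_split2:
  fixes q :: "'a::{real_normed_field,banach}"
  assumes "norm q < 1"
  shows "euler q = qpoch_inf q (q\<^sup>2) * euler (q\<^sup>2)"
  using qpoch_inf_split[OF assms, of 2 q]
  by (simp add: euler_def numeral_2_eq_2 lessThan_Suc mult_ac)

lemma euler_split3:
  fixes q :: "'a::{real_normed_field,banach}"
  assumes "norm q < 1"
  shows "euler q = qpoch_inf q (q ^ 3) * qpoch_inf (q\<^sup>2) (q ^ 3) * euler (q ^ 3)"
  using qpoch_inf_split[OF assms, of 3 q]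
  by (simp add: euler_def eval_nat_numeral lessThan_Suc mult_ac)

lemma qpoch_inf_minus_euler:
  fixes q :: "'a::{real_normed_field,banach}"
  assumes "norm q < 1"
  shows "qpoch_inf (- q) q * euler q = euler (q\<^sup>2)"
  using qpoch_inf_minus_mult[OF assms, of q] by (simp add: euler_def mult_ac)

text \<open>Factors 1 - q^k with k prime to 3 combine over the three cube roots of unity to 1 -
  q^(3k), which together make \<open>euler (q ^ 3)\<close> over \<open>euler (q ^ 9)\<close>.
  Factors with 3 dividing k are repeated three times and make the cube of
  \<open>euler (q ^ 3)\<close>.\<close>

lemma euler_cube_roots:
  fixes q w :: "'a::{real_normed_field,banach}"
  assumes q: "norm q < 1" and w: "1 + w + w\<^sup>2 = 0"
  shows "euler q * euler (w * q) * euler (w\<^sup>2 * q) * euler (q ^ 9) = euler (q ^ 3) ^ 4"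
proof -
  have w3: "w ^ 3 = 1" using w by algebra
  have nw: "norm w = 1"
    using power_eq_1_iff[of "norm w" 3] arg_cong[OF w3, of norm] by (simp add: norm_power)
  have wq: "norm (w * q) < 1" "norm (w\<^sup>2 * q) < 1" using q by (simp_all add: norm_mult norm_power nw)
  have q3: "norm (q ^ 3) < 1" by (rule norm_power_lt_1[OF q]) simp
  have pw: "(w * q) ^ 3 = q ^ 3" "(w\<^sup>2 * q) ^ 3 = q ^ 3" "(w\<^sup>2 * q)\<^sup>2 = w * q\<^sup>2" "(w * q)\<^sup>2 = w\<^sup>2 * q\<^sup>2"
    "(q ^ 3) ^ 3 = q ^ 9" "(q ^ 3)\<^sup>2 = q ^ 6" "(q\<^sup>2) ^ 3 = q ^ 6"
    using w3 by algebra+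
  have 1: "qpoch_inf q (q ^ 3) * qpoch_inf (w * q) (q ^ 3) * qpoch_inf (w\<^sup>2 * q) (q ^ 3) = qpoch_inf (q ^ 3) (q ^ 9)"
    using qpoch_inf_cube_mult[OF q3 w, of q] by (simp add: pw)
  have 2: "qpoch_inf (q\<^sup>2) (q ^ 3) * qpoch_inf (w * q\<^sup>2) (q ^ 3) * qpoch_inf (w\<^sup>2 * q\<^sup>2) (q ^ 3) = qpoch_inf (q ^ 6) (q ^ 9)"
    using qpoch_inf_cube_mult[OF q3 w, of "q\<^sup>2"] by (simp add: pw)
  have 3: "euler (q ^ 3) = qpoch_inf (q ^ 3) (q ^ 9) * qpoch_inf (q ^ 6) (q ^ 9) * euler (q ^ 9)"
    using euler_split3[OF q3] by (simp add: pw)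
  have "euler q * euler (w * q) * euler (w\<^sup>2 * q) * euler (q ^ 9) =
    (qpoch_inf q (q ^ 3) * qpoch_inf (w * q) (q ^ 3) * qpoch_inf (w\<^sup>2 * q) (q ^ 3)) *
    (qpoch_inf (q\<^sup>2) (q ^ 3) * qpoch_inf (w * q\<^sup>2) (q ^ 3) * qpoch_inf (w\<^sup>2 * q\<^sup>2) (q ^ 3)) * euler (q ^ 9) * euler (q ^ 3) ^ 3"
    unfolding euler_split3[OF q] euler_split3[OF wq(1)] euler_split3[OF wq(2)] pw
    by (simp add: power3_eq_cube mult_ac)
  also have "\<dots> = euler (q ^ 3) ^ 4"
    unfolding 1 2 3[symmetric] by (simp add: eval_nat_numeral)
  finally show ?thesis .
qed

section \<open>Product forms and 3-dissections of theta functions\<close>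

lemma ram_theta_commute: "ram_theta a b = ram_theta b a"
  unfolding ram_theta_def
  by (rule infsum_reindex_bij_witness[of _ uminus uminus]) (auto simp: mult_ac)

lemma ram_theta_phi:
  fixes q :: "'a::{real_normed_field,banach}"
  assumes "norm q < 1" "q \<noteq> 0"
  shows "ram_theta (- q) (- q) * euler (q\<^sup>2) = euler q ^ 2"
proof -
  have "norm (- q * - q) < 1" using norm_power_lt_1[OF assms(1), of 2] by (simp add: power2_eq_square)
  from jacobi_triple[OF _ _ this] assms
  have "ram_theta (- q) (- q) = qpoch_inf q (q\<^sup>2) * qpoch_inf q (q\<^sup>2) * euler (q\<^sup>2)"
    by (simp add: euler_def power2_eq_square)
  then show ?thesis using euler_split2[OF assms(1)] by (simp add: power2_eq_square mult_ac)
qed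

lemma ram_theta_psi:
  fixes q :: "'a::{real_normed_field,banach}"
  assumes "norm q < 1" "q \<noteq> 0"
  shows "ram_theta 1 q * euler q = 2 * euler (q\<^sup>2) ^ 2"
proof -
  have "ram_theta 1 q = qpoch_inf (- 1) q * qpoch_inf (- q) q * euler q"
    using jacobi_triple[of 1 q] assms by (simp add: euler_def)
  also have "qpoch_inf (- 1) q = 2 * qpoch_inf (- q) q" using qpoch_inf_shift[OF assms(1), of "- 1"] by simp
  finally have "ram_theta 1 q * euler q = 2 * (qpoch_inf (- q) q * euler q) ^ 2" by (simp add: power2_eq_square mult_ac)
  then show ?thesis unfolding qpoch_inf_minus_euler[OF assms(1)] .
qed

lemma ram_theta_q_q2:
  fixes q :: "'a::{real_normed_field,banach}"
  assumes "norm q < 1" "q \<noteq> 0"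
  shows "ram_theta q (q\<^sup>2) * (euler q * euler (q ^ 6)) = euler (q\<^sup>2) * euler (q ^ 3) ^ 2"
proof -
  have q3: "norm (q ^ 3) < 1" by (rule norm_power_lt_1[OF assms(1)]) simp
  have q': "q * q\<^sup>2 = q ^ 3" "(q ^ 3)\<^sup>2 = q ^ 6" by algebra+
  have 1: "ram_theta q (q\<^sup>2) = qpoch_inf (- q) (q ^ 3) * qpoch_inf (- (q\<^sup>2)) (q ^ 3) * euler (q ^ 3)"
    using jacobi_triple[of q "q\<^sup>2"] assms q3 by (simp add: q' euler_def)
  have 2: "qpoch_inf (- q) q = qpoch_inf (- q) (q ^ 3) * qpoch_inf (- (q\<^sup>2)) (q ^ 3) * qpoch_inf (- (q ^ 3)) (q ^ 3)"
    using qpoch_inf_split[OF assms(1), of 3 "- q"]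
    by (simp add: eval_nat_numeral lessThan_Suc mult_ac)
  have 3: "qpoch_inf (- (q ^ 3)) (q ^ 3) * euler (q ^ 3) = euler (q ^ 6)"
    using qpoch_inf_minus_euler[OF q3] by (simp add: q')
  have "ram_theta q (q\<^sup>2) * (euler q * euler (q ^ 6)) = (qpoch_inf (- q) q * euler q) * euler (q ^ 3) ^ 2"
    unfolding 1 2 3[symmetric] by (simp add: power2_eq_square mult_ac)
  then show ?thesis unfolding qpoch_inf_minus_euler[OF assms(1)] .
qed

lemma ram_theta_q_q5:
  fixes q :: "'a::{real_normed_field,banach}"
  assumes "norm q < 1" "q \<noteq> 0"
  shows "ram_theta (- q) (- (q ^ 5)) * (euler (q\<^sup>2) * euler (q ^ 3)) = euler q * euler (q ^ 6) ^ 2"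
proof -
  have q2: "norm (q\<^sup>2) < 1" and q3: "norm (q ^ 3) < 1" and q6: "norm (q ^ 6) < 1"
    by (rule norm_power_lt_1[OF assms(1)]; simp)+
  have q': "(q\<^sup>2) ^ 3 = q ^ 6" "(q ^ 3)\<^sup>2 = q ^ 6" "(q\<^sup>2)\<^sup>2 = q ^ 4" "q * q ^ 5 = q ^ 6" by algebra+
  have 1: "ram_theta (- q) (- (q ^ 5)) = qpoch_inf q (q ^ 6) * qpoch_inf (q ^ 5) (q ^ 6) * euler (q ^ 6)"
    using jacobi_triple[of "- q" "- (q ^ 5)"] assms q6 by (simp add: q' euler_def)
  have 2: "euler q = qpoch_inf q (q ^ 6) * qpoch_inf (q\<^sup>2) (q ^ 6) * qpoch_inf (q ^ 3) (q ^ 6) * qpoch_inf (q ^ 4) (q ^ 6) * qpoch_inf (q ^ 5) (q ^ 6) * euler (q ^ 6)"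
    using qpoch_inf_split[OF assms(1), of 6 q]
    by (simp add: euler_def eval_nat_numeral lessThan_Suc mult_ac)
  have 3: "euler (q\<^sup>2) = qpoch_inf (q\<^sup>2) (q ^ 6) * qpoch_inf (q ^ 4) (q ^ 6) * euler (q ^ 6)"
    using euler_split3[OF q2] by (simp add: q')
  have 4: "euler (q ^ 3) = qpoch_inf (q ^ 3) (q ^ 6) * euler (q ^ 6)"
    using euler_split2[OF q3] by (simp add: q')
  show ?thesis unfolding 1 2 3 4 by (simp add: power2_eq_square mult_ac)
qed

lemma infsum_mod_3:
  fixes f :: "int \<Rightarrow> 'a::banach"
  assumes f: "f summable_on UNIV"
  shows "infsum f UNIV = (\<Sum>\<^sub>\<infinity>m. f (3 * m)) + (\<Sum>\<^sub>\<infinity>m. f (3 * m + 1)) + (\<Sum>\<^sub>\<infinity>m. f (3 * m - 1))"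
proof -
  let ?A = "range (\<lambda>m::int. 3 * m)" and ?B = "range (\<lambda>m::int. 3 * m + 1)" and ?C = "range (\<lambda>m::int. 3 * m - 1)"
  have sub: "f summable_on S" for S by (rule summable_on_subset_banach[OF f]) simp
  have U: "UNIV = (?A \<union> ?B) \<union> ?C"
  proof -
    have "x \<in> (?A \<union> ?B) \<union> ?C" for x :: int
    proof -
      have "x = 3 * (x div 3) \<or> x = 3 * (x div 3) + 1 \<or> x = 3 * (x div 3 + 1) - 1" by presburger
      then show ?thesis by blast
    qed
    then show ?thesis by blast
  qed
  have "?A \<inter> ?B = {}" "(?A \<union> ?B) \<inter> ?C = {}" by (auto; presburger)+
  then have "infsum f UNIV = infsum f ?A + infsum f ?B + infsum f ?C"
    by (subst U) (simp add: infsum_Un_disjoint sub)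
  moreover have "infsum f ?A = (\<Sum>\<^sub>\<infinity>m. f (3 * m))" "infsum f ?B = (\<Sum>\<^sub>\<infinity>m. f (3 * m + 1))"
    "infsum f ?C = (\<Sum>\<^sub>\<infinity>m. f (3 * m - 1))"
    by (subst infsum_reindex; force simp: inj_def o_def)+
  ultimately show ?thesis by simp
qed

text \<open>The exponents n^2 are sorted by n modulo 3. Multiples of 3 give 9 m^2; the other two
  classes give 9 m^2 + 6 m + 1 and its mirror image, hence the factor 2.\<close>

lemma phi_dissection:
  fixes q :: "'a::{real_normed_field,banach}"
  assumes "norm q < 1" "q \<noteq> 0"
  shows "ram_theta (- q) (- q) = ram_theta (- (q ^ 9)) (- (q ^ 9)) - 2 * q * ram_theta (- (q ^ 3)) (- (q ^ 15))"
proof -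
  let ?f = "\<lambda>n. (- q) ^ tri n * (- q) ^ tri (- n)"
  have "norm (- q * - q) < 1" using norm_power_lt_1[OF assms(1), of 2] by (simp add: power2_eq_square)
  then have "?f summable_on UNIV" using assms by (intro ram_theta_summable) auto
  from infsum_mod_3[OF this]
  have 0: "ram_theta (- q) (- q) = (\<Sum>\<^sub>\<infinity>m. ?f (3 * m)) + (\<Sum>\<^sub>\<infinity>m. ?f (3 * m + 1)) + (\<Sum>\<^sub>\<infinity>m. ?f (3 * m - 1))"
    by (simp only: ram_theta_def)
  have 1: "?f (3 * m) = (- (q ^ 9)) ^ tri m * (- (q ^ 9)) ^ tri (- m)" for m
  proof -
    have "2 * int (tri (3 * m) + tri (- (3 * m))) = 2 * int (9 * tri m + 9 * tri (- m))"
      unfolding of_nat_add of_nat_mult distrib_left mult.left_commute[of 2 "int 9"] tri_eq tri_minus_eq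
      by (simp add: algebra_simps)
    then have "tri (3 * m) + tri (- (3 * m)) = 9 * tri m + 9 * tri (- m)" by (rule nat_eqI_double)
    then have "?f (3 * m) = (- q) ^ (9 * tri m + 9 * tri (- m))" by (simp only: power_add[symmetric])
    also have "\<dots> = ((- q) ^ 9) ^ tri m * ((- q) ^ 9) ^ tri (- m)" by (simp only: power_add power_mult)
    finally show ?thesis by (simp add: power_minus_odd)
  qed
  have 2: "?f (3 * m + 1) = - q * ((- (q ^ 15)) ^ tri m * (- (q ^ 3)) ^ tri (- m))" for m
  proof -
    have "2 * int (tri (3 * m + 1) + tri (- (3 * m + 1))) = 2 * int (1 + 15 * tri m + 3 * tri (- m))"
      unfolding of_nat_add of_nat_mult distrib_left mult.left_commute[of 2 "int 15"] mult.left_commute[of 2 "int 3"] tri_eq tri_minus_eq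
      by (simp add: algebra_simps)
    then have "tri (3 * m + 1) + tri (- (3 * m + 1)) = 1 + 15 * tri m + 3 * tri (- m)" by (rule nat_eqI_double)
    then have "?f (3 * m + 1) = (- q) ^ (1 + 15 * tri m + 3 * tri (- m))" by (simp only: power_add[symmetric])
    also have "\<dots> = (- q) * (((- q) ^ 15) ^ tri m * ((- q) ^ 3) ^ tri (- m))" by (simp only: power_add power_mult power_one_right mult.assoc)
    finally show ?thesis by (simp add: power_minus_odd)
  qed
  have 3: "?f (3 * m - 1) = - q * ((- (q ^ 3)) ^ tri m * (- (q ^ 15)) ^ tri (- m))" for m
  proof -
    have "2 * int (tri (3 * m - 1) + tri (- (3 * m - 1))) = 2 * int (1 + 3 * tri m + 15 * tri (- m))"
      unfolding of_nat_add of_nat_mult distrib_left mult.left_commute[of 2 "int 15"] mult.left_commute[of 2 "int 3"] tri_eq tri_minus_eq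
      by (simp add: algebra_simps)
    then have "tri (3 * m - 1) + tri (- (3 * m - 1)) = 1 + 3 * tri m + 15 * tri (- m)" by (rule nat_eqI_double)
    then have "?f (3 * m - 1) = (- q) ^ (1 + 3 * tri m + 15 * tri (- m))" by (simp only: power_add[symmetric])
    also have "\<dots> = (- q) * (((- q) ^ 3) ^ tri m * ((- q) ^ 15) ^ tri (- m))" by (simp only: power_add power_mult power_one_right mult.assoc)
    finally show ?thesis by (simp add: power_minus_odd)
  qed
  have "ram_theta (- q) (- q) = ram_theta (- (q ^ 9)) (- (q ^ 9)) + - q * ram_theta (- (q ^ 15)) (- (q ^ 3)) + - q * ram_theta (- (q ^ 3)) (- (q ^ 15))"
    using 0 unfolding 1 2 3 infsum_cmult_right' by (simp only: ram_theta_def)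
  then show ?thesis using ram_theta_commute[of "- (q ^ 15)" "- (q ^ 3)"] by simp
qed

text \<open>Here the classes 0 and 1 modulo 3 mirror each other, while the class of -1 reproduces
  the whole series at q^9.\<close>

lemma psi_dissection:
  fixes q :: "'a::{real_normed_field,banach}"
  assumes "norm q < 1" "q \<noteq> 0"
  shows "ram_theta 1 q = 2 * ram_theta (q ^ 3) (q ^ 6) + q * ram_theta 1 (q ^ 9)"
proof -
  let ?f = "\<lambda>n. 1 ^ tri n * q ^ tri (- n)"
  have "?f summable_on UNIV" using assms by (intro ram_theta_summable) auto
  from infsum_mod_3[OF this]
  have 0: "ram_theta 1 q = (\<Sum>\<^sub>\<infinity>m. ?f (3 * m)) + (\<Sum>\<^sub>\<infinity>m. ?f (3 * m + 1)) + (\<Sum>\<^sub>\<infinity>m. ?f (3 * m - 1))"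
    by (simp only: ram_theta_def)
  have 1: "?f (3 * m) = (q ^ 3) ^ tri m * (q ^ 6) ^ tri (- m)" for m
  proof -
    have "2 * int (tri (- (3 * m))) = 2 * int (3 * tri m + 6 * tri (- m))"
      unfolding of_nat_add of_nat_mult distrib_left mult.left_commute[of 2 "int 3"] mult.left_commute[of 2 "int 6"] tri_eq tri_minus_eq
      by (simp add: algebra_simps)
    then have "tri (- (3 * m)) = 3 * tri m + 6 * tri (- m)" by (rule nat_eqI_double)
    then show ?thesis by (simp add: power_add power_mult)
  qed
  have 2: "?f (3 * m + 1) = (q ^ 6) ^ tri m * (q ^ 3) ^ tri (- m)" for m
  proof -
    have "2 * int (tri (- (3 * m + 1))) = 2 * int (6 * tri m + 3 * tri (- m))"
      unfolding of_nat_add of_nat_mult distrib_left mult.left_commute[of 2 "int 3"] mult.left_commute[of 2 "int 6"] tri_eq tri_minus_eq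
      by (simp add: algebra_simps)
    then have "tri (- (3 * m + 1)) = 6 * tri m + 3 * tri (- m)" by (rule nat_eqI_double)
    then show ?thesis by (simp only: power_add power_mult power_one mult_1_left)
  qed
  have 3: "?f (3 * m - 1) = q * (1 ^ tri m * (q ^ 9) ^ tri (- m))" for m
  proof -
    have "2 * int (tri (- (3 * m - 1))) = 2 * int (1 + 9 * tri (- m))"
      unfolding of_nat_add of_nat_mult distrib_left mult.left_commute[of 2 "int 9"] tri_eq tri_minus_eq
      by (simp add: algebra_simps)
    then have "tri (- (3 * m - 1)) = 1 + 9 * tri (- m)" by (rule nat_eqI_double)
    then show ?thesis by (simp only: power_add power_mult power_one mult_1_left power_one_right)
  qed
  have "ram_theta 1 q = ram_theta (q ^ 3) (q ^ 6) + ram_theta (q ^ 6) (q ^ 3) + q * ram_theta 1 (q ^ 9)"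
    using 0 unfolding 1 2 3 infsum_cmult_right' by (simp only: ram_theta_def)
  then show ?thesis using ram_theta_commute[of "q ^ 6" "q ^ 3"] by simp
qed

text \<open>Each dissection reads U + q V, where U and V depend on q^3 only. Multiplying its values
  at q, w q and w^2 q gives U^3 + q^3 V^3, and \<open>euler_cube_roots\<close> evaluates the same
  product on the other side. The psi series yields the first relation and the phi series the
  second.\<close>

lemma level_6_cube_roots:
  fixes q w :: "'a::{real_normed_field,banach}"
  assumes q: "norm q < 1" "q \<noteq> 0" and w: "1 + w + w\<^sup>2 = 0"
  defines "e1 \<equiv> euler (q ^ 3)" and "e2 \<equiv> euler (q ^ 6)" and "e3 \<equiv> euler (q ^ 9)" and "e6 \<equiv> euler (q ^ 18)"
  shows "e2 ^ 8 * e3 ^ 4 * e6 = e1 * e2 ^ 3 * e3 ^ 9 + q ^ 3 * (e1 ^ 4 * e6 ^ 9)"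
    and "e1 ^ 8 * e3 * e6 ^ 4 = e2 ^ 4 * e3 ^ 9 - 8 * q ^ 3 * (e1 ^ 3 * e2 * e6 ^ 9)"
proof -
  have w3: "w ^ 3 = 1" using w by algebra
  have w0: "w \<noteq> 0" using w by auto
  have nw: "norm w = 1"
    using power_eq_1_iff[of "norm w" 3] arg_cong[OF w3, of norm] by (simp add: norm_power)
  have q1: "norm (w * q) < 1" "norm (w\<^sup>2 * q) < 1" "w * q \<noteq> 0" "w\<^sup>2 * q \<noteq> 0"
    using q w0 by (simp_all add: norm_mult norm_power nw)
  have np: "norm (q\<^sup>2) < 1" "norm (q ^ 3) < 1" "norm (q ^ 6) < 1" "norm (q ^ 9) < 1" "norm (q ^ 18) < 1"
    by (rule norm_power_lt_1[OF q(1)]; simp)+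
  have pw: "(w * q) ^ 3 = q ^ 3" "(w\<^sup>2 * q) ^ 3 = q ^ 3" "(w * q) ^ 6 = q ^ 6" "(w\<^sup>2 * q) ^ 6 = q ^ 6"
    "(w * q) ^ 9 = q ^ 9" "(w\<^sup>2 * q) ^ 9 = q ^ 9" "(w * q) ^ 15 = q ^ 15" "(w\<^sup>2 * q) ^ 15 = q ^ 15"
    "(w\<^sup>2 * q)\<^sup>2 = w * q\<^sup>2"
    using w3 by algebra+
  note pw = pw power_mult_distrib[of w q 2]
  have pq: "(q\<^sup>2) ^ 9 = q ^ 18" "(q\<^sup>2) ^ 3 = q ^ 6" "(q ^ 3)\<^sup>2 = q ^ 6" "(q ^ 3) ^ 3 = q ^ 9" "(q ^ 3) ^ 6 = q ^ 18"
    "(q ^ 3) ^ 5 = q ^ 15" "(q ^ 9)\<^sup>2 = q ^ 18" by algebra+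
  have nz: "e1 \<noteq> 0" "e2 \<noteq> 0" "e3 \<noteq> 0" "e6 \<noteq> 0"
    unfolding e1_def e2_def e3_def e6_def by (rule euler_nonzero; rule np)+
  define u where "u = euler q * euler (w * q) * euler (w\<^sup>2 * q)"
  \<comment> \<open>Squaring the argument permutes the cube roots of unity, so \<open>v\<close> is
    the product \<open>u\<close> taken at the square of \<open>q\<close>.\<close>
  define v where "v = euler (q\<^sup>2) * euler (w\<^sup>2 * q\<^sup>2) * euler (w * q\<^sup>2)"
  have u: "u * e3 = e1 ^ 4" using euler_cube_roots[OF q(1) w] by (simp add: u_def e3_def e1_def)
  have v: "v * e6 = e2 ^ 4" using euler_cube_roots[OF np(1) w] by (simp add: v_def e6_def e2_def pq mult_ac)
  from u v nz have nzuv: "u \<noteq> 0" "v \<noteq> 0" by auto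

  define A where "A = ram_theta (q ^ 3) (q ^ 6)"
  define B where "B = ram_theta 1 (q ^ 9)"
  have A: "A * (e1 * e6) = e2 * e3 ^ 2"
    using ram_theta_q_q2[of "q ^ 3"] np q(2) by (simp add: A_def e1_def e2_def e3_def e6_def pq)
  have B: "B * e3 = 2 * e6 ^ 2"
    using ram_theta_psi[of "q ^ 9"] np q(2) by (simp add: B_def e3_def e6_def pq)
  have psi: "2 * A + q * B = ram_theta 1 q" "2 * A + w * q * B = ram_theta 1 (w * q)" "2 * A + w\<^sup>2 * q * B = ram_theta 1 (w\<^sup>2 * q)"
    using psi_dissection[OF q] psi_dissection[OF q1(1,3)] psi_dissection[OF q1(2,4)]
    unfolding pw A_def B_def by simp_all
  have "(2 * A) ^ 3 + (q * B) ^ 3 = (2 * A + q * B) * (2 * A + w * q * B) * (2 * A + w\<^sup>2 * q * B)"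
    using w by algebra
  also have "\<dots> * u = 8 * v\<^sup>2"
    unfolding psi using ram_theta_psi[OF q] ram_theta_psi[OF q1(1,3)] ram_theta_psi[OF q1(2,4)]
    unfolding pw u_def v_def by algebra
  finally have 1: "((2 * A) ^ 3 + (q * B) ^ 3) * u = 8 * v\<^sup>2" .
  have A': "A = e2 * e3 ^ 2 / (e1 * e6)" and B': "B = 2 * e6 ^ 2 / e3"
    and u': "u = e1 ^ 4 / e3" and v': "v = e2 ^ 4 / e6" using A B u v nz by (simp_all add: field_simps)
  have "8 * (e2 ^ 8 * e3 ^ 4 * e6) = 8 * (e1 * e2 ^ 3 * e3 ^ 9 + q ^ 3 * (e1 ^ 4 * e6 ^ 9))"
    using 1 nz unfolding A' B' u' v' by (simp add: field_simps) algebra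
  then show "e2 ^ 8 * e3 ^ 4 * e6 = e1 * e2 ^ 3 * e3 ^ 9 + q ^ 3 * (e1 ^ 4 * e6 ^ 9)"
    using mult_left_cancel[of "8 :: 'a"] by (metis zero_neq_numeral)

  define X where "X = ram_theta (- (q ^ 9)) (- (q ^ 9))"
  define Y where "Y = ram_theta (- (q ^ 3)) (- (q ^ 15))"
  have X: "X * e6 = e3 ^ 2"
    using ram_theta_phi[of "q ^ 9"] np q(2) by (simp add: X_def e3_def e6_def pq)
  have Y: "Y * (e2 * e3) = e1 * e6 ^ 2"
    using ram_theta_q_q5[of "q ^ 3"] np q(2) by (simp add: Y_def e1_def e2_def e3_def e6_def pq)
  have phi: "X - 2 * q * Y = ram_theta (- q) (- q)" "X - 2 * (w * q) * Y = ram_theta (- (w * q)) (- (w * q))"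
    "X - 2 * (w\<^sup>2 * q) * Y = ram_theta (- (w\<^sup>2 * q)) (- (w\<^sup>2 * q))"
    using phi_dissection[OF q] phi_dissection[OF q1(1,3)] phi_dissection[OF q1(2,4)]
    unfolding pw X_def Y_def by simp_all
  have "X ^ 3 - (2 * q * Y) ^ 3 = (X - 2 * q * Y) * (X - 2 * (w * q) * Y) * (X - 2 * (w\<^sup>2 * q) * Y)"
    using w by algebra
  also have "\<dots> * v = u\<^sup>2"
    unfolding phi using ram_theta_phi[OF q] ram_theta_phi[OF q1(1,3)] ram_theta_phi[OF q1(2,4)]
    unfolding pw u_def v_def by algebra
  finally have 2: "(X ^ 3 - (2 * q * Y) ^ 3) * v = u\<^sup>2" .
  have X': "X = e3 ^ 2 / e6" and Y': "Y = e1 * e6 ^ 2 / (e2 * e3)" using X Y nz by (simp_all add: field_simps)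
  show "e1 ^ 8 * e3 * e6 ^ 4 = e2 ^ 4 * e3 ^ 9 - 8 * q ^ 3 * (e1 ^ 3 * e2 * e6 ^ 9)"
    using 2 nz unfolding X' Y' u' v' by (simp add: field_simps) algebra
qed

lemma euler_of_real:
  "norm q < 1 \<Longrightarrow> euler (of_real q) = (of_real (euler q) :: 'a::{real_normed_field,banach})"
  by (simp add: euler_def qpoch_inf_of_real)

theorem level_6:
  fixes p :: real
  assumes p: "0 < p" "p < 1"
  defines "e1 \<equiv> euler p" and "e2 \<equiv> euler (p\<^sup>2)" and "e3 \<equiv> euler (p ^ 3)" and "e6 \<equiv> euler (p ^ 6)"
  shows "e2 ^ 8 * e3 ^ 4 * e6 = e1 * e2 ^ 3 * e3 ^ 9 + p * (e1 ^ 4 * e6 ^ 9)"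
    and "e1 ^ 8 * e3 * e6 ^ 4 = e2 ^ 4 * e3 ^ 9 - 8 * p * (e1 ^ 3 * e2 * e6 ^ 9)"
proof -
  \<comment> \<open>The relations are known at the cube of a variable, and multiplying over cube
    roots of unity needs a primitive one. Hence the real cube root of \<open>p\<close> is taken and
    then viewed as a complex number.\<close>
  define t where "t = root 3 p"
  have t: "t ^ 3 = p" "0 < t" "t < 1" using p by (auto simp: t_def)
  define w where "w = Complex (- 1 / 2) (sqrt 3 / 2)"
  have w: "1 + w + w\<^sup>2 = 0" by (simp add: w_def power2_eq_square complex_eq_iff)
  have n: "norm (complex_of_real t) < 1" "complex_of_real t \<noteq> 0" using t by auto
  have e: "euler (complex_of_real t ^ 3) = of_real e1" "euler (complex_of_real t ^ 6) = of_real e2"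
    "euler (complex_of_real t ^ 9) = of_real e3" "euler (complex_of_real t ^ 18) = of_real e6"
  proof -
    have tp: "t ^ 3 = p" "t ^ 6 = p\<^sup>2" "t ^ 9 = p ^ 3" "t ^ 18 = p ^ 6" by (simp_all flip: t(1) power_mult)
    have "norm p < 1" "norm (p ^ 2) < 1" "norm (p ^ 3) < 1" "norm (p ^ 6) < 1"
      using p by (auto simp: power_less_one_iff)
    note this[THEN euler_of_real]
    then show "euler (complex_of_real t ^ 3) = of_real e1" "euler (complex_of_real t ^ 6) = of_real e2"
    "euler (complex_of_real t ^ 9) = of_real e3" "euler (complex_of_real t ^ 18) = of_real e6"
      unfolding of_real_power[symmetric] e1_def e2_def e3_def e6_def tp
      by simp_all
  qed
  have p3: "complex_of_real t ^ 3 = of_real p" using t(1) by (simp flip: of_real_power)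
  note l = level_6_cube_roots[OF n w, unfolded e, unfolded p3]
  from l(1) have "complex_of_real (e2 ^ 8 * e3 ^ 4 * e6) = of_real (e1 * e2 ^ 3 * e3 ^ 9 + p * (e1 ^ 4 * e6 ^ 9))"
    by simp
  then show "e2 ^ 8 * e3 ^ 4 * e6 = e1 * e2 ^ 3 * e3 ^ 9 + p * (e1 ^ 4 * e6 ^ 9)"
    by (simp only: of_real_eq_iff)
  from l(2) have "complex_of_real (e1 ^ 8 * e3 * e6 ^ 4) = of_real (e2 ^ 4 * e3 ^ 9 - 8 * p * (e1 ^ 3 * e2 * e6 ^ 9))"
    by simp
  then show "e1 ^ 8 * e3 * e6 ^ 4 = e2 ^ 4 * e3 ^ 9 - 8 * p * (e1 ^ 3 * e2 * e6 ^ 9)"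
    by (simp only: of_real_eq_iff)
qed

section \<open>The theta function identity of degree 7\<close>

lemma infsum_times:
  fixes f :: "'b \<Rightarrow> 'a::{real_normed_field,banach}"
  assumes f: "(\<lambda>x. norm (f x)) summable_on A" and g: "(\<lambda>y. norm (g y)) summable_on B"
  shows "(\<lambda>(x, y). norm (f x * g y)) summable_on A \<times> B"
    and "infsum f A * infsum g B = (\<Sum>\<^sub>\<infinity>(x, y)\<in>A \<times> B. f x * g y)"
proof -
  have "(\<lambda>x. norm (f x) * (\<Sum>\<^sub>\<infinity>y\<in>B. norm (g y))) summable_on A"
    by (intro summable_on_cmult_left f)
  then have "(\<lambda>x. norm (\<Sum>\<^sub>\<infinity>y\<in>B. norm (f x * g y))) summable_on A"
    by (simp add: norm_mult infsum_cmult_right' infsum_nonneg)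
  then have "(\<lambda>z. norm (case z of (x, y) \<Rightarrow> f x * g y)) summable_on A \<times> B"
    using g by (intro Infinite_Sum.abs_summable_on_Sigma_iff[THEN iffD2] conjI ballI)
      (auto simp: norm_mult intro!: summable_on_cmult_right)
  then show *: "(\<lambda>(x, y). norm (f x * g y)) summable_on A \<times> B"
    by (simp add: case_prod_unfold)
  have "(\<lambda>(x, y). f x * g y) summable_on A \<times> B"
    by (rule abs_summable_summable) (use * in \<open>simp add: case_prod_unfold\<close>)
  from infsum_Sigma'_banach[OF this]
  show "infsum f A * infsum g B = (\<Sum>\<^sub>\<infinity>(x, y)\<in>A \<times> B. f x * g y)"
    by (simp add: infsum_cmult_right' infsum_cmult_left')
qed

section \<open>The pentagonal number series\<close>

definition pent :: "int \<Rightarrow> nat" where "pent m = nat (m * (3 * m - 1) div 2)"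

lemma pent_eq: "2 * int (pent m) = m * (3 * m - 1)"
proof -
  have "m * (3 * m - 1) \<ge> 0" by (cases "m > 0") (auto simp: zero_le_mult_iff)
  moreover have "even (m * (3 * m - 1))" by simp
  ultimately show ?thesis by (simp add: pent_def)
qed

lemma pent_tri: "pent m = tri m + 2 * tri (- m)"
proof (rule nat_eqI_double)
  show "2 * int (pent m) = 2 * int (tri m + 2 * tri (- m))"
    unfolding of_nat_add of_nat_mult distrib_left mult.left_commute[of 2 "int 2"] tri_eq tri_minus_eq pent_eq
    by (simp add: algebra_simps)
qed

lemma minus_one_power_tri: "(- 1) ^ tri m * (- 1) ^ tri (- m) = ((- 1) powi m :: 'a::field)"
proof -
  have "even (tri m + tri (- m)) \<longleftrightarrow> even m"
    using tri_add_tri_minus[of m] by (metis even_mult_iff even_of_nat)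
  then have "(- 1) ^ (tri m + tri (- m)) = ((- 1) powi m :: 'a)"
    by (cases "even m") (simp_all add: power_int_minus_left)
  then show ?thesis by (simp add: power_add)
qed

lemma euler_term:
  fixes q :: "'a::{real_normed_field,banach}"
  shows "(- q) ^ tri m * (- (q\<^sup>2)) ^ tri (- m) = (- 1) powi m * q ^ pent m"
proof -
  have "(- q) ^ tri m * (- (q\<^sup>2)) ^ tri (- m) =
     ((- 1) ^ tri m * (- 1) ^ tri (- m)) * (q ^ tri m * (q\<^sup>2) ^ tri (- m))"
    unfolding power_minus[of q] power_minus[of "q\<^sup>2"] by (simp only: mult_ac)
  also have "q ^ tri m * (q\<^sup>2) ^ tri (- m) = q ^ pent m"
    by (simp only: pent_tri power_add power_mult)
  finally show ?thesis unfolding minus_one_power_tri .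
qed

lemma pentagonal:
  fixes q :: "'a::{real_normed_field,banach}"
  assumes q: "norm q < 1" "q \<noteq> 0"
  shows "(\<lambda>m. norm ((- 1) powi m * q ^ pent m)) summable_on UNIV"
    and "euler q = (\<Sum>\<^sub>\<infinity>m. (- 1) powi m * q ^ pent m)"
proof -
  have q3: "norm (q ^ 3) < 1" by (rule norm_power_lt_1[OF q(1)]) simp
  have eq: "- q * - (q\<^sup>2) = q ^ 3" by algebra
  show "(\<lambda>m. norm ((- 1) powi m * q ^ pent m)) summable_on UNIV"
    using ram_theta_abs_summable[of "- q" "- (q\<^sup>2)"] q q3 unfolding euler_term eq by simp
  have "ram_theta (- q) (- (q\<^sup>2)) = euler q"
    using jacobi_triple[of "- q" "- (q\<^sup>2)"] q q3 unfolding eq euler_split3[OF q(1)]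
    by (simp add: euler_def)
  then show "euler q = (\<Sum>\<^sub>\<infinity>m. (- 1) powi m * q ^ pent m)"
    by (simp add: ram_theta_def euler_term)
qed

lemma ramanujan_f_eq_euler:
  fixes q :: "'a::{real_normed_field,banach}"
  assumes "norm q < 1" "q \<noteq> 0"
  shows "ramanujan_f (- q) = euler q"
  by (simp add: pentagonal(2)[OF assms] ramanujan_f_def pent_def)

lemma mod_4_cases: "x mod 4 = 0 \<or> x mod 4 = 1 \<or> x mod 4 = 2 \<or> x mod 4 = 3" for x :: int
  by presburger

lemma pent_mod: "odd (pent m) \<longleftrightarrow> m mod 4 = 1 \<or> m mod 4 = 2"
proof -
  have "even (pent (4 * k + c)) \<longleftrightarrow> even (pent c)" for k c
  proof -
    have "int (pent (4 * k + c)) = 2 * (12 * k * k + 6 * k * c - k) + int (pent c)"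
      using pent_eq[of "4 * k + c"] pent_eq[of c] by (simp add: algebra_simps)
    then show ?thesis by (metis even_add even_mult_iff even_numeral even_of_nat)
  qed
  from this[of "m div 4" "m mod 4"] have "even (pent m) \<longleftrightarrow> even (pent (m mod 4))" by simp
  moreover have "pent 0 = 0" "pent 1 = 1" "pent 2 = 5" "pent 3 = 12" by (simp_all add: pent_def)
  ultimately show ?thesis using mod_4_cases[of m] by (elim disjE; simp)
qed

lemma mod_4_double: "2 * x mod 4 = 2 * (x mod 2)" for x :: int
  using mult_mod_right[of 2 x 2] by simp

lemma mod_4_imp_ex: "x mod 4 = c \<Longrightarrow> \<exists>t. x = c + 4 * t" for x c :: int
  by (metis mod_mult_div_eq)

text \<open>Each product on the left is a double pentagonal series, and the difference keeps the
  terms of odd exponent. Symmetries of the form x^2 + 7 y^2 rearrange them into two sums of one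
  function over two sublattices, whose difference is again a product of two pentagonal series, now
  in q^4.\<close>

lemma degree_7:
  fixes q :: "'a::{real_normed_field,banach}"
  assumes q: "norm q < 1" "q \<noteq> 0"
  shows "euler (- q) * euler (- (q ^ 7)) - euler q * euler (q ^ 7) = 2 * q * euler (q ^ 4) * euler (q ^ 28)"
proof -
  define sg :: "int \<times> int \<Rightarrow> 'a" where "sg = (\<lambda>(m, n). (- 1) powi m * (- 1) powi n)"
  define M where "M = (\<lambda>(m, n). pent m + 7 * pent n)"
  have np: "norm (q ^ k) < 1" if "k > 0" for k using norm_power_lt_1[OF q(1) that] .
  have prod: "(\<lambda>z. norm (sg z * x ^ M z)) summable_on UNIV"
    "euler x * euler (x ^ 7) = (\<Sum>\<^sub>\<infinity>z. sg z * x ^ M z)" if x: "norm x < 1" "x \<noteq> 0" for x :: 'a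
  proof -
    have x7: "norm (x ^ 7) < 1" "x ^ 7 \<noteq> 0" using norm_power_lt_1[OF x(1)] x by auto
    have tz: "(- 1) powi m * x ^ pent m * ((- 1) powi n * (x ^ 7) ^ pent n) = sg (m, n) * x ^ M (m, n)" for m n
      by (simp add: sg_def M_def power_add power_mult[symmetric] mult_ac)
    have tn: "(\<lambda>(m, n). norm ((- 1) powi m * x ^ pent m * ((- 1) powi n * (x ^ 7) ^ pent n))) = (\<lambda>z. norm (sg z * x ^ M z))"
      by (rule ext, clarify) (simp only: tz)
    have t: "(\<lambda>(m, n). (- 1) powi m * x ^ pent m * ((- 1) powi n * (x ^ 7) ^ pent n)) = (\<lambda>z. sg z * x ^ M z)"
      by (rule ext, clarify) (simp only: tz)
    show "(\<lambda>z. norm (sg z * x ^ M z)) summable_on UNIV"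
      using infsum_times(1)[OF pentagonal(1)[OF x] pentagonal(1)[OF x7]]
      unfolding tn by simp
    show "euler x * euler (x ^ 7) = (\<Sum>\<^sub>\<infinity>z. sg z * x ^ M z)"
      using infsum_times(2)[OF pentagonal(1)[OF x] pentagonal(1)[OF x7]]
      unfolding pentagonal(2)[OF x, symmetric] pentagonal(2)[OF x7, symmetric] t by simp
  qed
  have qm: "norm (- q) < 1" "- q \<noteq> 0" using q by auto
  have sgn: "norm (sg z) = 1" for z by (auto simp: sg_def norm_mult norm_power_int case_prod_unfold)
  have sumq: "(\<lambda>z. norm (q ^ M z)) summable_on UNIV" using prod(1)[OF q] by (simp add: norm_mult sgn)
  have sumM: "(\<lambda>z. q ^ M z) summable_on S" for S
    by (rule summable_on_subset_banach[OF abs_summable_summable[OF sumq]]) simp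
  have sums: "(\<lambda>z. sg z * x ^ M z) summable_on S" if x: "norm x < 1" "x \<noteq> 0" for x S
    by (rule summable_on_subset_banach[OF abs_summable_summable[OF prod(1)[OF x]]]) simp
  \<comment> \<open>\<open>O1\<close> and \<open>O2\<close> are the two kinds of index pairs with
    odd exponent; the sign is constantly +1 on the first and -1 on the second. \<open>O3\<close> is
    the image of \<open>O2\<close> under the map \<open>G\<close> defined further down.\<close>
  define O1 where "O1 = {(m, n). (m - n) mod 4 = (2::int)}"
  define O2 where "O2 = {(m, n). (m + n) mod 4 = (1::int)}"
  define O3 where "O3 = {(m, n). (m + n) mod 4 = (0::int)}"
  have oddM: "odd (M z) \<longleftrightarrow> z \<in> O1 \<union> O2" for z
  proof -
    obtain m n where z: "z = (m, n)" by force
    have "odd (M z) \<longleftrightarrow> odd (pent m) \<noteq> odd (pent n)" by (simp add: z M_def)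
    also have "\<dots> \<longleftrightarrow> z \<in> O1 \<union> O2"
    proof -
      have *: "(a = 1 \<or> a = 2) \<noteq> (b = 1 \<or> b = 2) \<longleftrightarrow> (a - b) mod 4 = 2 \<or> (a + b) mod 4 = 1"
        if "a = 0 \<or> a = 1 \<or> a = 2 \<or> a = 3" "b = 0 \<or> b = 1 \<or> b = 2 \<or> b = 3" for a b :: int
        using that by (elim disjE; simp)
      show ?thesis
        unfolding pent_mod z O1_def O2_def mem_Collect_eq Un_iff prod.case
        using *[OF mod_4_cases mod_4_cases, of m n] by (simp only: mod_diff_eq mod_add_eq)
    qed
    finally show ?thesis .
  qed
  have sg1: "sg z = 1" if "z \<in> O1" for z
  proof -
    obtain m n where z: "z = (m, n)" by force
    have "(m - n) mod 4 = 2" using that by (simp only: z O1_def mem_Collect_eq prod.case)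
    from mod_4_imp_ex[OF this] obtain t where "m - n = 2 + 4 * t" ..
    then have "m = n + 2 * (1 + 2 * t)" by simp
    then have "even m \<longleftrightarrow> even n" by simp
    then show ?thesis by (simp add: z sg_def power_int_minus_left)
  qed
  have sg2: "sg z = - 1" if "z \<in> O2" for z
  proof -
    obtain m n where z: "z = (m, n)" by force
    have "(m + n) mod 4 = 1" using that by (simp only: z O2_def mem_Collect_eq prod.case)
    from mod_4_imp_ex[OF this] obtain t where "m + n = 1 + 4 * t" ..
    then have "m = - n + 2 * (2 * t) + 1" by simp
    then have "even m \<longleftrightarrow> odd n" by simp
    then show ?thesis by (simp add: z sg_def power_int_minus_left)
  qed
  have "euler q * euler (q ^ 7) - euler (- q) * euler (- (q ^ 7)) =
     (\<Sum>\<^sub>\<infinity>z. sg z * q ^ M z) - (\<Sum>\<^sub>\<infinity>z. sg z * (- q) ^ M z)"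
    using prod(2)[OF q] prod(2)[OF qm] by (simp add: power_minus_odd)
  also have "\<dots> = (\<Sum>\<^sub>\<infinity>z. sg z * q ^ M z - sg z * (- q) ^ M z)"
    using infsum_add[OF sums[OF q] summable_on_uminus[THEN iffD2, OF sums[OF qm]]] by (simp add: infsum_uminus)
  also have "\<dots> = (\<Sum>\<^sub>\<infinity>z\<in>O1 \<union> O2. 2 * (sg z * q ^ M z))"
  proof (rule infsum_cong_neutral)
    have mq: "(- q) ^ M z = (if z \<in> O1 \<union> O2 then - (q ^ M z) else q ^ M z)" for z
      using oddM[of z] by (cases "odd (M z)") (simp_all add: power_minus_odd power_minus_even)
    show "sg z * q ^ M z - sg z * (- q) ^ M z = 0" if "z \<in> UNIV - (O1 \<union> O2)" for z
      using that unfolding mq by simp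
    show "sg z * q ^ M z - sg z * (- q) ^ M z = 2 * (sg z * q ^ M z)" if "z \<in> UNIV \<inter> (O1 \<union> O2)" for z
      using that unfolding mq by simp
  qed simp
  also have "\<dots> = 2 * (\<Sum>\<^sub>\<infinity>z\<in>O1 \<union> O2. sg z * q ^ M z)"
    by (simp add: infsum_cmult_right')
  also have "(\<Sum>\<^sub>\<infinity>z\<in>O1 \<union> O2. sg z * q ^ M z) = (\<Sum>\<^sub>\<infinity>z\<in>O1. sg z * q ^ M z) + (\<Sum>\<^sub>\<infinity>z\<in>O2. sg z * q ^ M z)"
  proof (rule infsum_Un_disjoint[OF sums[OF q] sums[OF q]])
    have "z \<notin> O2" if "z \<in> O1" for z using sg1[OF that] sg2[of z] by auto
    then show "O1 \<inter> O2 = {}" by blast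
  qed
  also have "(\<Sum>\<^sub>\<infinity>z\<in>O1. sg z * q ^ M z) = (\<Sum>\<^sub>\<infinity>z\<in>O1. q ^ M z)"
    by (rule infsum_cong) (simp add: sg1)
  also have "(\<Sum>\<^sub>\<infinity>z\<in>O2. sg z * q ^ M z) = - (\<Sum>\<^sub>\<infinity>z\<in>O2. q ^ M z)"
    by (subst infsum_uminus[symmetric], rule infsum_cong) (simp add: sg2)
  finally have 1: "euler q * euler (q ^ 7) - euler (- q) * euler (- (q ^ 7)) =
      2 * ((\<Sum>\<^sub>\<infinity>z\<in>O1. q ^ M z) - (\<Sum>\<^sub>\<infinity>z\<in>O2. q ^ M z))" by simp

  \<comment> \<open>With \<open>x = 6 m - 1\<close> and \<open>y = 6 n - 1\<close> the exponent \<open>M (m, n)\<close> is \<open>(x\<^sup>2 + 7 y\<^sup>2 - 8) / 24\<close>. If it is odd, then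
    \<open>(x + y \<surd>(-7)) / 2\<close> is divisible by the square of exactly one of the two primes above 2 in the ring of
    integers of \<open>\<rat>(\<surd>(-7))\<close>; up to sign and conjugation, \<open>F\<close> and \<open>G\<close> divide by that square.\<close>
  define N where "N = (\<lambda>(i, j). nat ((3 * i * i - 2 * i + 21 * j * j - 14 * j + 2) div 2 :: int))"
  define F where "F = (\<lambda>(m, n). ((3 * m - 7 * n + 2) div 4, (2 - m - 3 * n) div 4 :: int))"
  define G where "G = (\<lambda>(m, n). ((3 - 3 * m - 7 * n) div 4, (1 - m + 3 * n) div 4 :: int))"
  define G' where "G' = (\<lambda>(i, j). ((4 - 3 * i - 7 * j) div 4, (3 * j - i) div 4 :: int))"
  have F: "F z \<in> O1 \<and> F (F z) = z \<and> N (F z) = M z" if z: "z \<in> O1" for z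
  proof -
    obtain m n where mn: "z = (m, n)" by force
    have "(m - n) mod 4 = 2" using z by (simp only: mn O1_def mem_Collect_eq prod.case)
    from mod_4_imp_ex[OF this] obtain t where "m - n = 2 + 4 * t" ..
    then have t: "m = n + 2 + 4 * t" by simp
    have eq: "3 * m - 7 * n + 2 = (- n + 3 * t + 2) * 4" "2 - m - 3 * n = (- n - t) * 4" using t by auto
    have Fz: "F z = (- n + 3 * t + 2, - n - t)" unfolding mn F_def prod.case eq by simp
    have "- n + 3 * t + 2 - (- n - t) = 2 + 4 * t" by simp
    then have 1: "F z \<in> O1" unfolding Fz O1_def mem_Collect_eq prod.case by simp
    have eq': "3 * (- n + 3 * t + 2) - 7 * (- n - t) + 2 = m * 4" "2 - (- n + 3 * t + 2) - 3 * (- n - t) = n * 4"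
      using t by auto
    have 2: "F (F z) = z" unfolding Fz unfolding F_def prod.case eq' mn by simp
    let ?i = "- n + 3 * t + 2" let ?j = "- n - t"
    have "3 * ?i * ?i - 2 * ?i + 21 * ?j * ?j - 14 * ?j + 2 = m * (3 * m - 1) + 7 * (n * (3 * n - 1))"
      unfolding t by (simp add: algebra_simps)
    also have "\<dots> = int (M z) * 2"
      unfolding pent_eq[symmetric] by (simp add: mn M_def)
    finally have 3: "N (F z) = M z" unfolding Fz N_def prod.case by simp
    from 1 2 3 show ?thesis by simp
  qed
  have G: "G z \<in> O3 \<and> G' (G z) = z \<and> N (G z) = M z" if z: "z \<in> O2" for z
  proof -
    obtain m n where mn: "z = (m, n)" by force
    have "(m + n) mod 4 = 1" using z by (simp only: mn O2_def mem_Collect_eq prod.case)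
    from mod_4_imp_ex[OF this] obtain t where "m + n = 1 + 4 * t" ..
    then have t: "m = - n + 1 + 4 * t" by simp
    have eq: "3 - 3 * m - 7 * n = (- n - 3 * t) * 4" "1 - m + 3 * n = (n - t) * 4" using t by auto
    have Gz: "G z = (- n - 3 * t, n - t)" unfolding mn G_def prod.case eq by simp
    have "- n - 3 * t + (n - t) = 4 * - t" by simp
    then have 1: "G z \<in> O3" unfolding Gz O3_def mem_Collect_eq prod.case by simp
    have eq': "4 - 3 * (- n - 3 * t) - 7 * (n - t) = m * 4" "3 * (n - t) - (- n - 3 * t) = n * 4"
      using t by auto
    have 2: "G' (G z) = z" unfolding Gz unfolding G'_def prod.case eq' mn by simp
    let ?i = "- n - 3 * t" let ?j = "n - t"
    have "3 * ?i * ?i - 2 * ?i + 21 * ?j * ?j - 14 * ?j + 2 = m * (3 * m - 1) + 7 * (n * (3 * n - 1))"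
      unfolding t by (simp add: algebra_simps)
    also have "\<dots> = int (M z) * 2"
      unfolding pent_eq[symmetric] by (simp add: mn M_def)
    finally have 3: "N (G z) = M z" unfolding Gz N_def prod.case by simp
    from 1 2 3 show ?thesis by simp
  qed
  have G': "G' z \<in> O2 \<and> G (G' z) = z" if z: "z \<in> O3" for z
  proof -
    obtain m n where mn: "z = (m, n)" by force
    have "(m + n) mod 4 = 0" using z by (simp only: mn O3_def mem_Collect_eq prod.case)
    from mod_4_imp_ex[OF this] obtain t where "m + n = 0 + 4 * t" ..
    then have t: "m = - n + 4 * t" by simp
    have eq: "4 - 3 * m - 7 * n = (1 - n - 3 * t) * 4" "3 * n - m = (n - t) * 4" using t by auto
    have Gz: "G' z = (1 - n - 3 * t, n - t)" unfolding mn G'_def prod.case eq by simp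
    have "1 - n - 3 * t + (n - t) = 1 + 4 * - t" by simp
    then have 1: "G' z \<in> O2" unfolding Gz O2_def mem_Collect_eq prod.case by (simp only: mod_mult_self2) simp
    have eq': "3 - 3 * (1 - n - 3 * t) - 7 * (n - t) = m * 4" "1 - (1 - n - 3 * t) + 3 * (n - t) = n * 4"
      using t by auto
    have 2: "G (G' z) = z" unfolding Gz unfolding G_def prod.case eq' mn by simp
    from 1 2 show ?thesis by simp
  qed
  have S1: "(\<Sum>\<^sub>\<infinity>z\<in>O1. q ^ M z) = (\<Sum>\<^sub>\<infinity>z\<in>O1. q ^ N z)"
    by (rule infsum_reindex_bij_witness[of _ F F]) (use F in auto)
  have N1: "(\<lambda>z. q ^ N z) summable_on O1"
    using summable_on_reindex_bij_witness[of O1 F F O1 "\<lambda>z. q ^ N z" "\<lambda>z. q ^ M z"] F sumM[of O1] by auto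
  have S2: "(\<Sum>\<^sub>\<infinity>z\<in>O2. q ^ M z) = (\<Sum>\<^sub>\<infinity>z\<in>O3. q ^ N z)"
    by (rule infsum_reindex_bij_witness[of _ G' G]) (use G G' in auto)
  have N3: "(\<lambda>z. q ^ N z) summable_on O3"
    using summable_on_reindex_bij_witness[of O2 G' G O3 "\<lambda>z. q ^ N z" "\<lambda>z. q ^ M z"] G G' sumM[of O2] by auto
  \<comment> \<open>Both sums now have terms \<open>q ^ N z\<close>. The ranges \<open>O1\<close>
    and \<open>O3\<close> contain the same pairs of odd integers, so these cancel in the difference
    and only pairs of even integers remain.\<close>
  define D where "D = {(i, j). odd (i::int) \<and> odd (j::int)}"
  have D13: "O1 \<inter> D = O3 \<inter> D"
  proof -
    have "(2 * i + 1 - (2 * j + 1)) mod 4 = 2 \<longleftrightarrow> (2 * i + 1 + (2 * j + 1)) mod 4 = 0" for i j :: int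
    proof -
      have "2 * i + 1 - (2 * j + 1) = 2 * (i - j)" "2 * i + 1 + (2 * j + 1) = 2 * (i + j + 1)" by simp_all
      then show ?thesis by (simp only: mod_4_double) (simp add: mod_2_eq_odd)
    qed
    then show ?thesis unfolding O1_def O3_def D_def by (auto elim!: oddE)
  qed
  let ?e = "\<lambda>z. q ^ N z"
  have split: "infsum ?e S = infsum ?e (S \<inter> D) + infsum ?e (S - D)" if "?e summable_on S" for S
  proof -
    have "?e summable_on S \<inter> D" "?e summable_on S - D"
      by (rule summable_on_subset_banach[OF that]; blast)+
    then have "infsum ?e ((S \<inter> D) \<union> (S - D)) = infsum ?e (S \<inter> D) + infsum ?e (S - D)"
      by (rule infsum_Un_disjoint) blast
    then show ?thesis by (simp only: Int_Diff_Un)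
  qed
  note s1 = split[OF N1] and s3 = split[OF N3]
  \<comment> \<open>Halving an even pair brings back the pentagonal exponent. Whether it came from
    \<open>O1\<close> or \<open>O3\<close> is then the parity of k + l, which is the sign of the
    term in the product of the two pentagonal series.\<close>
  have MN: "q ^ N (2 * k, 2 * l) = q * (q ^ 4) ^ M (k, l)" for k l
  proof -
    have "3 * (2 * k) * (2 * k) - 2 * (2 * k) + 21 * (2 * l) * (2 * l) - 14 * (2 * l) + 2 =
      2 + 4 * (k * (3 * k - 1)) + 28 * (l * (3 * l - 1))" by (simp add: algebra_simps)
    also have "\<dots> = int (1 + 4 * M (k, l)) * 2"
      unfolding pent_eq[symmetric] by (simp add: M_def)
    finally have "N (2 * k, 2 * l) = 1 + 4 * M (k, l)" unfolding N_def prod.case by simp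
    then show ?thesis by (simp only: power_add power_mult power_one_right)
  qed
  let ?P1 = "{(k, l). odd (k - l :: int)}" and ?P3 = "{(k, l). even (k + l :: int)}"
  have e1: "infsum ?e (O1 - D) = (\<Sum>\<^sub>\<infinity>z\<in>?P1. q * (q ^ 4) ^ M z)"
  proof (rule infsum_reindex_bij_witness[of _ "\<lambda>(k, l). (2 * k, 2 * l)" "\<lambda>(i, j). (i div 2, j div 2)"])
    fix a assume a: "a \<in> O1 - D"
    obtain i j where ij: "a = (i, j)" by force
    have m4: "(i - j) mod 4 = 2" and nd: "\<not> (odd i \<and> odd j)"
      using a unfolding ij O1_def D_def by auto
    obtain t where "i - j = 2 + 4 * t" using mod_4_imp_ex[OF m4] ..
    then have "even (i - j)" by simp
    with nd have ev12: "even i" "even j" by auto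
    then have "i - j = 2 * (i div 2 - j div 2)" by simp
    with m4 have "odd (i div 2 - j div 2)" by (simp only: mod_4_double) (simp add: mod_2_eq_odd split: if_splits)
    note ev = ev12 this
    show "(case case a of (i, j) \<Rightarrow> (i div 2, j div 2) of (k, l) \<Rightarrow> (2 * k, 2 * l)) = a"
      using ev by (simp add: ij)
    show "(case a of (i, j) \<Rightarrow> (i div 2, j div 2)) \<in> ?P1" using ev by (simp add: ij)
    show "q * (q ^ 4) ^ M (case a of (i, j) \<Rightarrow> (i div 2, j div 2)) = q ^ N a"
      using ev MN[of "i div 2" "j div 2"] by (simp add: ij)
  next
    fix b assume b: "b \<in> ?P1"
    obtain k l where kl: "b = (k, l)" by force
    show "(case case b of (k, l) \<Rightarrow> (2 * k, 2 * l) of (i, j) \<Rightarrow> (i div 2, j div 2)) = b" by (simp add: kl)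
    have "2 * k - 2 * l = 2 * (k - l)" by simp
    then have "(2 * k - 2 * l) mod 4 = 2"
      using b unfolding kl by (simp only: mod_4_double) (simp add: mod_2_eq_odd)
    then show "(case b of (k, l) \<Rightarrow> (2 * k, 2 * l)) \<in> O1 - D" by (simp add: kl O1_def D_def)
  qed
  have e3: "infsum ?e (O3 - D) = (\<Sum>\<^sub>\<infinity>z\<in>?P3. q * (q ^ 4) ^ M z)"
  proof (rule infsum_reindex_bij_witness[of _ "\<lambda>(k, l). (2 * k, 2 * l)" "\<lambda>(i, j). (i div 2, j div 2)"])
    fix a assume a: "a \<in> O3 - D"
    obtain i j where ij: "a = (i, j)" by force
    have m4: "(i + j) mod 4 = 0" and nd: "\<not> (odd i \<and> odd j)"
      using a unfolding ij O3_def D_def by auto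
    obtain t where "i + j = 0 + 4 * t" using mod_4_imp_ex[OF m4] ..
    then have "even (i + j)" by simp
    with nd have ev12: "even i" "even j" by auto
    then have "i + j = 2 * (i div 2 + j div 2)" by simp
    with m4 have "even (i div 2 + j div 2)" by (simp only: mod_4_double) (simp add: mod_2_eq_odd split: if_splits)
    note ev = ev12 this
    show "(case case a of (i, j) \<Rightarrow> (i div 2, j div 2) of (k, l) \<Rightarrow> (2 * k, 2 * l)) = a"
      using ev by (simp add: ij)
    show "(case a of (i, j) \<Rightarrow> (i div 2, j div 2)) \<in> ?P3" using ev by (simp add: ij)
    show "q * (q ^ 4) ^ M (case a of (i, j) \<Rightarrow> (i div 2, j div 2)) = q ^ N a"
      using ev MN[of "i div 2" "j div 2"] by (simp add: ij)
  next
    fix b assume b: "b \<in> ?P3"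
    obtain k l where kl: "b = (k, l)" by force
    show "(case case b of (k, l) \<Rightarrow> (2 * k, 2 * l) of (i, j) \<Rightarrow> (i div 2, j div 2)) = b" by (simp add: kl)
    have "2 * k + 2 * l = 2 * (k + l)" by simp
    then have "(2 * k + 2 * l) mod 4 = 0"
      using b unfolding kl by (simp only: mod_4_double) (simp add: mod_2_eq_odd)
    then show "(case b of (k, l) \<Rightarrow> (2 * k, 2 * l)) \<in> O3 - D" by (simp add: kl O3_def D_def)
  qed
  have sg_P1: "sg z = - 1" if "z \<in> ?P1" for z
  proof -
    obtain m n where z: "z = (m, n)" by force
    have "even m \<longleftrightarrow> odd n" using that unfolding z by simp
    then show ?thesis by (simp add: z sg_def power_int_minus_left)
  qed
  have sg_P3: "sg z = 1" if "z \<in> ?P3" for z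
  proof -
    obtain m n where z: "z = (m, n)" by force
    have "even m \<longleftrightarrow> even n" using that unfolding z by simp
    then show ?thesis by (simp add: z sg_def power_int_minus_left)
  qed
  have q4: "norm (q ^ 4) < 1" "q ^ 4 \<noteq> 0" using np q by auto
  have "euler (q ^ 4) * euler (q ^ 28) = (\<Sum>\<^sub>\<infinity>z. sg z * (q ^ 4) ^ M z)"
    using prod(2)[OF q4] unfolding power_mult[symmetric, of q 4 7] by simp
  also have "\<dots> = (\<Sum>\<^sub>\<infinity>z\<in>?P1. sg z * (q ^ 4) ^ M z) + (\<Sum>\<^sub>\<infinity>z\<in>?P3. sg z * (q ^ 4) ^ M z)"
  proof -
    have U: "UNIV = ?P1 \<union> ?P3" and d: "?P1 \<inter> ?P3 = {}" by auto
    show ?thesis by (subst U) (rule infsum_Un_disjoint[OF sums[OF q4] sums[OF q4] d])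
  qed
  also have "(\<Sum>\<^sub>\<infinity>z\<in>?P1. sg z * (q ^ 4) ^ M z) = - (\<Sum>\<^sub>\<infinity>z\<in>?P1. (q ^ 4) ^ M z)"
    by (subst infsum_uminus[symmetric], rule infsum_cong) (simp add: sg_P1)
  also have "(\<Sum>\<^sub>\<infinity>z\<in>?P3. sg z * (q ^ 4) ^ M z) = (\<Sum>\<^sub>\<infinity>z\<in>?P3. (q ^ 4) ^ M z)"
    by (rule infsum_cong) (simp add: sg_P3)
  finally have "euler (q ^ 4) * euler (q ^ 28) =
    - (\<Sum>\<^sub>\<infinity>z\<in>?P1. (q ^ 4) ^ M z) + (\<Sum>\<^sub>\<infinity>z\<in>?P3. (q ^ 4) ^ M z)" .
  then have "q * (euler (q ^ 4) * euler (q ^ 28)) = infsum ?e (O3 - D) - infsum ?e (O1 - D)"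
    using e1 e3 infsum_cmult_right'[of q "\<lambda>z. (q ^ 4) ^ M z"] by (simp only: distrib_left) simp
  then have 2: "q * (euler (q ^ 4) * euler (q ^ 28)) = infsum ?e O3 - infsum ?e O1"
    using s1 s3 D13 by simp
  have "euler (- q) * euler (- (q ^ 7)) - euler q * euler (q ^ 7) =
      - (euler q * euler (q ^ 7) - euler (- q) * euler (- (q ^ 7)))" by (rule minus_diff_eq[symmetric])
  also have "\<dots> = 2 * (infsum ?e O3 - infsum ?e O1)"
    by (simp only: 1 S1 S2 mult_minus_right[symmetric] minus_diff_eq)
  also have "\<dots> = 2 * q * euler (q ^ 4) * euler (q ^ 28)"
    by (simp only: 2[symmetric] mult.assoc)
  finally show ?thesis .
qed

section \<open>Jacobi's quartic identity\<close>

text \<open>Write the squares as sums over pairs and split by the parity of m + n. Pairs of even sum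
  are (k + l, k - l), which doubles the form m^2 + n^2. Pairs of odd sum are (k + l - 1, k - l),
  which turns m^2 + n^2 into 1 plus 4 times a sum of two triangular numbers.\<close>

lemma phi_psi_squares:
  fixes q :: "'a::{real_normed_field,banach}"
  assumes q: "norm q < 1" "q \<noteq> 0"
  shows "ram_theta q q ^ 2 + ram_theta (- q) (- q) ^ 2 = 2 * ram_theta (q\<^sup>2) (q\<^sup>2) ^ 2"
    and "ram_theta q q ^ 2 - ram_theta (- q) (- q) ^ 2 = 2 * q * ram_theta 1 (q ^ 4) ^ 2"
proof -
  define s where "s m = tri m + tri (- m)" for m
  have s: "int (s m) = m * m" for m unfolding s_def by (rule tri_add_tri_minus)
  define M where "M = (\<lambda>(m, n). s m + s n)"
  have sq: "(\<lambda>z. x ^ M z) abs_summable_on UNIV" "ram_theta x x ^ 2 = (\<Sum>\<^sub>\<infinity>z. x ^ M z)"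
    if x: "norm x < 1" "x \<noteq> 0" for x :: 'a
  proof -
    have xx: "norm (x * x) < 1" using norm_power_lt_1[OF x(1), of 2] by (simp add: power2_eq_square)
    have 1: "(\<lambda>m. norm (x ^ s m)) summable_on UNIV"
      using ram_theta_abs_summable[OF x(2) x(2) xx] by (simp add: s_def power_add)
    have 2: "ram_theta x x = (\<Sum>\<^sub>\<infinity>m. x ^ s m)" by (simp add: ram_theta_def s_def power_add)
    have t: "x ^ s m * x ^ s n = x ^ M (m, n)" for m n by (simp add: M_def power_add)
    have "(\<lambda>(m, n). norm (x ^ s m * x ^ s n)) = (\<lambda>z. norm (x ^ M z))"
      by (rule ext, clarify) (simp only: t)
    then show "(\<lambda>z. x ^ M z) abs_summable_on UNIV" using infsum_times(1)[OF 1 1] by simp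
    have "(\<lambda>(m, n). x ^ s m * x ^ s n) = (\<lambda>z. x ^ M z)"
      by (rule ext, clarify) (simp only: t)
    then show "ram_theta x x ^ 2 = (\<Sum>\<^sub>\<infinity>z. x ^ M z)"
      using infsum_times(2)[OF 1 1] by (simp add: 2 power2_eq_square)
  qed
  have qm: "norm (- q) < 1" "- q \<noteq> 0" using q by auto
  have q2: "norm (q\<^sup>2) < 1" "q\<^sup>2 \<noteq> 0" using norm_power_lt_1[OF q(1), of 2] q by auto
  have q4: "norm (q ^ 4) < 1" "q ^ 4 \<noteq> 0" using norm_power_lt_1[OF q(1), of 4] q by auto
  have sums: "(\<lambda>z. x ^ M z) summable_on S" if x: "norm x < 1" "x \<noteq> 0" for x :: 'a and S
    by (rule summable_on_subset_banach[OF abs_summable_summable[OF sq(1)[OF x]]]) simp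
  let ?E = "{(m, n). even (m + n :: int)}" and ?O = "{(m, n). odd (m + n :: int)}"
  have par: "even (M (m, n)) \<longleftrightarrow> even (m + n)" for m n
  proof -
    have "int (M (m, n)) = m * m + n * n" by (simp add: M_def s)
    then have "even (int (M (m, n))) \<longleftrightarrow> even (m * m + n * n)" by simp
    then show ?thesis by simp
  qed
  have split: "(\<Sum>\<^sub>\<infinity>z. x ^ M z) = (\<Sum>\<^sub>\<infinity>z\<in>?E. x ^ M z) + (\<Sum>\<^sub>\<infinity>z\<in>?O. x ^ M z)"
    if x: "norm x < 1" "x \<noteq> 0" for x :: 'a
  proof -
    have U: "UNIV = ?E \<union> ?O" and d: "?E \<inter> ?O = {}" by auto
    show ?thesis by (subst U) (rule infsum_Un_disjoint[OF sums[OF x] sums[OF x] d])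
  qed
  have mE: "(\<Sum>\<^sub>\<infinity>z\<in>?E. (- q) ^ M z) = (\<Sum>\<^sub>\<infinity>z\<in>?E. q ^ M z)"
    by (rule infsum_cong) (use par in \<open>auto simp del: even_add\<close>)
  have "(\<Sum>\<^sub>\<infinity>z\<in>?O. (- q) ^ M z) = (\<Sum>\<^sub>\<infinity>z\<in>?O. - (q ^ M z))"
    by (rule infsum_cong) (use par in \<open>auto simp del: even_add simp: power_minus_odd\<close>)
  then have mO: "(\<Sum>\<^sub>\<infinity>z\<in>?O. (- q) ^ M z) = - (\<Sum>\<^sub>\<infinity>z\<in>?O. q ^ M z)"
    by (simp only: infsum_uminus)
  have E: "(\<Sum>\<^sub>\<infinity>z\<in>?E. q ^ M z) = (\<Sum>\<^sub>\<infinity>z. (q\<^sup>2) ^ M z)"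
  proof (rule infsum_reindex_bij_witness[of _ "\<lambda>(k, l). (k + l, k - l)" "\<lambda>(m, n). ((m + n) div 2, (m - n) div 2)"])
    fix a assume a: "a \<in> ?E"
    obtain m n where mn: "a = (m, n)" by force
    have "even (m + n)" using a by (simp add: mn)
    then obtain k where "m + n = 2 * k" by (elim evenE)
    then have m: "m = 2 * k - n" by simp
    have 1: "(\<lambda>(m, n). ((m + n) div 2, (m - n) div 2)) a = (k, k - n)"
    proof -
      have "m + n = 2 * k" "m - n = 2 * (k - n)" unfolding m by simp_all
      then show ?thesis unfolding mn prod.case by (auto simp only: nonzero_mult_div_cancel_left)
    qed
    show "(\<lambda>(k, l). (k + l, k - l)) ((\<lambda>(m, n). ((m + n) div 2, (m - n) div 2)) a) = a"
      unfolding 1 by (simp add: mn m)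
    have "int (M (m, n)) = int (2 * M (k, k - n))" by (simp add: M_def s m algebra_simps)
    then have "M (m, n) = 2 * M (k, k - n)" by (simp only: of_nat_eq_iff)
    then show "(q\<^sup>2) ^ M ((\<lambda>(m, n). ((m + n) div 2, (m - n) div 2)) a) = q ^ M a"
      unfolding 1 by (simp add: mn power_mult)
  next
    fix b :: "int \<times> int"
    obtain k l where kl: "b = (k, l)" by force
    show "(\<lambda>(k, l). (k + l, k - l)) b \<in> ?E" by (simp add: kl)
    have "k + l + (k - l) = 2 * k" "k + l - (k - l) = 2 * l" by simp_all
    then show "(\<lambda>(m, n). ((m + n) div 2, (m - n) div 2)) ((\<lambda>(k, l). (k + l, k - l)) b) = b"
      unfolding kl prod.case by (auto simp only: nonzero_mult_div_cancel_left)
  qed simp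
  define T where "T = (\<lambda>(k, l). tri (- k) + tri (- l))"
  have O: "(\<Sum>\<^sub>\<infinity>z\<in>?O. q ^ M z) = (\<Sum>\<^sub>\<infinity>z. q * (q ^ 4) ^ T z)"
  proof (rule infsum_reindex_bij_witness[of _ "\<lambda>(k, l). (k + l - 1, k - l)" "\<lambda>(m, n). ((m + n + 1) div 2, (m - n + 1) div 2)"])
    fix a assume a: "a \<in> ?O"
    obtain m n where mn: "a = (m, n)" by force
    have "odd (m + n)" using a by (simp add: mn)
    then have "even (m + n + 1)" by simp
    then obtain k where "m + n + 1 = 2 * k" by (elim evenE)
    then have m: "m = 2 * k - n - 1" by simp
    have 1: "(\<lambda>(m, n). ((m + n + 1) div 2, (m - n + 1) div 2)) a = (k, k - n)"
    proof -
      have "m + n + 1 = 2 * k" "m - n + 1 = 2 * (k - n)" unfolding m by simp_all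
      then show ?thesis unfolding mn prod.case by (auto simp only: nonzero_mult_div_cancel_left)
    qed
    show "(\<lambda>(k, l). (k + l - 1, k - l)) ((\<lambda>(m, n). ((m + n + 1) div 2, (m - n + 1) div 2)) a) = a"
      unfolding 1 by (simp add: mn m)
    have "int (M (m, n)) = 1 + 2 * (2 * int (tri (- k)) + 2 * int (tri (- (k - n))))"
      unfolding tri_minus_eq by (simp add: M_def s m algebra_simps)
    also have "\<dots> = int (1 + 4 * T (k, k - n))" by (simp add: T_def)
    finally have "M (m, n) = 1 + 4 * T (k, k - n)" by (simp only: of_nat_eq_iff)
    then have "q ^ M (m, n) = q * (q ^ 4) ^ T (k, k - n)"
      by (simp only: power_add power_mult power_one_right)
    then show "q * (q ^ 4) ^ T ((\<lambda>(m, n). ((m + n + 1) div 2, (m - n + 1) div 2)) a) = q ^ M a"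
      unfolding 1 by (simp add: mn)
  next
    fix b :: "int \<times> int"
    obtain k l where kl: "b = (k, l)" by force
    show "(\<lambda>(k, l). (k + l - 1, k - l)) b \<in> ?O" by (simp add: kl)
    have "k + l - 1 + (k - l) + 1 = 2 * k" "k + l - 1 - (k - l) + 1 = 2 * l" by simp_all
    then show "(\<lambda>(m, n). ((m + n + 1) div 2, (m - n + 1) div 2)) ((\<lambda>(k, l). (k + l - 1, k - l)) b) = b"
      unfolding kl prod.case by (auto simp only: nonzero_mult_div_cancel_left)
  qed simp
  have psi: "ram_theta 1 (q ^ 4) ^ 2 = (\<Sum>\<^sub>\<infinity>z. (q ^ 4) ^ T z)"
  proof -
    have 1: "(\<lambda>m. norm ((q ^ 4) ^ tri (- m))) summable_on UNIV"
      using ram_theta_abs_summable[of 1 "q ^ 4"] q4 by simp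
    have 2: "ram_theta 1 (q ^ 4) = (\<Sum>\<^sub>\<infinity>m. (q ^ 4) ^ tri (- m))" by (simp add: ram_theta_def)
    have "(\<lambda>(m, n). (q ^ 4) ^ tri (- m) * (q ^ 4) ^ tri (- n)) = (\<lambda>z. (q ^ 4) ^ T z)"
      by (rule ext, clarify) (simp only: T_def power_add prod.case)
    then show ?thesis using infsum_times(2)[OF 1 1] by (simp only: 2 power2_eq_square UNIV_Times_UNIV)
  qed
  have p: "ram_theta q q ^ 2 = ram_theta (q\<^sup>2) (q\<^sup>2) ^ 2 + q * ram_theta 1 (q ^ 4) ^ 2"
    unfolding sq(2)[OF q] split[OF q] E O sq(2)[OF q2] psi by (simp only: infsum_cmult_right')
  have m: "ram_theta (- q) (- q) ^ 2 = ram_theta (q\<^sup>2) (q\<^sup>2) ^ 2 - q * ram_theta 1 (q ^ 4) ^ 2"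
    unfolding sq(2)[OF qm] split[OF qm] mE mO E O sq(2)[OF q2] psi by (simp only: infsum_cmult_right') simp
  show "ram_theta q q ^ 2 + ram_theta (- q) (- q) ^ 2 = 2 * ram_theta (q\<^sup>2) (q\<^sup>2) ^ 2"
    "ram_theta q q ^ 2 - ram_theta (- q) (- q) ^ 2 = 2 * q * ram_theta 1 (q ^ 4) ^ 2"
    unfolding p m by (simp_all add: algebra_simps)
qed

lemma euler_minus:
  fixes q :: "'a::{real_normed_field,banach}"
  assumes q: "norm q < 1"
  shows "euler (- q) * (euler q * euler (q ^ 4)) = euler (q\<^sup>2) ^ 3"
proof -
  have q2: "norm (q\<^sup>2) < 1" using norm_power_lt_1[OF q, of 2] by simp
  have qm: "norm (- q) < 1" using q by simp
  have "qpoch_inf q (q\<^sup>2) * qpoch_inf (- q) (q\<^sup>2) = qpoch_inf (q\<^sup>2) (q ^ 4)" using qpoch_inf_minus_mult[OF q2, of q] by simp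
  then have "qpoch_inf q (q\<^sup>2) * qpoch_inf (- q) (q\<^sup>2) * euler (q ^ 4) = euler (q\<^sup>2)"
    using euler_split2[OF q2] by simp
  moreover have "euler (- q) = qpoch_inf (- q) (q\<^sup>2) * euler (q\<^sup>2)" using euler_split2[OF qm] by simp
  ultimately show ?thesis
    unfolding euler_split2[OF q] by (simp add: power3_eq_cube mult_ac)
qed

text \<open>Multiplying the two identities of \<open>phi_psi_squares\<close> gives phi(q)^4 -
  phi(-q)^4 = 16 q psi(q^2)^4. As a relation of eta quotients this is f^8 = f_1^8 + f_2^8 for
  Weber's functions, the form used in degree 7.\<close>

theorem jacobi_quartic:
  fixes q :: "'a::{real_normed_field,banach}"
  assumes q: "norm q < 1" "q \<noteq> 0"
  defines "e1 \<equiv> euler q" and "e2 \<equiv> euler (q\<^sup>2)" and "e4 \<equiv> euler (q ^ 4)"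
  shows "e2 ^ 24 = e1 ^ 16 * e4 ^ 8 + 16 * q * (e1 ^ 8 * e4 ^ 16)"
proof -
  have np: "norm (q\<^sup>2) < 1" "norm (q ^ 4) < 1" "norm (q ^ 8) < 1"
    by (rule norm_power_lt_1[OF q(1)]; simp)+
  have pq: "(q\<^sup>2)\<^sup>2 = q ^ 4" "(q\<^sup>2) ^ 4 = q ^ 8" "(q ^ 4)\<^sup>2 = q ^ 8" by algebra+
  have nz: "e1 \<noteq> 0" "e2 \<noteq> 0" "e4 \<noteq> 0"
    unfolding e1_def e2_def e4_def by (rule euler_nonzero; fact)+
  define e8 where "e8 = euler (q ^ 8)"
  have nz8: "e8 \<noteq> 0" unfolding e8_def by (rule euler_nonzero; fact)
  define em where "em = euler (- q)"
  define em2 where "em2 = euler (- (q\<^sup>2))"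
  have em: "em * (e1 * e4) = e2 ^ 3" unfolding em_def e1_def e4_def e2_def by (rule euler_minus[OF q(1)])
  have em2: "em2 * (e2 * e8) = e4 ^ 3"
    using euler_minus[OF np(1)] unfolding em2_def e8_def e4_def e2_def pq .
  have P1: "ram_theta (- q) (- q) * e2 = e1 ^ 2" unfolding e2_def e1_def by (rule ram_theta_phi[OF q])
  have P0: "ram_theta q q * e2 = em ^ 2" using ram_theta_phi[of "- q"] q by (simp add: e2_def em_def)
  have P2: "ram_theta (q\<^sup>2) (q\<^sup>2) * e4 = em2 ^ 2" using ram_theta_phi[of "- (q\<^sup>2)"] np q by (simp add: e4_def em2_def pq)
  have P4: "ram_theta 1 (q ^ 4) * e4 = 2 * e8 ^ 2" using ram_theta_psi[of "q ^ 4"] np q by (simp add: e4_def e8_def pq)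
  have p0: "ram_theta q q = em ^ 2 / e2" and p1: "ram_theta (- q) (- q) = e1 ^ 2 / e2" and
     p2: "ram_theta (q\<^sup>2) (q\<^sup>2) = em2 ^ 2 / e4" and p4: "ram_theta 1 (q ^ 4) = 2 * e8 ^ 2 / e4"
    using P0 P1 P2 P4 nz by (simp_all add: field_simps)
  have e: "em = e2 ^ 3 / (e1 * e4)" "em2 = e4 ^ 3 / (e2 * e8)" using em em2 nz nz8 by (simp_all add: field_simps)
  have "ram_theta q q ^ 4 - ram_theta (- q) (- q) ^ 4 = 4 * q * (ram_theta (q\<^sup>2) (q\<^sup>2) * ram_theta 1 (q ^ 4)) ^ 2"
    using phi_psi_squares[OF q] by algebra
  also have "ram_theta (q\<^sup>2) (q\<^sup>2) * ram_theta 1 (q ^ 4) = 2 * e4 ^ 4 / e2 ^ 2"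
    unfolding p2 p4 e using nz nz8 by (simp add: field_simps) algebra
  finally have "e2 ^ 8 * e2 ^ 24 = e2 ^ 8 * (e1 ^ 16 * e4 ^ 8 + 16 * q * (e1 ^ 8 * e4 ^ 16))"
    unfolding p0 p1 e using nz by (simp add: field_simps)
  then show ?thesis using nz mult_left_cancel[of "e2 ^ 8"] by (metis power_not_zero)
qed

section \<open>Modular equations of degree 3 and 7\<close>

text \<open>The Dedekind eta function at the point \<open>it\<close> of the imaginary axis.\<close>

definition eta :: "real \<Rightarrow> real" where
  "eta t = exp (- (pi * t / 12)) * euler (exp (- (2 * pi * t)))"

lemma euler_pos:
  fixes q :: real
  assumes "0 \<le> q" "q < 1"
  shows "euler q > 0"
proof -
  have "0 < 1 - q * q ^ k" for k
    using power_less_one_iff[of q "Suc k"] assms by simp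
  then have "0 \<le> (\<Prod>k<n. 1 - q * q ^ k)" for n
    by (intro prod_nonneg) (auto intro: less_imp_le)
  then have "0 \<le> euler q"
    unfolding euler_def using assms by (intro LIMSEQ_le_const[OF qpoch_inf_LIMSEQ]) auto
  moreover have "euler q \<noteq> 0" using assms by (intro euler_nonzero) auto
  ultimately show ?thesis by simp
qed

lemma eta_pos: "t > 0 \<Longrightarrow> eta t > 0"
  by (simp add: eta_def euler_pos)

lemma eta_mult: "eta (real n * t) = exp (- (pi * t / 12)) ^ n * euler (exp (- (2 * pi * t)) ^ n)"
  by (simp add: eta_def exp_of_nat_mult[symmetric] mult_ac)

lemma eta_numeral:
  "eta (numeral n * t) = exp (- (pi * t / 12)) ^ numeral n * euler (exp (- (2 * pi * t)) ^ numeral n)"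
  using eta_mult[of "numeral n"] by simp

lemma exp_eta_nome: "exp (- (pi * t / 12)) ^ 24 = exp (- (2 * pi * t))"
  by (simp add: exp_of_nat_mult[symmetric])

lemma eta_level_6:
  assumes t: "t > 0"
  defines "a \<equiv> eta t" and "b \<equiv> eta (2 * t)" and "c \<equiv> eta (3 * t)" and "d \<equiv> eta (6 * t)"
  shows "b ^ 8 * c ^ 4 * d = a * b ^ 3 * c ^ 9 + a ^ 4 * d ^ 9"
    and "a ^ 8 * c * d ^ 4 = b ^ 4 * c ^ 9 - 8 * (a ^ 3 * b * d ^ 9)"
proof -
  define q where "q = exp (- (2 * pi * t))"
  define u where "u = exp (- (pi * t / 12))"
  have q: "0 < q" "q < 1" using t by (auto simp: q_def)
  have uq: "u ^ 24 = q" unfolding u_def q_def by (rule exp_eta_nome)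
  have e: "a = u * euler q" "b = u ^ 2 * euler (q ^ 2)" "c = u ^ 3 * euler (q ^ 3)" "d = u ^ 6 * euler (q ^ 6)"
    unfolding a_def b_def c_def d_def eta_numeral u_def q_def by (simp_all add: eta_def)
  show "b ^ 8 * c ^ 4 * d = a * b ^ 3 * c ^ 9 + a ^ 4 * d ^ 9"
    using level_6(1)[OF q] uq unfolding e by algebra
  show "a ^ 8 * c * d ^ 4 = b ^ 4 * c ^ 9 - 8 * (a ^ 3 * b * d ^ 9)"
    using level_6(2)[OF q] uq unfolding e by algebra
qed

text \<open>The level 6 relations say that not only \<open>h\<close> but also \<open>h + 1\<close>
  and \<open>h - 8\<close> are eta quotients. This gives X Y = h + 1, Y (h - 8) = X h and Y V = h,
  from which \<open>h\<close> is eliminated. The second conclusion is the modular equation of degree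
  3: Y depends on the ratio of a/b and c/d, and V on their product.\<close>

lemma eta_degree_3:
  assumes t: "t > 0"
  defines "a \<equiv> eta t" and "b \<equiv> eta (2 * t)" and "c \<equiv> eta (3 * t)" and "d \<equiv> eta (6 * t)"
  defines "X \<equiv> (a * b / (c * d)) ^ 2" and "Y \<equiv> (b * c / (a * d)) ^ 6" and "V \<equiv> (a * c / (b * d)) ^ 3"
  shows "X + 9 / X = Y + 1 / Y" and "Y - 1 / Y = V + 8 / V"
proof -
  have pos: "a > 0" "b > 0" "c > 0" "d > 0" using t by (auto simp: a_def b_def c_def d_def eta_pos)
  define h where "h = b ^ 3 * c ^ 9 / (a ^ 3 * d ^ 9)"
  have h1: "h + 1 = b ^ 8 * c ^ 4 / (a ^ 4 * d ^ 8)"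
  proof -
    have "(h + 1) * (a ^ 4 * d ^ 9) = a * b ^ 3 * c ^ 9 + a ^ 4 * d ^ 9"
      using pos by (simp add: h_def field_simps) algebra
    also have "\<dots> = b ^ 8 * c ^ 4 * d"
      using eta_level_6(1)[OF t] unfolding a_def b_def c_def d_def by simp
    finally have "d * ((h + 1) * (a ^ 4 * d ^ 8)) = d * (b ^ 8 * c ^ 4)" by algebra
    then have "(h + 1) * (a ^ 4 * d ^ 8) = b ^ 8 * c ^ 4" using pos by simp
    then show ?thesis using pos by (simp add: eq_divide_eq)
  qed
  have h8: "h - 8 = a ^ 5 * c / (b * d ^ 5)"
  proof -
    have "(h - 8) * (a ^ 3 * b * d ^ 9) = b ^ 4 * c ^ 9 - 8 * (a ^ 3 * b * d ^ 9)"
      using pos by (simp add: h_def field_simps) algebra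
    also have "\<dots> = a ^ 8 * c * d ^ 4"
      using eta_level_6(2)[OF t] unfolding a_def b_def c_def d_def by simp
    finally have "(a ^ 3 * d ^ 4) * ((h - 8) * (b * d ^ 5)) = (a ^ 3 * d ^ 4) * (a ^ 5 * c)" by algebra
    then have "(h - 8) * (b * d ^ 5) = a ^ 5 * c" using pos by simp
    then show ?thesis using pos by (simp add: eq_divide_eq)
  qed
  have XY: "X * Y = h + 1" unfolding X_def Y_def h1 using pos by (simp add: power_divide power_mult_distrib power_mult[symmetric] frac_eq_eq) algebra
  have YX: "Y * (h - 8) = X * h" unfolding X_def Y_def h8 unfolding h_def using pos by (simp add: power_divide power_mult_distrib power_mult[symmetric] frac_eq_eq) algebra
  have YV: "Y * V = h" unfolding V_def Y_def h_def using pos by (simp add: power_divide power_mult_distrib power_mult[symmetric] frac_eq_eq) algebra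
  have nz: "X > 0" "Y > 0" "V > 0" using pos by (auto simp: X_def Y_def V_def)
  have "h > 0" "h - 8 > 0" using pos unfolding h8 by (auto simp: h_def)
  have "h * (X\<^sup>2 * Y + 9 * Y - Y\<^sup>2 * X - X) = 0" using XY YX by algebra
  then have "X\<^sup>2 * Y + 9 * Y - Y\<^sup>2 * X - X = 0" using \<open>h > 0\<close> by (metis mult_eq_0_iff less_irrefl)
  then show "X + 9 / X = Y + 1 / Y" using nz \<open>h > 0\<close> by (simp add: field_simps power2_eq_square)
  have "X * (Y\<^sup>2 * V - V - V\<^sup>2 * Y - 8 * Y) = 0" using XY YX YV by algebra
  then have "Y\<^sup>2 * V - V - V\<^sup>2 * Y - 8 * Y = 0" using nz by (metis mult_eq_0_iff less_irrefl)
  then show "Y - 1 / Y = V + 8 / V" using nz by (simp add: field_simps power2_eq_square)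
qed

text \<open>\<open>x\<close>, \<open>f\<close>, \<open>h\<close> play the roles of Weber's f_1, f,
  f_2 at one point, and the primed letters at 7 times that point. From u = P + v and P u v = 2, the
  power sums of \<open>u\<close> and \<open>v\<close> are, up to powers of \<open>P\<close>,
  polynomials in \<open>p\<close>; Jacobi's relation then converts the eighth powers into a
  statement about \<open>x\<close> and \<open>x'\<close> alone.\<close>

lemma weber_degree_7_algebra:
  fixes x x' f f' h h' :: real
  assumes pos: "x > 0" "x' > 0"
    and w: "x * f * h = sqrt 2" "x' * f' * h' = sqrt 2"
    and jac: "f ^ 8 = x ^ 8 + h ^ 8" "f' ^ 8 = x' ^ 8 + h' ^ 8"
    and deg: "f * f' = x * x' + h * h'"
  shows "(x / x') ^ 4 + (x' / x) ^ 4 = (x * x') ^ 3 + 8 / (x * x') ^ 3 + 7"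
proof -
  define A where "A = x ^ 8" define A' where "A' = x' ^ 8"
  define H where "H = h ^ 8" define H' where "H' = h' ^ 8"
  define P where "P = x * x'"
  define p where "p = P ^ 3"
  define u where "u = f * f'" define v where "v = h * h'"
  have p: "p > 0" using pos by (simp add: p_def P_def)
  have "(x * f * h) ^ 8 = 16" "(x' * f' * h') ^ 8 = 16"
    unfolding w using power_mult[of "sqrt 2" 2 4] by simp_all
  then have AH: "A * (A + H) * H = 16" "A' * (A' + H') * H' = 16"
    unfolding A_def H_def A'_def H'_def jac[symmetric] by (simp_all add: power_mult_distrib)
  have uv: "P * (u * v) = 2"
  proof -
    have "P * (u * v) = (x * f * h) * (x' * f' * h')" by (simp add: P_def u_def v_def mult_ac)
    then show ?thesis unfolding w by simp
  qed
  have uP: "u = P + v" using deg by (simp add: u_def v_def P_def)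
  have s2: "P * (u\<^sup>2 + v\<^sup>2) = p + 4"   proof -
    have "P * (u\<^sup>2 + v\<^sup>2) = P ^ 3 + 2 * (P * (u * v))"
      unfolding uP by (simp add: power2_eq_square power3_eq_cube algebra_simps)
    then show ?thesis unfolding uv p_def by simp
  qed
  have s4: "P\<^sup>2 * (u ^ 4 + v ^ 4) = (p + 4)\<^sup>2 - 8" using s2 uv by algebra
  have s8: "P ^ 4 * (u ^ 8 + v ^ 8) = ((p + 4)\<^sup>2 - 8)\<^sup>2 - 32" using s4 uv by algebra
  \<comment> \<open>This combination factors as (A + 2 H)(A' + 2 H'), and A (A + 2 H)^2 = A^3 + 64
    no longer involves \<open>H\<close>. So the square of P^4 W reveals the sum of the cubes of
    \<open>A\<close> and \<open>A'\<close>.\<close>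
  define W where "W = 2 * (u ^ 8 + v ^ 8) - P ^ 8"
  have AA: "A * A' = P ^ 8" by (simp add: A_def A'_def P_def power_mult_distrib)
  have W: "W = (A + 2 * H) * (A' + 2 * H')"
  proof -
    have "u ^ 8 = (A + H) * (A' + H')" "v ^ 8 = H * H'"
      by (simp_all add: u_def v_def A_def A'_def H_def H'_def jac power_mult_distrib)
    then show ?thesis unfolding W_def AA[symmetric] by algebra
  qed
  have "(P ^ 4 * W)\<^sup>2 = A ^ 3 * A' ^ 3 + 64 * (A ^ 3 + A' ^ 3) + 4096"
  proof -
    have "(P ^ 4 * W)\<^sup>2 = (A * (A + 2 * H)\<^sup>2) * (A' * (A' + 2 * H')\<^sup>2)" using W AA by algebra
    also have "A * (A + 2 * H)\<^sup>2 = A ^ 3 + 4 * (A * (A + H) * H)"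
      by (simp add: power2_eq_square power3_eq_cube algebra_simps)
    also note AH(1)
    also have "A' * (A' + 2 * H')\<^sup>2 = A' ^ 3 + 4 * (A' * (A' + H') * H')"
      by (simp add: power2_eq_square power3_eq_cube algebra_simps)
    also note AH(2)
    finally show ?thesis by algebra
  qed
  also have "P ^ 4 * W = p ^ 4 + 32 * p ^ 3 + 160 * p ^ 2 + 256 * p + 64"
    using s8 unfolding W_def p_def by algebra
  also have "A ^ 3 * A' ^ 3 = p ^ 8" using AA unfolding p_def by algebra
  finally have sum: "64 * (A ^ 3 + A' ^ 3) = (p ^ 4 + 32 * p ^ 3 + 160 * p ^ 2 + 256 * p + 64)\<^sup>2 - p ^ 8 - 4096"
    by simp
  \<comment> \<open>The sum of cubes only gives S^3 + 1/S^3, that is X^3 - 3 X. It turns out to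
    equal Z^3 - 3 Z for the claimed value \<open>Z\<close>, and this cubic is injective on the reals
    from 2 upwards.\<close>
  define S where "S = (x / x') ^ 4"
  define X where "X = S + 1 / S"
  define Z where "Z = p + 8 / p + 7"
  have S: "S > 0" using pos by (simp add: S_def)
  have X2: "X \<ge> 2"
  proof -
    have "X - 2 = (S - 1)\<^sup>2 / S" using S by (simp add: X_def field_simps power2_eq_square)
    then have "X - 2 \<ge> 0" using S by simp
    then show ?thesis by simp
  qed
  have AS: "S ^ 3 + 1 / S ^ 3 = (A ^ 3 + A' ^ 3) / p ^ 4"
    unfolding S_def A_def A'_def p_def P_def using pos by (simp add: field_simps power_numeral_reduce)
  have "X ^ 3 - 3 * X = S ^ 3 + 1 / S ^ 3"
    unfolding X_def using S by (simp add: field_simps) algebra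
  also have "\<dots> = Z ^ 3 - 3 * Z"
  proof -
    have "64 * p ^ 4 * (Z ^ 3 - 3 * Z) = (p ^ 4 + 32 * p ^ 3 + 160 * p ^ 2 + 256 * p + 64)\<^sup>2 - p ^ 8 - 4096"
      unfolding Z_def using p by (simp add: field_simps) algebra
    then have "64 * (A ^ 3 + A' ^ 3) = 64 * p ^ 4 * (Z ^ 3 - 3 * Z)" using sum by simp
    then show ?thesis unfolding AS using p by (simp add: field_simps)
  qed
  finally have "(X - Z) * (X\<^sup>2 + X * Z + Z\<^sup>2 - 3) = 0" by algebra
  moreover have "X\<^sup>2 + X * Z + Z\<^sup>2 - 3 > 0"
  proof -
    have "Z \<ge> 2" using p by (simp add: Z_def add_increasing)
    then have "X * Z \<ge> 2 * 2" using X2 by (intro mult_mono) auto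
    then show ?thesis using zero_le_power2[of X] zero_le_power2[of Z] by linarith
  qed
  ultimately have "X = Z" by simp
  moreover have "X = (x / x') ^ 4 + (x' / x) ^ 4"
    using pos by (simp add: X_def S_def power_divide)
  ultimately show ?thesis by (simp add: Z_def p_def P_def)
qed

theorem eta_degree_7:
  assumes t: "t > 0"
  defines "x \<equiv> eta t / eta (2 * t)" and "x' \<equiv> eta (7 * t) / eta (14 * t)"
  shows "(x / x') ^ 4 + (x' / x) ^ 4 = (x * x') ^ 3 + 8 / (x * x') ^ 3 + 7"
proof -
  define q where "q = exp (- (2 * pi * t))"
  define u where "u = exp (- (pi * t / 12))"
  have q: "0 < q" "q < 1" using t by (auto simp: q_def)
  have u: "u > 0" by (simp add: u_def)
  have uq: "u ^ 24 = q" unfolding u_def q_def by (rule exp_eta_nome)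
  have n: "norm q < 1" "q \<noteq> 0" and n7: "norm (q ^ 7) < 1" "q ^ 7 \<noteq> 0"
    using q by (auto simp: power_less_one_iff)
  define e1 where "e1 = euler q" define e2 where "e2 = euler (q\<^sup>2)" define e4 where "e4 = euler (q ^ 4)"
  define g1 where "g1 = euler (q ^ 7)" define g2 where "g2 = euler (q ^ 14)" define g4 where "g4 = euler (q ^ 28)"
  note edefs = e1_def e2_def e4_def g1_def g2_def g4_def
  have pos: "e1 > 0" "e2 > 0" "e4 > 0" "g1 > 0" "g2 > 0" "g4 > 0"
    unfolding edefs using q by (auto intro!: euler_pos simp: power_less_one_iff)
  have x: "x = e1 / (u * e2)" "x' = g1 / (u ^ 7 * g2)"
    unfolding x_def x'_def eta_numeral edefs u_def q_def
    by (simp_all add: eta_def field_simps power_numeral_reduce)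
  have pq: "(q ^ 7)\<^sup>2 = q ^ 14" "(q ^ 7) ^ 4 = q ^ 28" by algebra+
  have j1: "e2 ^ 24 = e1 ^ 16 * e4 ^ 8 + 16 * u ^ 24 * (e1 ^ 8 * e4 ^ 16)"
    unfolding uq edefs by (rule jacobi_quartic[OF n])
  have j2: "g2 ^ 24 = g1 ^ 16 * g4 ^ 8 + 16 * (u ^ 24) ^ 7 * (g1 ^ 8 * g4 ^ 16)"
    unfolding uq edefs using jacobi_quartic[OF n7] unfolding pq .
  have em: "euler (- q) = e2 ^ 3 / (e1 * e4)" "euler (- (q ^ 7)) = g2 ^ 3 / (g1 * g4)"
    using euler_minus[OF n(1)] euler_minus[OF n7(1)] pos unfolding pq edefs[symmetric]
    by (simp_all add: field_simps)
  have d7: "e2 ^ 3 * g2 ^ 3 = e1 * e4 * g1 * g4 * (e1 * g1 + 2 * u ^ 24 * e4 * g4)"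
  proof -
    have "e2 ^ 3 / (e1 * e4) * (g2 ^ 3 / (g1 * g4)) - e1 * g1 = 2 * u ^ 24 * e4 * g4"
      using degree_7[OF n] unfolding em uq edefs .
    then show ?thesis using pos by (simp add: field_simps)
  qed
  \<comment> \<open>With \<open>x\<close>, these are Weber's f, f_2 and f_1 at the point 2it, where
    \<open>u\<close> is the 24th root of \<open>q\<close>. Dividing the series identity by u^8 e2 g2
    turns it into f f' = x x' + h h'.\<close>
  define f where "f = e2\<^sup>2 / (u * e1 * e4)" define h where "h = sqrt 2 * u\<^sup>2 * e4 / e2"
  define f' where "f' = g2\<^sup>2 / (u ^ 7 * g1 * g4)" define h' where "h' = sqrt 2 * u ^ 14 * g4 / g2"
  have r8: "sqrt 2 ^ 8 = 16" using power_mult[of "sqrt 2" 2 4] by simp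
  show ?thesis
  proof (rule weber_degree_7_algebra)
    show "x > 0" "x' > 0" using pos u by (simp_all add: x)
    show "x * f * h = sqrt 2" "x' * f' * h' = sqrt 2"
      unfolding x f_def h_def f'_def h'_def using pos u by (simp_all add: field_simps power_numeral_reduce)
    have "h ^ 8 = 16 * u ^ 16 * e4 ^ 8 / e2 ^ 8"
      unfolding h_def by (simp add: power_mult_distrib power_divide r8 power_mult[symmetric])
    then show "f ^ 8 = x ^ 8 + h ^ 8"
      unfolding x f_def using pos u j1
      by (simp add: power_mult_distrib power_divide power_mult[symmetric]) (simp add: field_simps power_numeral_reduce)
    have "h' ^ 8 = 16 * u ^ 112 * g4 ^ 8 / g2 ^ 8"
      unfolding h'_def by (simp add: power_mult_distrib power_divide r8 power_mult[symmetric])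
    then show "f' ^ 8 = x' ^ 8 + h' ^ 8"
      unfolding x f'_def using pos u j2
      by (simp add: power_mult_distrib power_divide power_mult[symmetric]) (simp add: field_simps power_numeral_reduce)
    have "h * h' = 2 * u ^ 16 * e4 * g4 / (e2 * g2)"
    proof -
      have "h * h' = (sqrt 2 * sqrt 2) * (u\<^sup>2 * u ^ 14) * e4 * g4 / (e2 * g2)"
        unfolding h_def h'_def by (simp add: mult_ac del: real_sqrt_mult_self)
      then show ?thesis by (simp add: power_add[symmetric])
    qed
    then show "f * f' = x * x' + h * h'"
      unfolding x f_def f'_def using pos u d7
      by (simp add: field_simps) algebra
  qed
qed

section \<open>Poisson summation for Gaussians\<close>

text \<open>The Weierstrass test along finite index sets gives uniform convergence, hence both a
  continuous sum and termwise integration as an unconditional sum.\<close>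

lemma integral_infsum:
  fixes f :: "int \<Rightarrow> real \<Rightarrow> real"
  assumes cont: "\<And>n. continuous_on {a..b} (f n)"
    and bound: "\<And>n x. x \<in> {a..b} \<Longrightarrow> \<bar>f n x\<bar> \<le> M n" and M: "M summable_on UNIV"
  shows "continuous_on {a..b} (\<lambda>x. \<Sum>\<^sub>\<infinity>n. f n x)"
    and "((\<lambda>n. integral {a..b} (f n)) has_sum integral {a..b} (\<lambda>x. \<Sum>\<^sub>\<infinity>n. f n x)) UNIV"
proof -
  have u: "uniform_limit {a..b} (\<lambda>X x. \<Sum>n\<in>X. f n x) (\<lambda>x. \<Sum>\<^sub>\<infinity>n. f n x) (finite_subsets_at_top UNIV)"
    by (rule Weierstrass_m_test_general[OF _ M]) (use bound in auto)
  have c: "continuous_on {a..b} (\<lambda>x. \<Sum>n\<in>X. f n x)" for X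
    by (intro continuous_on_sum cont)
  show "continuous_on {a..b} (\<lambda>x. \<Sum>\<^sub>\<infinity>n. f n x)"
    by (rule uniform_limit_theorem[OF always_eventually u]) (use c in auto)
  obtain I J where IJ: "\<And>X. ((\<lambda>x. \<Sum>n\<in>X. f n x) has_integral I X) {a..b}"
    "((\<lambda>x. \<Sum>\<^sub>\<infinity>n. f n x) has_integral J) {a..b}" "(I \<longlongrightarrow> J) (finite_subsets_at_top UNIV)"
    using uniform_limit_integral[OF u c] by auto
  have "I X = (\<Sum>n\<in>X. integral {a..b} (f n))" if "finite X" for X
  proof -
    have "((\<lambda>x. \<Sum>n\<in>X. f n x) has_integral (\<Sum>n\<in>X. integral {a..b} (f n))) {a..b}"
      using that by (intro has_integral_sum integrable_integral integrable_continuous_real cont)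
    with IJ(1) show ?thesis by (rule has_integral_unique)
  qed
  then have "((\<lambda>X. \<Sum>n\<in>X. integral {a..b} (f n)) \<longlongrightarrow> J) (finite_subsets_at_top UNIV)"
    using tendsto_cong[of I "\<lambda>X. \<Sum>n\<in>X. integral {a..b} (f n)"] IJ(3)
    by (auto simp: eventually_finite_subsets_at_top_weakI)
  then show "((\<lambda>n. integral {a..b} (f n)) has_sum integral {a..b} (\<lambda>x. \<Sum>\<^sub>\<infinity>n. f n x)) UNIV"
    using integral_unique[OF IJ(2)] by (simp add: has_sum_def)
qed

text \<open>By symmetry \<open>D\<close> is a continuous function \<open>h\<close> of cos(2 pi x).
  It is orthogonal to every polynomial in this cosine, and approximating \<open>h\<close> uniformly
  by polynomials makes the integral of D^2 arbitrarily small.\<close>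

lemma cosine_coefficients_zero:
  fixes D :: "real \<Rightarrow> real"
  assumes cont: "continuous_on {0..1} D" and sym: "\<And>x. x \<in> {0..1} \<Longrightarrow> D (1 - x) = D x"
    and zero: "\<And>k::nat. integral {0..1} (\<lambda>x. D x * cos (2 * pi * k * x)) = 0"
    and x: "x \<in> {0..1}"
  shows "D x = 0"
proof -
  let ?c = "\<lambda>x. cos (2 * pi * x)"
  have ci: "(\<lambda>x. D x * g x) integrable_on {0..1}" if "continuous_on {0..1} g" for g
    by (intro integrable_continuous_real continuous_on_mult cont that)
  \<comment> \<open>The frequency \<open>k\<close> is carried along for the induction: a product of
    cosines trades one power for a shift of the frequency by 1, and at frequency 0 one power is
    itself the cosine of frequency 1.\<close>
  have pow: "integral {0..1} (\<lambda>x. D x * (?c x ^ m * cos (2 * pi * real k * x))) = 0" for m k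
  proof (induction m arbitrary: k)
    case 0
    then show ?case using zero[of k] by simp
  next
    case (Suc m)
    show ?case
    proof (cases k)
      case 0
      then show ?thesis using Suc[of 1] by (simp add: mult_ac)
    next
      case (Suc j)
      have e: "D x * (?c x ^ Suc m * cos (2 * pi * real k * x)) =
        1 / 2 * (D x * (?c x ^ m * cos (2 * pi * real (k + 1) * x))) +
        1 / 2 * (D x * (?c x ^ m * cos (2 * pi * real j * x)))" for x
      proof -
        have "?c x * cos (2 * pi * real k * x) = (cos (2 * pi * real (k + 1) * x) + cos (2 * pi * real j * x)) / 2"
        proof -
          have "2 * pi * x - 2 * pi * real k * x = - (2 * pi * real j * x)"
            "2 * pi * x + 2 * pi * real k * x = 2 * pi * real (k + 1) * x"
            unfolding Suc by (simp_all add: algebra_simps)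
          then show ?thesis unfolding cos_times_cos by simp
        qed
        then have "D x * ?c x ^ m * (?c x * cos (2 * pi * real k * x)) =
          D x * ?c x ^ m * ((cos (2 * pi * real (k + 1) * x) + cos (2 * pi * real j * x)) / 2)" by simp
        then show ?thesis by (simp add: algebra_simps)
      qed
      have i: "(\<lambda>x. D x * (?c x ^ m * cos (2 * pi * real l * x))) integrable_on {0..1}" for l
        by (intro ci continuous_intros)
      have "integral {0..1} (\<lambda>x. D x * (?c x ^ Suc m * cos (2 * pi * real k * x))) =
        integral {0..1} (\<lambda>x. 1 / 2 * (D x * (?c x ^ m * cos (2 * pi * real (k + 1) * x)))) +
        integral {0..1} (\<lambda>x. 1 / 2 * (D x * (?c x ^ m * cos (2 * pi * real j * x))))"
        unfolding e by (intro integral_add integrable_on_mult_right i)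
      then show ?thesis unfolding integral_mult_right Suc.IH by simp
    qed
  qed
  define h where "h y = D (arccos y / (2 * pi))" for y
  have conth: "continuous_on {- 1..1} h"
  proof -
    have "continuous_on {- 1..1} (\<lambda>y. arccos y / (2 * pi))"
      by (intro continuous_intros) auto
    moreover have "(\<lambda>y. arccos y / (2 * pi)) ` {- 1..1} \<subseteq> {0..1}"
      using arccos_lbound arccos_ubound by (fastforce simp: field_simps)
    ultimately show ?thesis
      unfolding h_def by (intro continuous_on_compose2[OF cont])
  qed
  have h1: "D x = h (?c x)" if "x \<in> {0..1/2}" for x
    using that by (simp add: h_def arccos_cos)
  have h: "D x = h (?c x)" if "x \<in> {0..1}" for x
  proof (cases "x \<le> 1 / 2")
    case True
    then show ?thesis using that h1 by simp
  next
    case False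
    have "cos (2 * pi * (1 - x)) = ?c x"
      by (simp add: right_diff_distrib cos_diff)
    then show ?thesis using that h1[of "1 - x"] sym[OF that] False by simp
  qed
  obtain B where B: "\<And>x. x \<in> {0..1} \<Longrightarrow> \<bar>D x\<bar> \<le> B" and "B \<ge> 0"
  proof -
    have "bounded (D ` {0..1})"
      by (intro compact_imp_bounded compact_continuous_image cont) simp
    then obtain B where "\<forall>y\<in>D ` {0..1}. norm y \<le> B" unfolding bounded_iff ..
    then have "\<bar>D x\<bar> \<le> B" if "x \<in> {0..1}" for x using that by auto
    then have "\<bar>D x\<bar> \<le> max B 0" if "x \<in> {0..1}" for x using that by (simp add: le_max_iff_disj)
    then show ?thesis using that by (metis max.cobounded2)
  qed
  have small: "integral {0..1} (\<lambda>x. D x * D x) \<le> B * e" if e: "e > 0" for e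
  proof -
    obtain p where p: "real_polynomial_function p" "\<And>y. y \<in> {- 1..1} \<Longrightarrow> \<bar>h y - p y\<bar> < e"
      using Stone_Weierstrass_real_polynomial_function[OF _ conth e] by auto
    then obtain a n where pa: "p = (\<lambda>y. \<Sum>i\<le>n. a i * y ^ i)"
      unfolding real_polynomial_function_iff_sum by auto
    have contp: "continuous_on {0..1} (\<lambda>x. p (?c x))" unfolding pa by (intro continuous_intros)
    have "integral {0..1} (\<lambda>x. D x * p (?c x)) = integral {0..1} (\<lambda>x. \<Sum>i\<le>n. a i * (D x * (?c x ^ i * cos (2 * pi * real 0 * x))))"
      unfolding pa sum_distrib_left by (simp add: mult_ac)
    also have "\<dots> = (\<Sum>i\<le>n. integral {0..1} (\<lambda>x. a i * (D x * (?c x ^ i * cos (2 * pi * real 0 * x)))))"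
      by (intro integral_sum integrable_on_mult_right ci continuous_intros) simp
    also have "\<dots> = 0" unfolding integral_mult_right pow by simp
    finally have 0: "integral {0..1} (\<lambda>x. D x * p (?c x)) = 0" .
    have "integral {0..1} (\<lambda>x. D x * D x) = integral {0..1} (\<lambda>x. D x * D x) - integral {0..1} (\<lambda>x. D x * p (?c x))"
      unfolding 0 by simp
    also have "\<dots> = integral {0..1} (\<lambda>x. D x * D x - D x * p (?c x))"
      by (rule integral_diff[symmetric]) (intro ci cont contp)+
    also have "\<dots> \<le> integral {0..1} (\<lambda>x::real. B * e)"
    proof (rule integral_le)
      show "(\<lambda>x. D x * D x - D x * p (?c x)) integrable_on {0..1}"
        by (intro integrable_diff ci cont contp)
      fix x :: real assume x: "x \<in> {0..1}"
      have "D x * D x - D x * p (?c x) = D x * (h (?c x) - p (?c x))"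
        using h[OF x] by (simp add: algebra_simps)
      also have "\<dots> \<le> \<bar>D x\<bar> * \<bar>h (?c x) - p (?c x)\<bar>" by (metis abs_ge_self abs_mult)
      also have "\<dots> \<le> B * e"
        using B[OF x] p(2)[of "?c x"] \<open>B \<ge> 0\<close> by (intro mult_mono) (auto intro: less_imp_le)
      finally show "D x * D x - D x * p (?c x) \<le> B * e" .
    qed auto
    finally show ?thesis by simp
  qed
  have "integral {0..1} (\<lambda>x. D x * D x) \<le> 0"
  proof (rule field_le_epsilon)
    fix e :: real assume "e > 0"
    have "integral {0..1} (\<lambda>x. D x * D x) \<le> B * (e / (B + 1))"
      using \<open>e > 0\<close> \<open>B \<ge> 0\<close> by (intro small) simp
    also have "\<dots> \<le> e" using \<open>e > 0\<close> \<open>B \<ge> 0\<close> by (simp add: field_simps)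
    finally show "integral {0..1} (\<lambda>x. D x * D x) \<le> 0 + e" by simp
  qed
  moreover have "integral {0..1} (\<lambda>x. D x * D x) \<ge> 0"
    by (intro integral_nonneg ci cont) simp
  ultimately have "integral {0..1} (\<lambda>x. D x * D x) = 0" by simp
  then have "\<forall>x\<in>{0..1}. D x * D x = 0"
    by (subst (asm) integral_eq_0_iff) (auto intro!: continuous_intros cont)
  then show ?thesis using x by simp
qed

text \<open>The real part of the characteristic function of the standard normal distribution,
  rescaled by \<open>c\<close> so that x^2 / 2 becomes pi s x^2.\<close>

lemma gaussian_cos_integral:
  fixes s a :: real
  assumes s: "s > 0"
  shows "integrable lborel (\<lambda>x. exp (- (pi * s * x\<^sup>2)) * cos (a * x))"
    and "(\<integral>x. exp (- (pi * s * x\<^sup>2)) * cos (a * x) \<partial>lborel) = exp (- (a\<^sup>2 / (4 * pi * s))) / sqrt s"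
proof -
  define c where "c = sqrt (2 * pi * s)"
  have c: "c > 0" "c\<^sup>2 = 2 * pi * s" using s by (auto simp: c_def)
  let ?g = "\<lambda>x. std_normal_density x * cos (a / c * x)"
  have int: "integrable lborel (\<lambda>x. std_normal_density x *\<^sub>R iexp (a / c * x))"
    by (rule Bochner_Integration.integrable_bound[of lborel std_normal_density])
       (auto simp: integrable_normal_moment[where k = 0, simplified])
  have "(\<integral>x. std_normal_density x *\<^sub>R iexp (a / c * x) \<partial>lborel) = char std_normal_distribution (a / c)"
    unfolding char_def by (subst integral_density) auto
  also have "\<dots> = exp (- ((a / c)\<^sup>2) / 2)" by (simp add: char_std_normal_distribution)
  finally have "Re (\<integral>x. std_normal_density x *\<^sub>R iexp (a / c * x) \<partial>lborel) = exp (- ((a / c)\<^sup>2) / 2)"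
    by (simp only: Re_complex_of_real)
  then have val: "(\<integral>x. ?g x \<partial>lborel) = exp (- ((a / c)\<^sup>2) / 2)"
    using integral_Re[OF int] by (simp add: Re_exp)
  have intg: "integrable lborel ?g"
    using integrable_Re[OF int] by (simp add: Re_exp)
  have eq: "?g (0 + c * x) = 1 / sqrt (2 * pi) * (exp (- (pi * s * x\<^sup>2)) * cos (a * x))" for x
    using c by (simp add: std_normal_density_def power_mult_distrib)
  have "integrable lborel (\<lambda>x. ?g (0 + c * x))"
    by (rule lborel_integrable_real_affine[OF intg]) (use c in simp)
  then have "integrable lborel (\<lambda>x. sqrt (2 * pi) * ?g (0 + c * x))" by (rule integrable_mult_right)
  then show "integrable lborel (\<lambda>x. exp (- (pi * s * x\<^sup>2)) * cos (a * x))"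
    unfolding eq by simp
  have "(\<integral>x. ?g x \<partial>lborel) = \<bar>c\<bar> *\<^sub>R (\<integral>x. ?g (0 + c * x) \<partial>lborel)"
    by (rule lborel_integral_real_affine) (use c in simp)
  also have "\<dots> = sqrt s * (\<integral>x. exp (- (pi * s * x\<^sup>2)) * cos (a * x) \<partial>lborel)"
    unfolding eq using s by (simp add: c_def real_sqrt_mult)
  finally have "(\<integral>x. exp (- (pi * s * x\<^sup>2)) * cos (a * x) \<partial>lborel) = exp (- ((a / c)\<^sup>2) / 2) / sqrt s"
    unfolding val using s by (simp add: field_simps)
  then show "(\<integral>x. exp (- (pi * s * x\<^sup>2)) * cos (a * x) \<partial>lborel) = exp (- (a\<^sup>2 / (4 * pi * s))) / sqrt s"
    using c by (simp add: power_divide field_simps)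
qed

text \<open>An unconditional sum that exists may be computed along the ranges from -N to N - 1, and
  the resulting integrals over [-N, N] tend to the Lebesgue integral by dominated
  convergence.\<close>

lemma integral_eq_sum_unit_intervals:
  fixes h :: "real \<Rightarrow> real"
  assumes cont: "continuous_on UNIV h" and int: "integrable lborel h"
    and sum: "((\<lambda>n::int. integral {0..1} (\<lambda>x. h (x + n))) has_sum S) UNIV"
  shows "S = (\<integral>x. h x \<partial>lborel)"
proof -
  have shift: "integral {0..1} (\<lambda>x. h (x + of_int n)) = integral {of_int n..of_int n + 1} h" for n :: int
    using integral_shift_Icc_real[of 0 1 h "of_int n"] by (simp add: o_def add.commute)
  have hi: "h integrable_on {a..b}" for a b
    by (intro integrable_continuous_real continuous_on_subset[OF cont]) auto
  have part: "(\<Sum>n\<in>{- int N..<int N}. integral {of_int n..of_int n + 1} h) = integral {- real N..real N} h" for N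
  proof (induction N)
    case (Suc N)
    have "{- int (Suc N)..<int (Suc N)} = insert (- int (Suc N)) (insert (int N) {- int N..<int N})" by auto
    then have "(\<Sum>n\<in>{- int (Suc N)..<int (Suc N)}. integral {of_int n..of_int n + 1} h) =
       integral {- real (Suc N)..- real N} h + (integral {- real N..real N} h + integral {real N..real (Suc N)} h)"
      using Suc by (simp add: add_ac)
    also have "integral {- real N..real N} h + integral {real N..real (Suc N)} h = integral {- real N..real (Suc N)} h"
      by (rule Henstock_Kurzweil_Integration.integral_combine) (auto intro: hi)
    also have "integral {- real (Suc N)..- real N} h + integral {- real N..real (Suc N)} h = integral {- real (Suc N)..real (Suc N)} h"
      by (rule Henstock_Kurzweil_Integration.integral_combine) (auto intro: hi)
    finally show ?case .
  qed simp
  have "filterlim (\<lambda>N. {- int N..<int N}) (finite_subsets_at_top UNIV) sequentially"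
    unfolding filterlim_finite_subsets_at_top
  proof (intro allI impI, elim conjE)
    fix X :: "int set" assume "finite X"
    define N where "N = Max (insert 0 ((\<lambda>x. nat \<bar>x\<bar>) ` X)) + 1"
    have N: "nat \<bar>x\<bar> < N" if "x \<in> X" for x
      unfolding N_def using that \<open>finite X\<close> by (simp add: less_Suc_eq_le)
    have "X \<subseteq> {- int n..<int n}" if "n \<ge> N" for n
    proof
      fix x assume "x \<in> X"
      then have "nat \<bar>x\<bar> < n" using N that by (meson less_le_trans)
      then show "x \<in> {- int n..<int n}" by auto
    qed
    then show "\<forall>\<^sub>F N in sequentially. finite {- int N..<int N} \<and> X \<subseteq> {- int N..<int N} \<and> {- int N..<int N} \<subseteq> UNIV"
      unfolding eventually_sequentially by auto
  qed
  from filterlim_compose[OF sum[unfolded has_sum_def] this]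
  have "(\<lambda>N. integral {- real N..real N} h) \<longlonglongrightarrow> S"
    unfolding shift part by simp
  moreover have "(\<lambda>N. integral {- real N..real N} h) \<longlonglongrightarrow> (\<integral>x. h x \<partial>lborel)"
  proof -
    have "integral {- real N..real N} h = (\<integral>x. indicator {- real N..real N} x *\<^sub>R h x \<partial>lborel)" for N
    proof -
      have "set_integrable lborel {- real N..real N} h"
        unfolding set_integrable_def by (intro integrable_mult_indicator int) simp
      from set_borel_integral_eq_integral(2)[OF this] show ?thesis
        by (simp add: set_lebesgue_integral_def)
    qed
    moreover have "(\<lambda>N. \<integral>x. indicator {- real N..real N} x *\<^sub>R h x \<partial>lborel) \<longlonglongrightarrow> (\<integral>x. h x \<partial>lborel)"
    proof (rule integral_dominated_convergence[where w = "\<lambda>x. norm (h x)"])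
      show "integrable lborel (\<lambda>x. norm (h x))" using int by simp
      show "AE x in lborel. (\<lambda>N. indicator {- real N..real N} x *\<^sub>R h x) \<longlonglongrightarrow> h x"
      proof (rule AE_I2)
        fix x :: real
        obtain N0 :: nat where "\<bar>x\<bar> \<le> real N0" using real_arch_simple by blast
        then have "\<forall>N\<ge>N0. indicator {- real N..real N} x *\<^sub>R h x = h x"
          by (auto simp: indicator_def)
        then have "\<forall>\<^sub>F N in sequentially. indicator {- real N..real N} x *\<^sub>R h x = h x"
          unfolding eventually_sequentially by blast
        then show "(\<lambda>N. indicator {- real N..real N} x *\<^sub>R h x) \<longlonglongrightarrow> h x"
          by (rule tendsto_eventually)
      qed
      show "AE x in lborel. norm (indicator {- real N..real N} x *\<^sub>R h x) \<le> norm (h x)" for N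
        by (auto simp: indicator_def)
    qed (use int in auto)
    ultimately show ?thesis by simp
  qed
  ultimately show ?thesis by (rule LIMSEQ_unique)
qed

lemma summable_exp_abs:
  assumes "c > (0::real)"
  shows "(\<lambda>n::int. exp (- (c * of_int \<bar>n\<bar>))) summable_on UNIV"
proof (rule summable_on_int)
  have "summable (\<lambda>n. exp (- c) ^ n)" using assms by (intro summable_geometric) simp
  then have "summable (\<lambda>n. exp (- (c * real n)))" by (simp add: exp_of_nat_mult[symmetric] mult_ac)
  then show "summable (\<lambda>n. exp (- (c * of_int \<bar>int n\<bar>)))" "summable (\<lambda>n. exp (- (c * of_int \<bar>- int n\<bar>)))"
    by simp_all
qed simp

lemma int_square_ge_abs: "\<bar>n\<bar> \<le> n * n" for n :: int
  by (metis abs_mult_self abs_ge_zero mult_right_mono mult_1 mult_zero_left order_refl zless_imp_add1_zle add_0 antisym_conv1)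

lemma cos_mult_integral:
  fixes n k :: int
  shows "integral {0..1} (\<lambda>x. cos (2 * pi * n * x) * cos (2 * pi * k * x)) =
    ((if n = k then 1 else 0) + (if n = - k then 1 else 0)) / 2"
proof -
  have c: "((\<lambda>x. cos (2 * pi * of_int m * x)) has_integral (if m = 0 then 1 else 0)) {0..1}" for m :: int
  proof (cases "m = 0")
    case True
    then show ?thesis using has_integral_const_real[of "1::real" 0 1] by simp
  next
    case False
    have "((\<lambda>x. cos (2 * pi * of_int m * x)) has_integral
        (sin (2 * pi * of_int m * 1) / (2 * pi * of_int m) - sin (2 * pi * of_int m * 0) / (2 * pi * of_int m))) {0..1}"
      using False by (intro fundamental_theorem_of_calculus)
        (auto intro!: derivative_eq_intros simp: has_real_derivative_iff_has_vector_derivative[symmetric])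
    moreover have "sin (2 * pi * of_int m * 1) = 0"
      using sin_integer_2pi[of "of_int m"] by (simp add: mult_ac)
    ultimately show ?thesis using False by simp
  qed
  have "((\<lambda>x. cos (2 * pi * n * x) * cos (2 * pi * k * x)) has_integral
     ((if n = k then 1 else 0) + (if n = - k then 1 else 0)) / 2) {0..1}"
  proof -
    have "cos (2 * pi * n * x) * cos (2 * pi * k * x) = (cos (2 * pi * of_int (n - k) * x) + cos (2 * pi * of_int (n + k) * x)) / 2" for x :: real
    proof -
      have "2 * pi * n * x - 2 * pi * k * x = 2 * pi * of_int (n - k) * x"
        "2 * pi * n * x + 2 * pi * k * x = 2 * pi * of_int (n + k) * x"
        by (simp_all add: algebra_simps)
      then show ?thesis unfolding cos_times_cos by (simp only:)
    qed
    then have "(\<lambda>x. cos (2 * pi * n * x) * cos (2 * pi * k * x)) =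
      (\<lambda>x. (cos (2 * pi * of_int (n - k) * x) + cos (2 * pi * of_int (n + k) * x)) / 2)" by (rule ext)
    moreover have "((\<lambda>x. (cos (2 * pi * of_int (n - k) * x) + cos (2 * pi * of_int (n + k) * x)) / 2) has_integral
      ((if n - k = 0 then 1 else 0) + (if n + k = 0 then 1 else 0)) / 2) {0..1}"
      by (intro has_integral_divide has_integral_add c)
    moreover have "n + k = 0 \<longleftrightarrow> n = - k" "n - k = 0 \<longleftrightarrow> n = k" by auto
    ultimately show ?thesis by (simp only:)
  qed
  then show ?thesis by (rule integral_unique)
qed

text \<open>Both sides are continuous on the unit interval and symmetric under x -> 1 - x, so
  comparing cosine coefficients suffices. On the left, unfolding gives a Gaussian integral over the
  whole line; on the right, orthogonality leaves only the indices k and -k.\<close>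

theorem poisson_gaussian:
  fixes s x :: real
  assumes s: "s > 0" and x: "x \<in> {0..1}"
  shows "(\<Sum>\<^sub>\<infinity>n::int. exp (- (pi * s * (x + n)\<^sup>2))) =
    (\<Sum>\<^sub>\<infinity>n::int. exp (- (pi * of_int (n * n) / s)) * cos (2 * pi * n * x)) / sqrt s"
proof -
  let ?g = "\<lambda>x. exp (- (pi * s * x\<^sup>2))"
  let ?w = "\<lambda>n::int. exp (- (pi * of_int (n * n) / s))"
  define F where "F x = (\<Sum>\<^sub>\<infinity>n::int. ?g (x + of_int n))" for x
  define G where "G x = (\<Sum>\<^sub>\<infinity>n::int. ?w n * cos (2 * pi * of_int n * x))" for x
  \<comment> \<open>On the unit interval (x + n)^2 is at least |n| - 1, which gives a majorant of
    geometric type independent of x.\<close>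
  define M where "M n = exp (pi * s) * exp (- (pi * s * of_int \<bar>n\<bar>))" for n :: int
  have M: "M summable_on UNIV"
    unfolding M_def using s by (intro summable_on_cmult_right summable_exp_abs) simp
  have gM: "?g (x + of_int n) \<le> M n" if "x \<in> {0..1}" for x :: real and n :: int
  proof -
    have "(x + of_int n)\<^sup>2 \<ge> of_int \<bar>n\<bar> - 1"
    proof (cases "n \<ge> 0")
      case True
      have "real_of_int \<bar>n\<bar> \<le> of_int (n * n)" by (simp only: of_int_le_iff int_square_ge_abs)
      also have "\<dots> \<le> (x + of_int n)\<^sup>2"
        using True that by (auto simp: power2_eq_square intro!: mult_mono)
      finally show ?thesis by simp
    next
      case False
      define m where "m = - n - 1"
      have m: "m \<ge> 0" "n = - (m + 1)" using False by (auto simp: m_def)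
      have "real_of_int \<bar>m\<bar> \<le> of_int (m * m)" by (simp only: of_int_le_iff int_square_ge_abs)
      also have "\<dots> \<le> (1 - x + of_int m)\<^sup>2"
        using m that by (auto simp: power2_eq_square intro!: mult_mono)
      also have "\<dots> = (x + of_int n)\<^sup>2" unfolding m by (simp add: power2_eq_square algebra_simps)
      finally show ?thesis using m by simp
    qed
    then have "pi * s * (of_int \<bar>n\<bar> - 1) \<le> pi * s * (x + of_int n)\<^sup>2"
      using s by (intro mult_left_mono) auto
    then show ?thesis unfolding M_def exp_add[symmetric] by (simp add: algebra_simps)
  qed
  have w: "?w summable_on UNIV"
  proof (rule summable_on_comparison_test[OF summable_exp_abs[of "pi / s"]])
    fix n :: int
    have "real_of_int \<bar>n\<bar> \<le> of_int (n * n)" by (simp only: of_int_le_iff int_square_ge_abs)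
    then have "pi / s * of_int \<bar>n\<bar> \<le> pi / s * of_int (n * n)" using s by (intro mult_left_mono) auto
    then show "?w n \<le> exp (- (pi / s * of_int \<bar>n\<bar>))" by simp
  qed (use s in auto)
  have contF: "continuous_on {0..1} F" unfolding F_def
    by (rule integral_infsum(1)[OF _ _ M]) (use gM in \<open>auto intro!: continuous_intros\<close>)
  have contG: "continuous_on {0..1} G" unfolding G_def
    by (rule integral_infsum(1)[OF _ _ w]) (auto intro!: continuous_intros simp: abs_mult)
  have coefF: "integral {0..1} (\<lambda>x. F x * cos (2 * pi * real k * x)) = exp (- (pi * (real k)\<^sup>2 / s)) / sqrt s" for k
  proof -
    let ?h = "\<lambda>x. ?g x * cos (2 * pi * real k * x)"
    have per: "cos (2 * pi * real k * (x + of_int n)) = cos (2 * pi * real k * x)" for x :: real and n :: int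
    proof -
      have "2 * pi * real k * (x + of_int n) = 2 * pi * real k * x + of_int (int k * n) * (2 * pi)"
        by (simp add: algebra_simps)
      also have "cos \<dots> = cos (2 * pi * real k * x)"
        unfolding cos_add using cos_integer_2pi[of "of_int (int k * n)"] sin_integer_2pi[of "of_int (int k * n)"]
        by (simp add: mult_ac)
      finally show ?thesis .
    qed
    have "((\<lambda>n. integral {0..1} (\<lambda>x. ?h (x + of_int n))) has_sum integral {0..1} (\<lambda>x. \<Sum>\<^sub>\<infinity>n. ?h (x + of_int n))) UNIV"
    proof (rule integral_infsum(2)[OF _ _ M])
      fix n :: int and x :: real assume x: "x \<in> {0..1}"
      have "\<bar>?h (x + of_int n)\<bar> \<le> ?g (x + of_int n) * 1"
        unfolding abs_mult by (intro mult_mono) auto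
      then show "\<bar>?h (x + of_int n)\<bar> \<le> M n" using gM[OF x, of n] by simp
    qed (auto intro!: continuous_intros)
    also have "(\<lambda>x. \<Sum>\<^sub>\<infinity>n. ?h (x + of_int n)) = (\<lambda>x. F x * cos (2 * pi * real k * x))"
      unfolding per F_def by (simp add: infsum_cmult_left')
    finally have "integral {0..1} (\<lambda>x. F x * cos (2 * pi * real k * x)) = (\<integral>x. ?h x \<partial>lborel)"
      by (intro integral_eq_sum_unit_intervals gaussian_cos_integral s) (auto intro!: continuous_intros)
    also have "\<dots> = exp (- ((2 * pi * real k)\<^sup>2 / (4 * pi * s))) / sqrt s"
      by (rule gaussian_cos_integral(2)[OF s])
    also have "(2 * pi * real k)\<^sup>2 / (4 * pi * s) = pi * (real k)\<^sup>2 / s"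
      using s by (simp add: power2_eq_square field_simps)
    finally show ?thesis .
  qed
  have coefG: "integral {0..1} (\<lambda>x. G x * cos (2 * pi * real k * x)) = exp (- (pi * (real k)\<^sup>2 / s))" for k
  proof -
    let ?f = "\<lambda>n x. ?w n * (cos (2 * pi * of_int n * x) * cos (2 * pi * of_int (int k) * x))"
    have "((\<lambda>n. integral {0..1} (?f n)) has_sum integral {0..1} (\<lambda>x. \<Sum>\<^sub>\<infinity>n. ?f n x)) UNIV"
    proof (rule integral_infsum(2)[OF _ _ w])
      fix n :: int and x :: real
      have "\<bar>?f n x\<bar> \<le> ?w n * (1 * 1)"
        unfolding abs_mult by (intro mult_mono) auto
      then show "\<bar>?f n x\<bar> \<le> ?w n" by simp
    qed (auto intro!: continuous_intros)
    also have "(\<lambda>x. \<Sum>\<^sub>\<infinity>n. ?f n x) = (\<lambda>x. G x * cos (2 * pi * real k * x))"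
      unfolding G_def by (simp add: infsum_cmult_left' mult.assoc[symmetric])
    finally have 1: "((\<lambda>n. integral {0..1} (?f n)) has_sum integral {0..1} (\<lambda>x. G x * cos (2 * pi * real k * x))) UNIV" .
    have fn: "integral {0..1} (?f n) = ?w n * (((if n = int k then 1 else 0) + (if n = - int k then 1 else 0)) / 2)" for n
      by (simp only: integral_mult_right cos_mult_integral)
    have "integral {0..1} (?f n) = 0" if "n \<in> UNIV - {int k, - int k}" for n
      using that unfolding fn by simp
    then have "((\<lambda>n. integral {0..1} (?f n)) has_sum (\<Sum>n\<in>{int k, - int k}. integral {0..1} (?f n))) UNIV"
      by (intro has_sum_finite_neutralI[OF _ _ _ refl] finite.insertI finite.emptyI subset_UNIV)
    with 1 have "integral {0..1} (\<lambda>x. G x * cos (2 * pi * real k * x)) = (\<Sum>n\<in>{int k, - int k}. integral {0..1} (?f n))"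
      by (rule has_sum_unique)
    also have "\<dots> = exp (- (pi * (real k)\<^sup>2 / s))"
      unfolding fn by (cases "k = 0") (auto simp: power2_eq_square)
    finally show ?thesis .
  qed
  define D where "D x = F x - G x / sqrt s" for x
  have "D x = 0"
  proof (rule cosine_coefficients_zero[OF _ _ _ x])
    show "continuous_on {0..1} D" unfolding D_def using s by (intro continuous_intros contF contG) auto
    show "D (1 - x) = D x" if "x \<in> {0..1}" for x
    proof -
      have "F (1 - x) = F x"
        unfolding F_def
        by (rule infsum_reindex_bij_witness[of _ "\<lambda>n. - 1 - n" "\<lambda>n. - 1 - n"])
           (auto simp: power2_eq_square algebra_simps)
      moreover have "cos (2 * pi * of_int n * (1 - x)) = cos (2 * pi * of_int n * x)" for n :: int
        using cos_integer_2pi[of "of_int n"] sin_integer_2pi[of "of_int n"]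
        by (simp add: right_diff_distrib cos_diff mult_ac)
      then have "G (1 - x) = G x" unfolding G_def by simp
      ultimately show ?thesis by (simp add: D_def)
    qed
    fix k :: nat
    have "integral {0..1} (\<lambda>x. D x * cos (2 * pi * k * x)) =
      integral {0..1} (\<lambda>x. F x * cos (2 * pi * real k * x) - G x * cos (2 * pi * real k * x) / sqrt s)"
      by (simp add: D_def left_diff_distrib)
    also have "\<dots> = integral {0..1} (\<lambda>x. F x * cos (2 * pi * real k * x)) -
       integral {0..1} (\<lambda>x. G x * cos (2 * pi * real k * x) / sqrt s)"
      using s by (intro integral_diff integrable_continuous_real continuous_intros contF contG) auto
    also have "integral {0..1} (\<lambda>x. G x * cos (2 * pi * real k * x) / sqrt s) = exp (- (pi * (real k)\<^sup>2 / s)) / sqrt s"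
      using integral_mult_left[of "{0..1}" "\<lambda>x. G x * cos (2 * pi * real k * x)" "1 / sqrt s"] coefG[of k] by simp
    finally show "integral {0..1} (\<lambda>x. D x * cos (2 * pi * k * x)) = 0" unfolding coefF by simp
  qed
  then show ?thesis by (simp add: D_def F_def G_def)
qed

section \<open>The four evaluations\<close>

text \<open>Here \<open>A\<close> is phi(-q) and \<open>B\<close> is 2 q^(1/8) psi(q). Summing
  Gaussians at half-integers is dual to an alternating sum at integers, so Poisson summation at 1/2
  turns \<open>B\<close> at \<open>t\<close> into \<open>A\<close> at \<open>s\<close>. Since 2 A /
  B is the cube of the eta quotient, the product is first found as a cube of a nonnegative
  number.\<close>

theorem eta_quotient_transform:
  assumes t: "t > 0" and s: "s > 0" and ts: "2 * t * s = 1"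
  shows "(eta t / eta (2 * t)) * (eta s / eta (2 * s)) = sqrt 2"
proof -
  define A where "A t = ram_theta (- exp (- (2 * pi * t))) (- exp (- (2 * pi * t)))" for t :: real
  define B where "B t = exp (- (pi * t / 4)) * ram_theta 1 (exp (- (2 * pi * t)))" for t :: real
  have A: "A t = (\<Sum>\<^sub>\<infinity>n::int. exp (- (2 * pi * t * of_int (n * n))) * cos (pi * of_int n))" for t
    unfolding A_def ram_theta_def
  proof (rule infsum_cong)
    fix n :: int
    let ?q = "exp (- (2 * pi * t))"
    have ev: "even (tri n + tri (- n)) \<longleftrightarrow> even n"
      using tri_add_tri_minus[of n] by (metis even_mult_iff even_of_nat)
    have "(- ?q) ^ tri n * (- ?q) ^ tri (- n) = (- 1) ^ (tri n + tri (- n)) * ?q ^ (tri n + tri (- n))"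
      by (subst (1 2) power_minus) (simp only: power_add mult_ac)
    also have "?q ^ (tri n + tri (- n)) = exp (- (2 * pi * t * of_int (n * n)))"
      unfolding tri_add_tri_minus[symmetric] by (simp add: exp_of_nat_mult[symmetric] mult_ac)
    also have "(- 1) ^ (tri n + tri (- n)) = cos (pi * of_int n)"
      using ev by (simp add: cos_npi_int minus_one_power_iff)
    finally show "(- ?q) ^ tri n * (- ?q) ^ tri (- n) = exp (- (2 * pi * t * of_int (n * n))) * cos (pi * of_int n)"
      by simp
  qed
  have B: "B t = (\<Sum>\<^sub>\<infinity>n::int. exp (- (pi * t * (1 / 2 + of_int n)\<^sup>2)))" for t
  proof -
    let ?q = "exp (- (2 * pi * t))"
    have "B t = (\<Sum>\<^sub>\<infinity>n. exp (- (pi * t / 4)) * ?q ^ tri (- n))"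
      unfolding B_def ram_theta_def by (simp add: infsum_cmult_right')
    also have "\<dots> = (\<Sum>\<^sub>\<infinity>n::int. exp (- (pi * t * (1 / 2 + of_int n)\<^sup>2)))"
    proof (rule infsum_reindex_bij_witness[of _ "\<lambda>n. n + 1" "\<lambda>n. n - 1"])
      fix n :: int
      have "real (2 * tri (- n)) = of_int n * (of_int n - 1)"
        using arg_cong[OF tri_minus_eq[of n], of real_of_int] by simp
      then have "pi * t / 4 + pi * t * (of_int n * (of_int n - 1)) = pi * t / 4 + real (tri (- n)) * (2 * pi * t)"
        by simp
      moreover have "pi * t * (1 / 2 + of_int (n - 1))\<^sup>2 = pi * t / 4 + pi * t * (of_int n * (of_int n - 1))"
        by (simp add: power2_eq_square algebra_simps)
      ultimately have "pi * t * (1 / 2 + of_int (n - 1))\<^sup>2 = pi * t / 4 + real (tri (- n)) * (2 * pi * t)"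
        by (simp only:)
      then have "exp (- (pi * t * (1 / 2 + of_int (n - 1))\<^sup>2)) = exp (- (pi * t / 4) + real (tri (- n)) * - (2 * pi * t))"
        by simp
      then show "exp (- (pi * t * (1 / 2 + of_int (n - 1))\<^sup>2)) = exp (- (pi * t / 4)) * ?q ^ tri (- n)"
        by (simp only: exp_add exp_of_nat_mult)
    qed auto
    finally show ?thesis .
  qed
  have poisson: "A s = sqrt t * B t" if "t > 0" "s > 0" "2 * t * s = 1" for t s
  proof -
    have "1 / t = 2 * s" using that by (simp add: field_simps)
    then have e: "pi * x / t = 2 * pi * s * x" for x :: real by (metis mult.assoc mult.commute mult_1 times_divide_eq_left)
    have "B t = A s / sqrt t"
      unfolding A B using poisson_gaussian[OF that(1), of "1 / 2"] unfolding e by (simp add: mult_ac)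
    then show ?thesis using that by simp
  qed
  have H: "(eta t / eta (2 * t)) ^ 3 = 2 * A t / B t" "B t > 0" "A t > 0" if t: "t > 0" for t
  proof -
    define q where "q = exp (- (2 * pi * t))"
    define u where "u = exp (- (pi * t / 12))"
    have q: "0 < q" "q < 1" "norm q < 1" "q \<noteq> 0" using t by (auto simp: q_def)
    have u: "u > 0" "u ^ 3 = exp (- (pi * t / 4))" by (auto simp: u_def exp_of_nat_mult[symmetric])
    define e1 where "e1 = euler q" define e2 where "e2 = euler (q\<^sup>2)"
    have pos: "e1 > 0" "e2 > 0"
      using q by (auto simp: e1_def e2_def power_less_one_iff intro!: euler_pos)
    have e: "eta t = u * e1" "eta (2 * t) = u\<^sup>2 * e2"
      unfolding eta_numeral u_def q_def e1_def e2_def by (simp_all add: eta_def)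
    have a: "A t = e1\<^sup>2 / e2"
      using ram_theta_phi[OF q(3,4)] pos unfolding A_def q_def[symmetric] e1_def[symmetric] e2_def[symmetric]
      by (simp add: field_simps)
    have "ram_theta 1 q = 2 * e2\<^sup>2 / e1"
      using ram_theta_psi[OF q(3,4)] pos unfolding e1_def[symmetric] e2_def[symmetric] by (simp add: field_simps)
    then have b: "B t = u ^ 3 * (2 * e2\<^sup>2 / e1)" unfolding B_def u(2) q_def by simp
    show "(eta t / eta (2 * t)) ^ 3 = 2 * A t / B t"
      unfolding a b e using pos u(1) by (simp add: power_divide power_mult_distrib power2_eq_square power3_eq_cube field_simps)
    show "B t > 0" "A t > 0" unfolding a b using pos u(1) by simp_all
  qed
  have "((eta t / eta (2 * t)) * (eta s / eta (2 * s))) ^ 3 = 4 * (A t * A s) / (B t * B s)"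
    unfolding power_mult_distrib H(1)[OF t] H(1)[OF s] by simp
  also have "A t * A s = sqrt (t * s) * (B t * B s)"
    using poisson[OF t s ts] poisson[OF s t] ts by (simp add: mult_ac real_sqrt_mult)
  also have "4 * (sqrt (t * s) * (B t * B s)) / (B t * B s) = 4 * sqrt (t * s)"
    using H(2)[OF t] H(2)[OF s] by simp
  also have "t * s = 1 / 2" using ts by simp
  also have "4 * sqrt (1 / 2) = sqrt 2 ^ 3"
    by (simp add: real_sqrt_divide power3_eq_cube field_simps)
  finally show ?thesis
    by (rule power_eq_imp_eq_base) (use eta_pos t s in \<open>auto intro!: mult_nonneg_nonneg divide_nonneg_nonneg simp: less_imp_le\<close>)
qed

section \<open>Numerical bounds that select the roots\<close>

lemma euler_bounds:
  fixes q :: real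
  assumes q: "0 \<le> q" "q < 1"
  shows "1 - q / (1 - q) \<le> euler q" "euler q \<le> 1"
proof -
  have lim: "(\<lambda>n. \<Prod>k<n. 1 - q * q ^ k) \<longlonglongrightarrow> euler q"
    unfolding euler_def using q by (intro qpoch_inf_LIMSEQ) simp
  have q01: "q * q ^ k \<in> {0..1}" for k
    using q power_le_one[of q "Suc k"] by simp
  have "1 - q / (1 - q) \<le> (\<Prod>k<n. 1 - q * q ^ k)" for n
  proof -
    have "(\<Sum>k<n. q * q ^ k) = q * ((1 - q ^ n) / (1 - q))"
      using q by (simp add: sum_distrib_left[symmetric] sum_gp_strict)
    also have "\<dots> \<le> q / (1 - q)" using q by (simp add: divide_right_mono mult_left_le)
    finally have "1 - q / (1 - q) \<le> 1 - (\<Sum>k<n. q * q ^ k)" by simp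
    also have "\<dots> \<le> (\<Prod>k<n. 1 - q * q ^ k)" by (rule Weierstrass_prod_ineq) (rule q01)
    finally show ?thesis .
  qed
  then show "1 - q / (1 - q) \<le> euler q" by (intro LIMSEQ_le_const[OF lim]) auto
  have "(\<Prod>k<n. 1 - q * q ^ k) \<le> 1" for n
    using q01 by (intro prod_le_1) auto
  then show "euler q \<le> 1" by (intro LIMSEQ_le_const2[OF lim]) auto
qed

text \<open>For \<open>t\<close> at least 1 the exponential prefactors exp(pi t / 3) and exp(pi t /
  2) are at least 2, while every Euler product lies between 49/50 and 1. The thresholds are the
  values of the quotients at which V = 8/V and X = 9/X in the degree 3 equations.\<close>

lemma eta_quotient_lower_bounds:
  assumes t: "t \<ge> 1"
  shows "eta t * eta (3 * t) / (eta (2 * t) * eta (6 * t)) > sqrt 2"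
    and "eta t * eta (2 * t) / (eta (3 * t) * eta (6 * t)) > sqrt 3"
proof -
  define q where "q = exp (- (2 * pi * t))"
  define u where "u = exp (- (pi * t / 12))"
  have t0: "t > 0" using t by simp
  have e2: "exp (1::real) \<ge> 2" using exp_ge_add_one_self[of 1] by simp
  have "q \<le> exp (- 6)" unfolding q_def exp_le_cancel_iff
    using mult_mono[of 3 pi 1 t] pi_gt3 t by simp
  also have "exp (- 6) \<le> (1 / 64 :: real)"
  proof -
    have "(2::real) ^ 6 \<le> exp 1 ^ 6" using e2 by (intro power_mono) auto
    then have "(64::real) \<le> exp 6" by (simp add: exp_of_nat_mult[symmetric])
    then show ?thesis by (simp add: exp_minus field_simps)
  qed
  finally have q: "q > 0" "q \<le> 1 / 64" by (simp_all add: q_def)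
  have b: "49 / 50 \<le> euler x" if "0 \<le> x" "x \<le> 1 / 64" for x :: real
  proof -
    have "x / (1 - x) \<le> 1 / 50" using that by (simp add: field_simps)
    moreover have "1 - x / (1 - x) \<le> euler x" using that by (intro euler_bounds(1)) auto
    ultimately show ?thesis by linarith
  qed
  have qn: "0 \<le> q ^ n" "q ^ n \<le> 1 / 64" "q ^ n < 1" if "n > 0" for n
  proof -
    have "q ^ n \<le> q ^ 1" using q that by (intro power_decreasing) auto
    then show "0 \<le> q ^ n" "q ^ n \<le> 1 / 64" "q ^ n < 1" using q by auto
  qed
  have lo: "49 / 50 \<le> euler (q ^ n)" and hi: "euler (q ^ n) \<le> 1" and pos: "euler (q ^ n) > 0" if "n > 0" for n
    using b[OF qn(1,2)[OF that]] euler_bounds(2)[OF qn(1,3)[OF that]] by simp_all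
  have e: "eta t = u * euler (q ^ 1)" "eta (2 * t) = u ^ 2 * euler (q ^ 2)"
    "eta (3 * t) = u ^ 3 * euler (q ^ 3)" "eta (6 * t) = u ^ 6 * euler (q ^ 6)"
    unfolding eta_numeral u_def q_def by (simp_all add: eta_def)
  have u: "u > 0" by (simp add: u_def)
  have large: "v * (euler (q ^ i) * euler (q ^ j) / (euler (q ^ k) * euler (q ^ l))) \<ge> 2 * (49 / 50 * (49 / 50))"
    if v: "v \<ge> 2" and ijkl: "i > 0" "j > 0" "k > 0" "l > 0" for v i j k l
  proof (rule mult_mono[OF v])
    have "euler (q ^ k) * euler (q ^ l) \<le> 1 * 1"
      using hi[of k] hi[of l] pos[of k] pos[of l] ijkl by (intro mult_mono) auto
    then have "49 / 50 * (49 / 50) * (euler (q ^ k) * euler (q ^ l)) \<le> 49 / 50 * (49 / 50) * 1"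
      by (intro mult_left_mono) auto
    also have "\<dots> \<le> euler (q ^ i) * euler (q ^ j)"
      using lo[of i] lo[of j] ijkl by (simp only: mult_1_right) (intro mult_mono, auto)
    finally show "49 / 50 * (49 / 50) \<le> euler (q ^ i) * euler (q ^ j) / (euler (q ^ k) * euler (q ^ l))"
      using pos[of k] pos[of l] ijkl by (simp add: pos_le_divide_eq)
  qed (use v in auto)
  have ui: "2 \<le> 1 / u ^ n" if "n \<ge> 4" for n
  proof -
    have "3 * 1 \<le> pi * t" by (rule mult_mono) (use pi_gt3 t in auto)
    then have "3 * 4 \<le> pi * t * real n" using that by (intro mult_mono) auto
    then have "1 \<le> real n * (pi * t / 12)" by (simp add: mult_ac)
    then have "exp 1 \<le> exp (real n * (pi * t / 12))" by (simp only: exp_le_cancel_iff)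
    also have "\<dots> = 1 / u ^ n"
    proof -
      have "u ^ n = exp (- (real n * (pi * t / 12)))"
        unfolding u_def exp_of_nat_mult[symmetric] by (simp only: mult_minus_right)
      then show ?thesis by (simp only: exp_minus inverse_eq_divide divide_divide_eq_right mult_1)
    qed
    finally show ?thesis using e2 by simp
  qed
  have s2: "sqrt 2 < 2 * (49 / 50 * (49 / 50))" and s3: "sqrt 3 < 2 * (49 / 50 * (49 / 50))"
    by (rule real_less_lsqrt; simp add: power2_eq_square)+
  have mono4: "u * A * (u ^ 3 * B) / (u ^ 2 * C * (u ^ 6 * D)) = 1 / u ^ 4 * (A * B / (C * D))" for A B C D
  proof -
    have "u * A * (u ^ 3 * B) = u ^ 4 * (A * B)" "u ^ 2 * C * (u ^ 6 * D) = u ^ 4 * (u ^ 4 * (C * D))" by algebra+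
    then have "u * A * (u ^ 3 * B) / (u ^ 2 * C * (u ^ 6 * D)) = (u ^ 4 * (A * B)) / (u ^ 4 * (u ^ 4 * (C * D)))"
      by (simp only:)
    also have "\<dots> = A * B / (u ^ 4 * (C * D))"
      by (rule nonzero_mult_divide_mult_cancel_left) (use u in simp)
    finally show ?thesis by simp
  qed
  have mono6: "u * A * (u ^ 2 * B) / (u ^ 3 * C * (u ^ 6 * D)) = 1 / u ^ 6 * (A * B / (C * D))" for A B C D
  proof -
    have "u * A * (u ^ 2 * B) = u ^ 3 * (A * B)" "u ^ 3 * C * (u ^ 6 * D) = u ^ 3 * (u ^ 6 * (C * D))" by algebra+
    then have "u * A * (u ^ 2 * B) / (u ^ 3 * C * (u ^ 6 * D)) = (u ^ 3 * (A * B)) / (u ^ 3 * (u ^ 6 * (C * D)))"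
      by (simp only:)
    also have "\<dots> = A * B / (u ^ 6 * (C * D))"
      by (rule nonzero_mult_divide_mult_cancel_left) (use u in simp)
    finally show ?thesis by simp
  qed
  have "eta t * eta (3 * t) / (eta (2 * t) * eta (6 * t)) =
     1 / u ^ 4 * (euler (q ^ 1) * euler (q ^ 3) / (euler (q ^ 2) * euler (q ^ 6)))"
    unfolding e by (rule mono4)
  with large[OF ui[of 4], of 1 3 2 6] s2
  show "eta t * eta (3 * t) / (eta (2 * t) * eta (6 * t)) > sqrt 2" by linarith
  have "eta t * eta (2 * t) / (eta (3 * t) * eta (6 * t)) =
     1 / u ^ 6 * (euler (q ^ 1) * euler (q ^ 2) / (euler (q ^ 3) * euler (q ^ 6)))"
    unfolding e by (rule mono6)
  with large[OF ui[of 6], of 1 2 3 6] s3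
  show "eta t * eta (2 * t) / (eta (3 * t) * eta (6 * t)) > sqrt 3" by linarith
qed

section \<open>Solving the system of modular equations\<close>

lemma reciprocal_sum_unique:
  fixes x y :: real
  assumes "x > 1" "y > 1" "x + 1 / x = y + 1 / y"
  shows "x = y"
proof -
  have "(x - y) * (x * y - 1) = 0" using assms by (simp add: field_simps)
  moreover have "x * y > 1" using assms by (simp add: less_1_mult)
  ultimately show ?thesis by simp
qed

lemma one_divide_eqI: "x * y = 1 \<Longrightarrow> 1 / x = y" for x y :: real
  using inverse_unique[of x y] by (simp only: inverse_eq_divide)

text \<open>Both equations are invariant under s -> 1/s, and the square of the first also under w ->
  1/w. In terms of s + 1/s and w + 1/w the system is polynomial, and eliminating the latter leaves
  one equation of degree 8 for the square of the former.\<close>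

lemma class_invariant_system_unique:
  fixes s w :: real
  assumes s: "s > 1" and w: "w > 0"
    and eq3: "w\<^sup>2 - 1 / w\<^sup>2 = 2 * sqrt 2 * (s ^ 3 + 1 / s ^ 3)"
    and eq7: "s ^ 4 + 1 / s ^ 4 = 2 * sqrt 2 * (w + 1 / w) + 7"
  shows "s = (sqrt 7 + sqrt 3) / 2" and "w = 2 * sqrt 2 + sqrt 7"
proof -
  define \<sigma> where "\<sigma> = s + 1 / s"
  define \<omega> where "\<omega> = w + 1 / w"
  define z where "z = \<sigma>\<^sup>2"
  \<comment> \<open>The degree 7 equation reads (z - 5)(z + 1) = 2 sqrt 2 (w + 1/w), so z exceeds 5.
    After the shift, the cofactor of the root y = 2 has positive coefficients only, which rules out
    every other root.\<close>
  define y where "y = z - 5"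
  have r2: "sqrt 2 * sqrt 2 = 2" by simp
  have pos: "\<sigma> > 0" "\<omega> > 0" using s w by (auto simp: \<sigma>_def \<omega>_def intro!: add_pos_pos)
  have s3: "s ^ 3 + 1 / s ^ 3 = \<sigma> ^ 3 - 3 * \<sigma>" unfolding \<sigma>_def using s by (simp add: field_simps) algebra
  have s4: "s ^ 4 + 1 / s ^ 4 = \<sigma> ^ 4 - 4 * \<sigma>\<^sup>2 + 2" unfolding \<sigma>_def using s by (simp add: field_simps) algebra
  have w2: "(w\<^sup>2 - 1 / w\<^sup>2)\<^sup>2 = \<omega>\<^sup>2 * (\<omega>\<^sup>2 - 4)" unfolding \<omega>_def using w by (simp add: field_simps) algebra
  have K: "(z - 5) * (z + 1) = 2 * sqrt 2 * \<omega>"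
    using eq7 unfolding s4 \<omega>_def[symmetric] z_def by algebra
  then have "(z - 5) * (z + 1) > 0" using pos by simp
  moreover have "z + 1 > 0" using zero_le_power2[of \<sigma>] unfolding z_def by linarith
  ultimately have y: "y > 0" unfolding y_def by (simp add: zero_less_mult_iff)
  have K2: "8 * \<omega>\<^sup>2 = ((z - 5) * (z + 1))\<^sup>2" unfolding K by (simp add: power_mult_distrib)
  have "\<omega>\<^sup>2 * (\<omega>\<^sup>2 - 4) = 8 * (\<sigma> ^ 3 - 3 * \<sigma>)\<^sup>2"
    using w2 unfolding eq3 s3 by (simp add: power_mult_distrib)
  also have "(\<sigma> ^ 3 - 3 * \<sigma>)\<^sup>2 = z * (z - 3)\<^sup>2" unfolding z_def by algebra
  finally have "8 * \<omega>\<^sup>2 * (8 * \<omega>\<^sup>2 - 32) = 512 * (z * (z - 3)\<^sup>2)" by algebra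
  then have "((z - 5) * (z + 1))\<^sup>2 * (((z - 5) * (z + 1))\<^sup>2 - 32) = 512 * (z * (z - 3)\<^sup>2)"
    unfolding K2 .
  then have "(y - 2) * (5120 + 8704 * y + 7232 * y ^ 2 + 4064 * y ^ 3 + 1400 * y ^ 4 + 268 * y ^ 5 + 26 * y ^ 6 + y ^ 7) = 0"
    unfolding y_def by algebra
  moreover have "5120 + 8704 * y + 7232 * y ^ 2 + 4064 * y ^ 3 + 1400 * y ^ 4 + 268 * y ^ 5 + 26 * y ^ 6 + y ^ 7 > 0"
    using y by (intro add_pos_pos mult_pos_pos zero_less_power) auto
  ultimately have "y = 2" by auto
  then have z: "z = 7" by (simp add: y_def)
  then have "\<sigma> = sqrt 7" using pos by (simp add: z_def real_sqrt_unique)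
  then have sum_s: "s + 1 / s = sqrt 7" by (simp add: \<sigma>_def)
  have "2 * sqrt 2 * \<omega> = 16" using K z by simp
  then have "sqrt 2 * (2 * sqrt 2 * \<omega>) = 16 * sqrt 2" by simp
  then have sum_w: "w + 1 / w = 4 * sqrt 2" using r2 by (simp add: \<omega>_def algebra_simps)

  have inv_s: "1 / ((sqrt 7 + sqrt 3) / 2) = (sqrt 7 - sqrt 3) / 2"
    by (rule one_divide_eqI) (simp add: field_simps)
  have inv_w: "1 / (2 * sqrt 2 + sqrt 7) = 2 * sqrt 2 - sqrt 7"
    by (rule one_divide_eqI) (simp add: algebra_simps)
  have g1: "sqrt 7 + sqrt 3 > 2" "2 * sqrt 2 + sqrt 7 > 1"
    using add_strict_mono[of 1 "sqrt 7" 1 "sqrt 3"] add_strict_mono[of 0 "2 * sqrt 2" 1 "sqrt 7"] by simp_all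
  show "s = (sqrt 7 + sqrt 3) / 2"
  proof (rule reciprocal_sum_unique[OF s])
    show "s + 1 / s = (sqrt 7 + sqrt 3) / 2 + 1 / ((sqrt 7 + sqrt 3) / 2)"
    proof -
      have "(sqrt 7 + sqrt 3) / 2 + (sqrt 7 - sqrt 3) / 2 = sqrt 7" by (simp add: field_simps)
      then show ?thesis by (simp only: sum_s inv_s)
    qed
  qed (use g1 in simp)
  \<comment> \<open>Squaring had erased the difference between \<open>w\<close> and its reciprocal;
    the sign in \<open>eq3\<close> restores it.\<close>
  have "w > 1"
  proof -
    have "w\<^sup>2 - 1 / w\<^sup>2 > 0" unfolding eq3 using s by (intro mult_pos_pos add_pos_pos) auto
    then have "w\<^sup>2 * w\<^sup>2 > 1" using w by (simp add: field_simps)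
    then have "w ^ 4 > 1" by (simp add: power_add[symmetric])
    then show ?thesis using w power_le_one[of w 4] by (metis not_le less_imp_le)
  qed
  then show "w = 2 * sqrt 2 + sqrt 7"
  proof (rule reciprocal_sum_unique)
    show "w + 1 / w = 2 * sqrt 2 + sqrt 7 + 1 / (2 * sqrt 2 + sqrt 7)"
      unfolding inv_w sum_w by simp
  qed (use g1 in simp)
qed

text \<open>The power of q with exponent (k - 1)/24 is exactly the quotient of the exponential
  prefactors of the two eta values.\<close>

lemma r_eq_eta:
  assumes "k > 0" "n > 0"
  shows "r k n = eta (sqrt (n / k)) / (k powr (1 / 4) * eta (k * sqrt (n / k)))"
proof -
  define t where "t = sqrt (n / k)"
  define q where "q = exp (- 2 * pi * t)"
  have t: "t > 0" using assms by (simp add: t_def)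
  have q: "norm q < 1" "q \<noteq> 0" using t by (auto simp: q_def)
  have qk: "q powr k = exp (- (2 * pi * (k * t)))" by (simp add: q_def powr_def mult_ac)
  have nk: "norm (q powr k) < 1" "q powr k \<noteq> 0" unfolding qk using t assms by auto
  have "q powr ((k - 1) / 24) * exp (- (pi * t / 12)) = exp (- (pi * (k * t) / 12))"
    unfolding exp_add[symmetric] q_def powr_def by (simp add: exp_add[symmetric] field_simps)
  then have "q powr ((k - 1) / 24) = exp (- (pi * (k * t) / 12)) / exp (- (pi * t / 12))"
    by (simp add: field_simps)
  moreover have "eta t = exp (- (pi * t / 12)) * euler q" by (simp add: eta_def q_def)
  moreover have "eta (k * t) = exp (- (pi * (k * t) / 12)) * euler (q powr k)" by (simp add: eta_def qk)
  ultimately show ?thesis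
    unfolding r_def Let_def t_def[symmetric] q_def[symmetric]
    by (simp add: ramanujan_f_eq_euler[OF q] ramanujan_f_eq_euler[OF nk] mult_ac)
qed

lemma eq_powr_half_sixth:
  fixes r A B :: real
  assumes "r > 0" "A > 0" "B > 0" "(r\<^sup>2) ^ 3 = A ^ 3 * B"
  shows "r = A powr (1 / 2) * B powr (1 / 6)"
proof -
  have "r ^ 6 = (A powr (1 / 2) * B powr (1 / 6)) ^ 6"
    using assms by (simp add: power_mult_distrib powr_power power_mult[symmetric])
  then show ?thesis using assms by (intro power_eq_imp_eq_base[of r 6]) auto
qed

theorem theorem4p2:
  shows "r 3 14 = (sqrt 3 + sqrt 2) powr (1 / 2) * (2 * sqrt 2 + sqrt 7) powr (1 / 6) \<and>
    r 3 (7 / 2) = (sqrt 3 + sqrt 2) powr (1 / 2) * (2 * sqrt 2 - sqrt 7) powr (1 / 6) \<and>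
    r 2 21 = 2 powr (- 1 / 2) * (sqrt 7 + sqrt 3) powr (1 / 2) * (2 * sqrt 2 + sqrt 7) powr (1 / 6) \<and>
    r 2 (7 / 3) = 2 powr (- 1 / 2) * (sqrt 7 + sqrt 3) powr (1 / 2) * (2 * sqrt 2 - sqrt 7) powr (1 / 6)"
proof -
  define t where "t = sqrt (7 / 6)"
  define a where "a = eta t" define b where "b = eta (2 * t)"
  define c where "c = eta (3 * t)" define d where "d = eta (6 * t)"
  have t1: "t \<ge> 1" "t > 0" by (simp_all add: t_def)
  have pos: "a > 0" "b > 0" "c > 0" "d > 0" using t1 by (auto simp: a_def b_def c_def d_def eta_pos)
  \<comment> \<open>Normalised so that Y = w^2 and V = 2 sqrt 2 s^3 in the degree 3 equations: 8/V
    then becomes 2 sqrt 2 / s^3, and the ratio and product in degree 7 become 1/s and the cube root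
    of 2 sqrt 2 w.\<close>
  define w where "w = (b * c / (a * d)) ^ 3"
  define s where "s = a * c / (b * d) / sqrt 2"
  define X where "X = (a * b / (c * d)) ^ 2"
  have w: "w > 0" using pos by (simp add: w_def)
  have s: "s > 1"
  proof -
    have "sqrt 2 / sqrt 2 < a * c / (b * d) / sqrt 2"
      using eta_quotient_lower_bounds(1)[OF t1(1)] unfolding a_def b_def c_def d_def
      by (intro divide_strict_right_mono) auto
    then show ?thesis by (simp add: s_def)
  qed
  have Xs: "sqrt 3 < a * b / (c * d)" using eta_quotient_lower_bounds(2)[OF t1(1)]
    by (simp add: a_def b_def c_def d_def)
  have X3: "X > 3"
    using power_strict_mono[OF Xs, of 2] by (simp add: X_def)
  note deg3 = eta_degree_3[OF t1(2), folded a_def b_def c_def d_def, folded X_def]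
  have w2: "w\<^sup>2 = (b * c / (a * d)) ^ 6" by (simp add: w_def power_mult[symmetric])
  have s3: "(a * c / (b * d)) ^ 3 = 2 * sqrt 2 * s ^ 3"
  proof -
    have "a * c / (b * d) = sqrt 2 * s" by (simp add: s_def)
    then show ?thesis by (simp only: power_mult_distrib) (simp add: power3_eq_cube)
  qed
  have eq3: "w\<^sup>2 - 1 / w\<^sup>2 = 2 * sqrt 2 * (s ^ 3 + 1 / s ^ 3)"
  proof -
    have "8 / (2 * sqrt 2 * s ^ 3) = 2 * sqrt 2 * (1 / s ^ 3)" using s by (simp add: field_simps)
    then show ?thesis using deg3(2) unfolding w2[symmetric] s3 by (simp add: distrib_left)
  qed
  have eq7: "s ^ 4 + 1 / s ^ 4 = 2 * sqrt 2 * (w + 1 / w) + 7"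
  proof -
    define t' where "t' = sqrt (3 / 14)"
    have "t' * t = sqrt ((1 / 2)\<^sup>2)"
      unfolding t'_def t_def real_sqrt_mult[symmetric] by (simp add: power2_eq_square)
    then have t': "t' > 0" "2 * t' * t = 1" by (simp_all add: t'_def)
    have "(7 * t')\<^sup>2 = (3 * t)\<^sup>2" by (simp add: t'_def t_def power_mult_distrib)
    then have t7: "7 * t' = 3 * t" by (rule power2_eq_imp_eq) (use t'(1) t1(2) in simp_all)
    have t14: "14 * t' = 6 * t" using t7 by linarith
    have tr: "eta t' / eta (2 * t') = sqrt 2 * b / a"
    proof -
      have "v = sqrt 2 * b / a" if "v * (a / b) = sqrt 2" for v :: real
        using that pos by (simp add: field_simps)
      from this[OF eta_quotient_transform[OF t'(1) t1(2) t'(2), folded a_def b_def]] show ?thesis .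
    qed
    have q1: "sqrt 2 * b / a / (c / d) = 1 / s" "c / d / (sqrt 2 * b / a) = s"
      "sqrt 2 * b / a * (c / d) = sqrt 2 * (b * c / (a * d))"
      using pos by (simp_all add: s_def field_simps)
    have w8: "(sqrt 2 * (b * c / (a * d))) ^ 3 = 2 * sqrt 2 * w"
      unfolding w_def power_mult_distrib[of "sqrt 2"] by (simp add: power3_eq_cube)
    have "(1 / s) ^ 4 + s ^ 4 = 2 * sqrt 2 * w + 8 / (2 * sqrt 2 * w) + 7"
      using eta_degree_7[OF t'(1)] unfolding tr t7 t14 c_def[symmetric] d_def[symmetric] q1 w8 .
    moreover have "8 / (2 * sqrt 2 * w) = 2 * sqrt 2 * (1 / w)" using w by (simp add: field_simps)
    ultimately show ?thesis by (simp add: power_one_over distrib_left)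
  qed
  note sw = class_invariant_system_unique[OF s w eq3 eq7]
  define g where "g = b * c / (a * d)"
  define m where "m = a * c / (b * d)"
  define p where "p = a * b / (c * d)"
  have g: "g > 0" "g ^ 3 = w" using pos by (simp_all add: g_def w_def)
  have m: "m = sqrt 2 * s" by (simp add: m_def s_def)
  have w_inv: "1 / w = 2 * sqrt 2 - sqrt 7"
    unfolding sw(2) by (rule one_divide_eqI) (simp add: algebra_simps)
  have u: "sqrt 3 + sqrt 2 > 1" "sqrt 3 + sqrt 2 > 0"
    using add_strict_mono[of 0 "sqrt 3" 1 "sqrt 2"] add_strict_mono[of 0 "sqrt 3" 0 "sqrt 2"] by simp_all
  \<comment> \<open>The value of \<open>w\<close> gives w^2 + 1/w^2 = 30, so X/3 is the root above 1
    of x + 1/x = 10.\<close>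
  have "X / 3 = (sqrt 3 + sqrt 2)\<^sup>2"
  proof (rule reciprocal_sum_unique)
    have "1 / (sqrt 3 + sqrt 2) = sqrt 3 - sqrt 2"
      by (rule one_divide_eqI) (simp add: algebra_simps)
    then have "1 / (sqrt 3 + sqrt 2)\<^sup>2 = (sqrt 3 - sqrt 2)\<^sup>2" by (metis power_one_over)
    then have 1: "(sqrt 3 + sqrt 2)\<^sup>2 + 1 / (sqrt 3 + sqrt 2)\<^sup>2 = 10"
      by (simp add: power2_eq_square algebra_simps)
    have "1 / w\<^sup>2 = (2 * sqrt 2 - sqrt 7)\<^sup>2" using w_inv by (metis power_one_over)
    then have "w\<^sup>2 + 1 / w\<^sup>2 = 30"
      unfolding sw(2) by (simp add: power2_eq_square algebra_simps)
    then have "X + 9 / X = 30" using deg3(1) unfolding w2[symmetric] by simp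
    then show "X / 3 + 1 / (X / 3) = (sqrt 3 + sqrt 2)\<^sup>2 + 1 / (sqrt 3 + sqrt 2)\<^sup>2"
      unfolding 1 by simp
    show "X / 3 > 1" using X3 by simp
    show "(sqrt 3 + sqrt 2)\<^sup>2 > 1" using u(1) by (simp add: one_less_power)
  qed
  then have "X = 3 * (sqrt 3 + sqrt 2)\<^sup>2" by simp
  also have "\<dots> = (sqrt 3 * (sqrt 3 + sqrt 2))\<^sup>2" by (simp only: power_mult_distrib) simp
  finally have "p\<^sup>2 = (sqrt 3 * (sqrt 3 + sqrt 2))\<^sup>2" by (simp only: X_def p_def)
  moreover have "p \<ge> 0" using pos by (simp add: p_def)
  moreover have "sqrt 3 * (sqrt 3 + sqrt 2) \<ge> 0" using u(2) by (intro mult_nonneg_nonneg less_imp_le) simp_all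
  ultimately have p: "p = sqrt 3 * (sqrt 3 + sqrt 2)" by (rule power2_eq_imp_eq)
  \<comment> \<open>The squares of the four wanted quotients are products or quotients of the three
    known ones. Only the cube \<open>w\<close> of \<open>g\<close> is explicit, which is the source
    of the exponent 1/6 next to 1/2.\<close>
  have pm: "(b / d)\<^sup>2 = p * g" "(a / c)\<^sup>2 = p / g" "(c / d)\<^sup>2 = m * g" "(a / b)\<^sup>2 = m / g"
    unfolding p_def g_def m_def power2_eq_square using pos by simp_all
  have root4: "(k powr (1 / 4))\<^sup>2 = sqrt k" if "k > 0" for k :: real
    using that by (simp add: powr_power powr_half_sqrt)
  have t_eqs: "sqrt (14 / 3) = 2 * t" "sqrt (7 / 2 / 3) = t" "sqrt (21 / 2) = 3 * t" "sqrt (7 / 3 / 2) = t"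
    by (rule real_sqrt_unique; simp add: t_def power_mult_distrib)+
  have r1: "r 3 14 = b / d / 3 powr (1 / 4)"
    using r_eq_eta[of 3 14, unfolded t_eqs] by (simp add: b_def d_def)
  have r2: "r 3 (7 / 2) = a / c / 3 powr (1 / 4)"
    using r_eq_eta[of 3 "7 / 2", unfolded t_eqs] by (simp add: a_def c_def)
  have r3: "r 2 21 = c / d / 2 powr (1 / 4)"
    using r_eq_eta[of 2 21, unfolded t_eqs] by (simp add: c_def d_def)
  have r4: "r 2 (7 / 3) = a / b / 2 powr (1 / 4)"
    using r_eq_eta[of 2 "7 / 3", unfolded t_eqs] by (simp add: a_def b_def)
  have v1: "r 3 14 = (sqrt 3 + sqrt 2) powr (1 / 2) * w powr (1 / 6)"
  proof (rule eq_powr_half_sixth)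
    have "(r 3 14)\<^sup>2 = (sqrt 3 + sqrt 2) * g"
      unfolding r1 power_divide[of _ "3 powr (1 / 4)"] pm root4[of 3, simplified] p by simp
    then show "((r 3 14)\<^sup>2) ^ 3 = (sqrt 3 + sqrt 2) ^ 3 * w" by (simp add: power_mult_distrib g(2))
  qed (use pos u w in \<open>auto simp: r1\<close>)
  have v2: "r 3 (7 / 2) = (sqrt 3 + sqrt 2) powr (1 / 2) * (1 / w) powr (1 / 6)"
  proof (rule eq_powr_half_sixth)
    have "(r 3 (7 / 2))\<^sup>2 = (sqrt 3 + sqrt 2) / g"
      unfolding r2 power_divide[of _ "3 powr (1 / 4)"] pm root4[of 3, simplified] p by simp
    then show "((r 3 (7 / 2))\<^sup>2) ^ 3 = (sqrt 3 + sqrt 2) ^ 3 * (1 / w)" by (simp add: power_divide g(2))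
  qed (use pos u w in \<open>auto simp: r2\<close>)
  have v3: "r 2 21 = s powr (1 / 2) * w powr (1 / 6)"
  proof (rule eq_powr_half_sixth)
    have "(r 2 21)\<^sup>2 = s * g"
      unfolding r3 power_divide[of _ "2 powr (1 / 4)"] pm root4[of 2, simplified] m by simp
    then show "((r 2 21)\<^sup>2) ^ 3 = s ^ 3 * w" by (simp add: power_mult_distrib g(2))
  qed (use pos s w in \<open>auto simp: r3\<close>)
  have v4: "r 2 (7 / 3) = s powr (1 / 2) * (1 / w) powr (1 / 6)"
  proof (rule eq_powr_half_sixth)
    have "(r 2 (7 / 3))\<^sup>2 = s / g"
      unfolding r4 power_divide[of _ "2 powr (1 / 4)"] pm root4[of 2, simplified] m by simp
    then show "((r 2 (7 / 3))\<^sup>2) ^ 3 = s ^ 3 * (1 / w)" by (simp add: power_divide g(2))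
  qed (use pos s w in \<open>auto simp: r4\<close>)
  have sp: "s powr (1 / 2) = 2 powr (- 1 / 2) * (sqrt 7 + sqrt 3) powr (1 / 2)"
  proof -
    have "s powr (1 / 2) = (sqrt 7 + sqrt 3) powr (1 / 2) / 2 powr (1 / 2)"
      unfolding sw(1) by (rule powr_divide)
    also have "\<dots> = 2 powr (- (1 / 2)) * (sqrt 7 + sqrt 3) powr (1 / 2)"
      by (simp only: powr_minus divide_inverse mult.commute)
    finally show ?thesis by (simp only: minus_divide_left)
  qed
  show ?thesis
    using v1[unfolded sw(2)] v2[unfolded w_inv] v3[unfolded sp sw(2)] v4[unfolded sp w_inv]
    by (intro conjI)
qed

end
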